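(* Let $A$ be an abelian group for which there is a set $\pi$ of primes such that for every $n\in\mathbb{N}$ the subgroup $\{a\in A: a^n=1\}$ is cyclic of order $n_\pi$ (the $\pi$-part of $n$). Let $G$ and $H$ be finite groups, let $(U,\phi)\in\mathcal{M}_{G\times H}$, and set $X:=\left(\frac{G\times H}{U,\phi}\right)$. Assume that $p_1(U)=G$, $p_2(U)=H$, set $K:=k_1(U)$, $L:=k_2(U)$, and assume that $\kappa:=\phi_1\in K^*$ and $\lambda:=\phi_2\in L^*$ are faithful (injective). Then there exists a decomposition $$X\cong\mathrm{Ins}_{\tilde G}^G\otimes_{A\tilde G}Y\otimes_{A\tilde H}\mathrm{Del}^H_{\tilde H}$$ with the following properties: (a) The group $\tilde G$ is a central extension of $G/K$ by $\tilde K:=K\cap G'$ and the group $\tilde H$ is a central extension of $H/L$ by $\tilde L:=L\cap H'$. (b) One has an isomorphism $Y\cong\left(\frac{\tilde G\times\tilde H}{\tilde U,\tilde\phi}\right)$ for a reduced pair $(\tilde U,\tilde\phi)\in\mathcal{M}_{\tilde G\times\tilde H}$ satisfying $$k_1(\tilde U)=\tilde K,\quad k_2(\tilde U)=\tilde L,\quad \tilde\phi_1=\kappa|_{\tilde K},\quad\tilde\phi_2=\lambda|_{\tilde L}.$$ Here $\mathrm{Ins}_{\tilde G}^G$ denotes an insertion biset for $(G,K,\kappa)$ and $\mathrm{Del}^H_{\tilde H}$ a deletion biset for $(H,L,\lambda)$, as defined in the context.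
   Context: $A$ is written multiplicatively. For a finite group $U$, $U^*=\mathrm{Hom}(U,A)$; $G'$ is the commutator subgroup. $\mathcal{M}_G$ is the set of pairs $(K,\kappa)$ with $K\le G$, $\kappa\in K^*$; $\mathcal{M}_G^G$ the subset with $K\trianglelefteq G$ and $\kappa(gxg^{-1})=\kappa(x)$ for all $g\in G$, $x\in K$. For $(U,\phi)\in\mathcal{M}_{G\times H}$: $p_1(U)\le G$, $p_2(U)\le H$ are the projections, $k_1(U)=\{g:(g,1)\in U\}$, $k_2(U)=\{h:(1,h)\in U\}$, and $\phi_i\in k_i(U)^*$ are defined by $\phi(g,h)=\phi_1(g)\phi_2(h)^{-1}$ on $k_1(U)\times k_2(U)$. **Fibered bisets.** An $A$-fibered $(G,H)$-biset is a left $A\times G\times H$-set, free as an $A$-set with finitely many $A$-orbits. $\left(\frac{G\times H}{U,\phi}\right)=(A\times G\times H)/U_\phi$ with $U_\phi=\{(\phi(u)^{-1},u):u\in U\}$. For an $A$-fibered $(G,H)$-biset $X$ and an $A$-fibered $(H,I)$-biset $Y$, let $A\times H$ act on $X\times Y$ by $(a,h)\cdot(x,y)=((a^{-1},1,h)x,(a,h,1)y)$; the orbit set is an $A\times G\times I$-set via $(a,g,i)[x,y]=[(a,g,1)x,(1,1,i)y]$, and $X\otimes_{AH}Y$ is its subset of elements with trivial stabilizer in $A$. The opposite of an $A$-fibered $(G,H)$-biset $X$ is $X^{\mathrm{op}}=X$ as a set with $A\times H\times G$-action $(a,h,g)x:=(a^{-1},g,h)x$. **Insertion and deletion.** Let $G$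 be a finite group, $K\le Z(G)$, $\kappa\in K^*$ injective, $\tilde K=K\cap G'$. An insertion biset for $(G,K,\kappa)$ is any $\mathrm{Ins}_{\tilde G}^G=\left(\frac{G\times\tilde G}{M,\mu}\right)$, where $1\to\tilde K\to\tilde G\to G/K\to1$ is a short exact sequence of groups such that the image of $\tilde K$ (identified with $\tilde K$) lies in $Z(\tilde G)\cap\tilde G'$, and $(M,\mu)\in\mathcal{M}_{G\times\tilde G}$ satisfies $p_1(M)=G$, $k_1(M)=K$, $\mu_1=\kappa$, $p_2(M)=\tilde G$, $k_2(M)=\tilde K$, $\mu_2=\kappa|_{\tilde K}$. A deletion biset is $\mathrm{Del}^G_{\tilde G}=(\mathrm{Ins}_{\tilde G}^G)^{\mathrm{op}}$. (These are not uniquely determined by $(G,K,\kappa)$. In the situation of the claim $K\le Z(G)$ and $L\le Z(H)$ hold automatically.) **Reduced pairs.** Let $k$ be a nonzero commutative ring (the notion does not depend on it). $B_k^A(G,H)$ is the free $k$-module on isomorphism classes $\left[\frac{G\times H}{U,\phi}\right]$ of transitive $A$-fibered $(G,H)$-bisets ($(U,\phi)$ up to $G\times H$-conjugacy), with bilinear compositions induced by the tensor product. $I_G=\sum_{|H|<|G|}B_k^A(G,H)\cdot B_k^A(H,G)\subseteq B_k^A(G,G)$. For $(K,\kappa)\in\mathcal{M}_G^G$, $e_{(K,\kappa)}=\left[\frac{G\times G}{\Delta_K(G),\phi_\kappa}\right]$ with $\Delta_K(G)=\{(g_1,g_2):g_1K=g_2K\}$, $\phi_\kappa(g_1,g_2)=\kappa(g_1g_2^{-1})$.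 $\mathcal{R}_G=\{(K,\kappa)\in\mathcal{M}_G^G:e_{(K,\kappa)}\notin I_G\}$. A pair $(U,\phi)\in\mathcal{M}_{G\times H}$ with $p_1(U)=G$ and $p_2(U)=H$ is called reduced if $(k_1(U),\phi_1)\in\mathcal{R}_G$ and $(k_2(U),\phi_2)\in\mathcal{R}_H$. *)

theory Defs
  imports
    Complex_Main
    "HOL-Algebra.Group_Action"
    "HOL-Algebra.Left_Coset"
    "HOL-Algebra.Elementary_Groups"
    "HOL-Computational_Algebra.Primes"
    "HOL-Library.Poly_Mapping"
begin

section \<open>Characters and character pairs\<close>

definition pi_part :: "nat set \<Rightarrow> nat \<Rightarrow> nat" where
  "pi_part \<pi> n = (\<Prod>p\<in>\<pi> \<inter> prime_factors n. p ^ multiplicity p n)"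

definition centre :: "'g monoid \<Rightarrow> 'g set" where
  "centre G = {z \<in> carrier G. \<forall>g\<in>carrier G. z \<otimes>\<^bsub>G\<^esub> g = g \<otimes>\<^bsub>G\<^esub> z}"

text \<open>
  \<open>U\<^sup>* = Hom(U, A)\<close> for \<open>U \<le> G\<close>. Characters are extensional functions (\<open>undefined\<close> outside \<open>U\<close>),
  so that equality of characters, and hence of pairs \<open>(U, \<phi>)\<close>, is equality in HOL.
\<close>

definition characters :: "'a monoid \<Rightarrow> 'g monoid \<Rightarrow> 'g set \<Rightarrow> ('g \<Rightarrow> 'a) set" where
  "characters A G U = hom (G\<lparr>carrier := U\<rparr>) A \<inter> extensional U"

definition char_pairs :: "'a monoid \<Rightarrow> 'g monoid \<Rightarrow> ('g set \<times> ('g \<Rightarrow> 'a)) set" where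
  "char_pairs A G = {(K, \<kappa>). subgroup K G \<and> \<kappa> \<in> characters A G K}"

definition stable_char_pairs :: "'a monoid \<Rightarrow> 'g monoid \<Rightarrow> ('g set \<times> ('g \<Rightarrow> 'a)) set" where
  "stable_char_pairs A G = {(K, \<kappa>) \<in> char_pairs A G. K \<lhd> G \<and>
     (\<forall>g\<in>carrier G. \<forall>x\<in>K. \<kappa> (g \<otimes>\<^bsub>G\<^esub> x \<otimes>\<^bsub>G\<^esub> inv\<^bsub>G\<^esub> g) = \<kappa> x)}"

text \<open>
  For \<open>U \<le> G \<times> H\<close> the projections \<open>p\<^sub>1(U)\<close> and \<open>p\<^sub>2(U)\<close> are written \<open>fst ` U\<close> and \<open>snd ` U\<close>.
  The convention \<open>\<phi>(g, h) = \<phi>\<^sub>1(g) \<phi>\<^sub>2(h)\<^sup>-\<^sup>1\<close> on \<open>k\<^sub>1(U) \<times> k\<^sub>2(U)\<close> amounts to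
  \<open>\<phi>\<^sub>1(g) = \<phi>(g, 1)\<close> and \<open>\<phi>\<^sub>2(h) = \<phi>(1, h)\<^sup>-\<^sup>1\<close>.
\<close>

definition k1 :: "'g monoid \<Rightarrow> 'h monoid \<Rightarrow> ('g \<times> 'h) set \<Rightarrow> 'g set" where
  "k1 G H U = {g \<in> carrier G. (g, \<one>\<^bsub>H\<^esub>) \<in> U}"

definition k2 :: "'g monoid \<Rightarrow> 'h monoid \<Rightarrow> ('g \<times> 'h) set \<Rightarrow> 'h set" where
  "k2 G H U = {h \<in> carrier H. (\<one>\<^bsub>G\<^esub>, h) \<in> U}"

definition char1 ::
  "'g monoid \<Rightarrow> 'h monoid \<Rightarrow> ('g \<times> 'h) set \<Rightarrow> ('g \<times> 'h \<Rightarrow> 'a) \<Rightarrow> 'g \<Rightarrow> 'a" where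
  "char1 G H U \<phi> = (\<lambda>g\<in>k1 G H U. \<phi> (g, \<one>\<^bsub>H\<^esub>))"

definition char2 ::
  "'a monoid \<Rightarrow> 'g monoid \<Rightarrow> 'h monoid \<Rightarrow> ('g \<times> 'h) set \<Rightarrow> ('g \<times> 'h \<Rightarrow> 'a) \<Rightarrow> 'h \<Rightarrow> 'a" where
  "char2 A G H U \<phi> = (\<lambda>h\<in>k2 G H U. inv\<^bsub>A\<^esub> \<phi> (\<one>\<^bsub>G\<^esub>, h))"


section \<open>Fibered bisets\<close>

record ('a, 'g, 'h, 'x) fbiset =
  pts :: "'x set"
  act :: "'a \<times> 'g \<times> 'h \<Rightarrow> 'x \<Rightarrow> 'x"

definition fibered_biset ::
  "'a monoid \<Rightarrow> 'g monoid \<Rightarrow> 'h monoid \<Rightarrow> ('a, 'g, 'h, 'x) fbiset \<Rightarrow> bool" where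
  "fibered_biset A G H X \<longleftrightarrow>
     group_action (A \<times>\<times> G \<times>\<times> H) (pts X) (act X) \<and>
     (\<forall>x\<in>pts X. stabilizer A (\<lambda>a. act X (a, \<one>\<^bsub>G\<^esub>, \<one>\<^bsub>H\<^esub>)) x = {\<one>\<^bsub>A\<^esub>}) \<and>
     finite (orbits A (pts X) (\<lambda>a. act X (a, \<one>\<^bsub>G\<^esub>, \<one>\<^bsub>H\<^esub>)))"

definition fbiset_iso ::
  "'a monoid \<Rightarrow> 'g monoid \<Rightarrow> 'h monoid \<Rightarrow>
   ('a, 'g, 'h, 'x) fbiset \<Rightarrow> ('a, 'g, 'h, 'y) fbiset \<Rightarrow> bool" where
  "fbiset_iso A G H X Y \<longleftrightarrow>
     (\<exists>f. bij_betw f (pts X) (pts Y) \<and>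
          (\<forall>t\<in>carrier (A \<times>\<times> G \<times>\<times> H). \<forall>x\<in>pts X. f (act X t x) = act Y t (f x)))"

definition twisted_graph :: "'a monoid \<Rightarrow> ('u set) \<Rightarrow> ('u \<Rightarrow> 'a) \<Rightarrow> ('a \<times> 'u) set" where
  "twisted_graph A U \<phi> = {(inv\<^bsub>A\<^esub> \<phi> u, u) |u. u \<in> U}"

definition trans_biset ::
  "'a monoid \<Rightarrow> 'g monoid \<Rightarrow> 'h monoid \<Rightarrow> ('g \<times> 'h) set \<Rightarrow> ('g \<times> 'h \<Rightarrow> 'a) \<Rightarrow>
   ('a, 'g, 'h, ('a \<times> 'g \<times> 'h) set) fbiset" where
  "trans_biset A G H U \<phi> =
     (let T = A \<times>\<times> G \<times>\<times> H; C = lcosets\<^bsub>T\<^esub> (twisted_graph A U \<phi>)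
      in \<lparr>pts = C, act = (\<lambda>t. \<lambda>c\<in>C. t <#\<^bsub>T\<^esub> c)\<rparr>)"

definition op_biset ::
  "'a monoid \<Rightarrow> ('a, 'g, 'h, 'x) fbiset \<Rightarrow> ('a, 'h, 'g, 'x) fbiset" where
  "op_biset A X = \<lparr>pts = pts X, act = (\<lambda>(a, h, g). act X (inv\<^bsub>A\<^esub> a, g, h))\<rparr>"

text \<open>
  In the tensor product over \<open>A \<times> H\<close>, the action of \<open>(a, g, i)\<close> on the orbit of \<open>(x, y)\<close> is given by
  taking the image of the whole orbit; since the two actions on \<open>X \<times> Y\<close> commute, this is the
  orbit of \<open>((a, g, 1) x, (1, 1, i) y)\<close>.
\<close>

definition mid_action ::
  "'a monoid \<Rightarrow> 'g monoid \<Rightarrow> 'i monoid \<Rightarrow>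
   ('a, 'g, 'h, 'x) fbiset \<Rightarrow> ('a, 'h, 'i, 'y) fbiset \<Rightarrow> 'a \<times> 'h \<Rightarrow> 'x \<times> 'y \<Rightarrow> 'x \<times> 'y" where
  "mid_action A G I X Y = (\<lambda>(a, h). \<lambda>(x, y)\<in>pts X \<times> pts Y.
     (act X (inv\<^bsub>A\<^esub> a, \<one>\<^bsub>G\<^esub>, h) x, act Y (a, h, \<one>\<^bsub>I\<^esub>) y))"

definition outer_action ::
  "'a monoid \<Rightarrow> 'h monoid \<Rightarrow>
   ('a, 'g, 'h, 'x) fbiset \<Rightarrow> ('a, 'h, 'i, 'y) fbiset \<Rightarrow>
   'a \<times> 'g \<times> 'i \<Rightarrow> ('x \<times> 'y) set \<Rightarrow> ('x \<times> 'y) set" where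
  "outer_action A H X Y = (\<lambda>(a, g, i) c.
     (\<lambda>(x, y). (act X (a, g, \<one>\<^bsub>H\<^esub>) x, act Y (\<one>\<^bsub>A\<^esub>, \<one>\<^bsub>H\<^esub>, i) y)) ` c)"

definition tensor ::
  "'a monoid \<Rightarrow> 'g monoid \<Rightarrow> 'h monoid \<Rightarrow> 'i monoid \<Rightarrow>
   ('a, 'g, 'h, 'x) fbiset \<Rightarrow> ('a, 'h, 'i, 'y) fbiset \<Rightarrow> ('a, 'g, 'i, ('x \<times> 'y) set) fbiset" where
  "tensor A G H I X Y =
     (let C = {c \<in> orbits (A \<times>\<times> H) (pts X \<times> pts Y) (mid_action A G I X Y).
                 stabilizer A (\<lambda>a. outer_action A H X Y (a, \<one>\<^bsub>G\<^esub>, \<one>\<^bsub>I\<^esub>)) c = {\<one>\<^bsub>A\<^esub>}}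
      in \<lparr>pts = C, act = (\<lambda>t. restrict (outer_action A H X Y t) C)\<rparr>)"


section \<open>The modules \<open>B(G, H)\<close> and reduced pairs\<close>

text \<open>
  The isomorphism class of a transitive biset \<open>X\<close> is represented by the set of all \<open>(U, \<phi>)\<close> with
  \<open>X \<cong> (A \<times> G \<times> H) / U\<^sub>\<phi>\<close>. As every transitive fibered biset is isomorphic to such a quotient,
  this is a complete isomorphism invariant, and it does not depend on the type of points of \<open>X\<close>.
\<close>

type_synonym ('a, 'g, 'h) biset_class = "(('g \<times> 'h) set \<times> ('g \<times> 'h \<Rightarrow> 'a)) set"

definition iso_class ::
  "'a monoid \<Rightarrow> 'g monoid \<Rightarrow> 'h monoid \<Rightarrow> ('a, 'g, 'h, 'x) fbiset \<Rightarrow> ('a, 'g, 'h) biset_class" where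
  "iso_class A G H X =
     {(U, \<phi>) \<in> char_pairs A (G \<times>\<times> H). fbiset_iso A G H X (trans_biset A G H U \<phi>)}"

definition fib_module ::
  "'a monoid \<Rightarrow> 'g monoid \<Rightarrow> 'h monoid \<Rightarrow> (('a, 'g, 'h) biset_class \<Rightarrow>\<^sub>0 'k::comm_ring_1) set" where
  "fib_module A G H = {x. Poly_Mapping.keys x \<subseteq>
     {iso_class A G H (trans_biset A G H U \<phi>) |U \<phi>. (U, \<phi>) \<in> char_pairs A (G \<times>\<times> H)}}"

abbreviation fib_scale :: "'k::comm_ring_1 \<Rightarrow> ('b \<Rightarrow>\<^sub>0 'k) \<Rightarrow> ('b \<Rightarrow>\<^sub>0 'k)" where
  "fib_scale c \<equiv> Poly_Mapping.map ((*) c)"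

lemma module_fib_scale:
  "Modules.module (fib_scale :: 'k::comm_ring_1 \<Rightarrow> ('b \<Rightarrow>\<^sub>0 'k) \<Rightarrow> ('b \<Rightarrow>\<^sub>0 'k))"
  by standard
    (auto intro!: poly_mapping_eqI
      simp: lookup_add Poly_Mapping.map.rep_eq when_def distrib_right mult.assoc simp flip: distrib_left)

text \<open>The class \<open>[X]\<close> of an arbitrary fibered biset is the sum of the classes of its orbits.\<close>

definition fib_element ::
  "'a monoid \<Rightarrow> 'g monoid \<Rightarrow> 'h monoid \<Rightarrow> ('a, 'g, 'h, 'x) fbiset \<Rightarrow>
   (('a, 'g, 'h) biset_class \<Rightarrow>\<^sub>0 'k::comm_ring_1)" where
  "fib_element A G H X =
     (\<Sum>c\<in>orbits (A \<times>\<times> G \<times>\<times> H) (pts X) (act X).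
        Poly_Mapping.single (iso_class A G H \<lparr>pts = c, act = (\<lambda>t. restrict (act X t) c)\<rparr>) 1)"

definition class_rep ::
  "'a monoid \<Rightarrow> 'g monoid \<Rightarrow> 'h monoid \<Rightarrow> ('a, 'g, 'h) biset_class \<Rightarrow>
   ('a, 'g, 'h, ('a \<times> 'g \<times> 'h) set) fbiset" where
  "class_rep A G H b = (case SOME u. u \<in> b of (U, \<phi>) \<Rightarrow> trans_biset A G H U \<phi>)"

definition fib_comp ::
  "'a monoid \<Rightarrow> 'g monoid \<Rightarrow> 'h monoid \<Rightarrow> 'i monoid \<Rightarrow>
   (('a, 'g, 'h) biset_class \<Rightarrow>\<^sub>0 'k) \<Rightarrow> (('a, 'h, 'i) biset_class \<Rightarrow>\<^sub>0 'k) \<Rightarrow>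
   (('a, 'g, 'i) biset_class \<Rightarrow>\<^sub>0 'k::comm_ring_1)" where
  "fib_comp A G H I x y =
     (\<Sum>b\<in>Poly_Mapping.keys x. \<Sum>c\<in>Poly_Mapping.keys y.
        fib_scale (Poly_Mapping.lookup x b * Poly_Mapping.lookup y c)
          (fib_element A G I (tensor A G H I (class_rep A G H b) (class_rep A H I c))))"

text \<open>
  \<open>I\<^sub>G\<close>: the sum runs over all finite groups \<open>H\<close> with \<open>|H| < |G|\<close>. Up to isomorphism these all have
  a carrier in \<open>nat\<close>, and the submodule \<open>B(G, H) \<cdot> B(H, G)\<close> only depends on \<open>H\<close> up to isomorphism.
\<close>

definition lower_ideal ::
  "'a monoid \<Rightarrow> 'g monoid \<Rightarrow> (('a, 'g, 'g) biset_class \<Rightarrow>\<^sub>0 'k::comm_ring_1) set" where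
  "lower_ideal A G = Modules.module.span fib_scale
     (\<Union>H\<in>{H :: nat monoid. group H \<and> finite (carrier H) \<and> order H < order G}.
        {fib_comp A G H G x y |x y. x \<in> fib_module A G H \<and> y \<in> fib_module A H G})"

definition diag_mod :: "'g monoid \<Rightarrow> 'g set \<Rightarrow> ('g \<times> 'g) set" where
  "diag_mod G K =
     {(g1, g2) \<in> carrier G \<times> carrier G. g1 <#\<^bsub>G\<^esub> K = g2 <#\<^bsub>G\<^esub> K}"

definition diag_char :: "'g monoid \<Rightarrow> 'g set \<Rightarrow> ('g \<Rightarrow> 'a) \<Rightarrow> 'g \<times> 'g \<Rightarrow> 'a" where
  "diag_char G K \<kappa> = (\<lambda>(g1, g2)\<in>diag_mod G K. \<kappa> (g1 \<otimes>\<^bsub>G\<^esub> inv\<^bsub>G\<^esub> g2))"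

definition e_elem ::
  "'a monoid \<Rightarrow> 'g monoid \<Rightarrow> 'g set \<Rightarrow> ('g \<Rightarrow> 'a) \<Rightarrow>
   (('a, 'g, 'g) biset_class \<Rightarrow>\<^sub>0 'k::comm_ring_1)" where
  "e_elem A G K \<kappa> = Poly_Mapping.single
     (iso_class A G G (trans_biset A G G (diag_mod G K) (diag_char G K \<kappa>))) 1"

text \<open>The coefficient ring \<open>k\<close> is passed as a type; \<open>comm_ring_1\<close> includes \<open>0 \<noteq> 1\<close>.\<close>

definition R_pairs ::
  "'k::comm_ring_1 itself \<Rightarrow> 'a monoid \<Rightarrow> 'g monoid \<Rightarrow> ('g set \<times> ('g \<Rightarrow> 'a)) set" where
  "R_pairs k A G = {(K, \<kappa>) \<in> stable_char_pairs A G.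
     (e_elem A G K \<kappa> :: ('a, 'g, 'g) biset_class \<Rightarrow>\<^sub>0 'k) \<notin> lower_ideal A G}"

definition reduced_pair ::
  "'k::comm_ring_1 itself \<Rightarrow> 'a monoid \<Rightarrow> 'g monoid \<Rightarrow> 'h monoid \<Rightarrow>
   ('g \<times> 'h) set \<Rightarrow> ('g \<times> 'h \<Rightarrow> 'a) \<Rightarrow> bool" where
  "reduced_pair k A G H U \<phi> \<longleftrightarrow>
     (U, \<phi>) \<in> char_pairs A (G \<times>\<times> H) \<and> fst ` U = carrier G \<and> snd ` U = carrier H \<and>
     (k1 G H U, char1 G H U \<phi>) \<in> R_pairs k A G \<and>
     (k2 G H U, char2 A G H U \<phi>) \<in> R_pairs k A H"


section \<open>Insertion and deletion bisets\<close>

definition short_exact ::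
  "'n monoid \<Rightarrow> 'e monoid \<Rightarrow> 'q monoid \<Rightarrow> ('n \<Rightarrow> 'e) \<Rightarrow> ('e \<Rightarrow> 'q) \<Rightarrow> bool" where
  "short_exact N E Q i p \<longleftrightarrow>
     group N \<and> group E \<and> group Q \<and> i \<in> hom N E \<and> p \<in> hom E Q \<and>
     inj_on i (carrier N) \<and> p ` carrier E = carrier Q \<and> kernel E Q p = i ` carrier N"

definition central_extension ::
  "'n monoid \<Rightarrow> 'e monoid \<Rightarrow> 'q monoid \<Rightarrow> ('n \<Rightarrow> 'e) \<Rightarrow> ('e \<Rightarrow> 'q) \<Rightarrow> bool" where
  "central_extension N E Q i p \<longleftrightarrow> short_exact N E Q i p \<and> i ` carrier N \<subseteq> centre E"

text \<open>
  The identification of \<open>K \<inter> G'\<close> with its image in the extension \<open>Gt\<close> is kept explicit as the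
  embedding \<open>i\<close>, since other data have to be compared along the same embedding.
\<close>

definition insertion_biset ::
  "'a monoid \<Rightarrow> 'g monoid \<Rightarrow> 'g set \<Rightarrow> ('g \<Rightarrow> 'a) \<Rightarrow>
   'e monoid \<Rightarrow> ('g \<Rightarrow> 'e) \<Rightarrow> ('e \<Rightarrow> 'g set) \<Rightarrow>
   ('a, 'g, 'e, ('a \<times> 'g \<times> 'e) set) fbiset \<Rightarrow> bool" where
  "insertion_biset A G K \<kappa> Gt i p X \<longleftrightarrow>
     (let Kt = K \<inter> derived G (carrier G) in
      group G \<and> finite (carrier G) \<and>
      subgroup K G \<and> K \<subseteq> centre G \<and> \<kappa> \<in> characters A G K \<and> inj_on \<kappa> K \<and>
      short_exact (G\<lparr>carrier := Kt\<rparr>) Gt (G Mod K) i p \<and>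
      i ` Kt \<subseteq> centre Gt \<inter> derived Gt (carrier Gt) \<and>
      (\<exists>M \<mu>. (M, \<mu>) \<in> char_pairs A (G \<times>\<times> Gt) \<and>
         fst ` M = carrier G \<and> k1 G Gt M = K \<and> char1 G Gt M \<mu> = \<kappa> \<and>
         snd ` M = carrier Gt \<and> k2 G Gt M = i ` Kt \<and>
         (\<forall>x\<in>Kt. char2 A G Gt M \<mu> (i x) = \<kappa> x) \<and>
         X = trans_biset A G Gt M \<mu>))"

definition deletion_biset ::
  "'a monoid \<Rightarrow> 'g monoid \<Rightarrow> 'g set \<Rightarrow> ('g \<Rightarrow> 'a) \<Rightarrow>
   'e monoid \<Rightarrow> ('g \<Rightarrow> 'e) \<Rightarrow> ('e \<Rightarrow> 'g set) \<Rightarrow>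
   ('a, 'e, 'g, ('a \<times> 'g \<times> 'e) set) fbiset \<Rightarrow> bool" where
  "deletion_biset A G K \<kappa> Gt i p D \<longleftrightarrow>
     (\<exists>X. insertion_biset A G K \<kappa> Gt i p X \<and> D = op_biset A X)"

end

theory Submission
  imports Defs
    "HOL-Algebra.Multiplicative_Group" "HOL-Algebra.Weak_Morphisms" "HOL-Algebra.Zassenhaus"
begin

text \<open>
  Let \<open>E\<close> be the quotient of \<open>A \<times> G\<close> by \<open>N = {(\<kappa>(k)\<^sup>-\<^sup>1, k) | k \<in> K}\<close>: it is a central extension of
  \<open>G/K\<close> by \<open>A\<close> in which \<open>k \<in> K\<close> and \<open>\<kappa>(k) \<in> A\<close> are the same element. As \<open>A\<close> is abelian, \<open>E'\<close> is the
  image of \<open>G'\<close>, so \<open>E' \<inter> A = \<kappa>(K \<inter> G')\<close>. The hypothesis on \<open>A\<close> implies that its torsion elements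
  have roots of every order, which are again torsion (\<open>torsion_root\<close>). Hence, as for a divisible subgroup
  of an abelian group, the torsion of \<open>A\<close> modulo \<open>\<kappa>(K \<inter> G')\<close> can be split off from \<open>E/E'\<close>: there is a
  finite subgroup \<open>Q\<close> of \<open>E\<close> that contains \<open>E'\<close>, satisfies \<open>A Q = E\<close>, and meets \<open>A\<close> exactly in
  \<open>\<kappa>(K \<inter> G')\<close> (\<open>exists_torsion_splitting\<close>). This \<open>Q\<close> is the group of the insertion biset: it is a
  central extension of \<open>G/K\<close> by \<open>K \<inter> G'\<close>, whose kernel lies in \<open>E' = Q'\<close>. An element of \<open>G\<close> and an
  element of \<open>Q\<close> with the same image in \<open>G/K\<close> differ in \<open>E\<close> by an element of \<open>A\<close>, and this
  difference is the character of the insertion biset.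

  A transitive fibered biset is determined by the stabilizer of a point, which is a subgroup of
  \<open>A \<times> G \<times> H\<close> meeting \<open>A\<close> trivially; such subgroups are the graphs of the pairs \<open>(U, \<phi>)\<close>. Under
  mild conditions the tensor product of transitive bisets is transitive, and its stabilizer is
  the composition of the two stabilizers as relations (\<open>transitive_at_tensor\<close>). If \<open>P\<close> is the
  preimage of \<open>Q\<close> in \<open>A \<times> G\<close> and \<open>r\<close> is the projection of \<open>P\<close> onto \<open>Q\<close>, then the insertion biset has
  stabilizer \<open>{(a, g, r(a, g)) | (a, g) \<in> P}\<close>. The stabilizer of \<open>Y\<close> is obtained by composing the one
  of \<open>X\<close> with the opposite of this relation on the left and with the corresponding relation for \<open>H\<close>
  on the right. Composing back returns the stabilizer of \<open>X\<close>, because the ambiguity consists of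
  elements of \<open>K\<close> and \<open>L\<close>, on which \<open>\<phi>\<close> agrees with \<open>\<kappa>\<close> and \<open>\<lambda>\<^sup>-\<^sup>1\<close> (\<open>ins_comp_mid_comp_del\<close>).

  It remains to see that \<open>(K, \<kappa>)\<close> is a reduced pair of \<open>G\<close> whenever \<open>\<kappa>\<close> is injective and
  \<open>K \<le> Z(G) \<inter> G'\<close> (\<open>central_commutator_character_reduced\<close>). Products of classes of bisets are
  combinations of classes of orbits, so if \<open>e\<^sub>(\<^sub>K\<^sub>,\<^sub>\<kappa>\<^sub>)\<close> lies in the ideal, then its biset is an orbit of
  some tensor product over a group \<open>H\<close> smaller than \<open>G\<close>. Let \<open>S \<le> A \<times> G \<times> H\<close> be the stabilizer of
  the left factor of a suitable point. It projects onto \<open>G\<close>, and every element of \<open>S\<close> over \<open>1 \<in> H\<close> is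
  of the form \<open>(\<kappa>(x)\<^sup>-\<^sup>1, x, 1)\<close> with \<open>x \<in> K\<close>. Since \<open>x\<close> is a product of commutators and \<open>A\<close> is abelian,
  \<open>S\<close> also contains some \<open>(1, x, w)\<close>, hence \<open>(\<kappa>(x), 1, w)\<close>. By injectivity of \<open>\<kappa>\<close> the kernel of \<open>S \<rightarrow> G\<close>
  is at least as large as the kernel of \<open>S \<rightarrow> H\<close>, and therefore \<open>|H| \<ge> |G|\<close>, a contradiction
  (\<open>order_le_if_factors\<close>).
\<close>

section \<open>Roots of torsion elements\<close>

lemma pi_part_superset:
  assumes "\<And>p. p \<in> \<pi> \<Longrightarrow> prime p" "n > 0"
    and "finite S" "S \<subseteq> \<pi>" "\<pi> \<inter> prime_factors n \<subseteq> S"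
  shows "pi_part \<pi> n = (\<Prod>p\<in>S. p ^ multiplicity p n)"
  unfolding pi_part_def
proof (rule prod.mono_neutral_left)
  show "\<forall>p\<in>S - \<pi> \<inter> prime_factors n. p ^ multiplicity p n = 1"
  proof
    fix p assume p: "p \<in> S - \<pi> \<inter> prime_factors n"
    then have "prime p" "p \<notin> prime_factors n" using assms(1,4) by auto
    then show "p ^ multiplicity p n = 1"
      using not_dvd_imp_multiplicity_0[of p n] assms(2) by (auto simp: in_prime_factors_iff)
  qed
qed (use assms in auto)

lemma pi_part_mult:
  assumes "\<And>p. p \<in> \<pi> \<Longrightarrow> prime p" "m > 0" "n > 0"
  shows "pi_part \<pi> (m * n) = pi_part \<pi> m * pi_part \<pi> n"
proof -
  define S where "S = \<pi> \<inter> prime_factors (m * n)"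
  have S: "finite S" "S \<subseteq> \<pi>" "\<pi> \<inter> prime_factors m \<subseteq> S" "\<pi> \<inter> prime_factors n \<subseteq> S"
    using assms by (auto simp: S_def prime_factors_product)
  have "pi_part \<pi> (m * n) = (\<Prod>p\<in>S. p ^ multiplicity p (m * n))"
    by (simp add: pi_part_def S_def)
  also have "\<dots> = (\<Prod>p\<in>S. p ^ multiplicity p m * p ^ multiplicity p n)"
  proof (rule prod.cong[OF refl])
    fix p assume "p \<in> S"
    then have "prime_elem p" using assms(1) S(2) by auto
    then show "p ^ multiplicity p (m * n) = p ^ multiplicity p m * p ^ multiplicity p n"
      using assms by (simp add: prime_elem_multiplicity_mult_distrib power_add)
  qed
  also have "\<dots> = pi_part \<pi> m * pi_part \<pi> n"
    using pi_part_superset[OF assms(1) assms(2) S(1,2,3)] pi_part_superset[OF assms(1) assms(3) S(1,2,4)]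
    by (simp add: prod.distrib)
  finally show ?thesis .
qed

lemma pi_part_pos:
  assumes "\<And>p. p \<in> \<pi> \<Longrightarrow> prime p"
  shows "pi_part \<pi> n > 0"
  unfolding pi_part_def using assms prime_gt_0_nat by (intro prod_pos) auto

text \<open>
  Writing \<open>A[n]\<close> for the elements killed by \<open>n\<close>, the fibres of the power map \<open>b \<mapsto> b\<^sup>n\<close> from
  \<open>A[e n]\<close> to \<open>A[e]\<close> have at most \<open>|A[n]|\<close> elements. As \<open>|A[e n]| = |A[e]| |A[n]|\<close> by multiplicativity
  of the \<open>\<pi>\<close>-part, the map is onto.
\<close>

lemma torsion_root:
  fixes A :: "('a, 'b) monoid_scheme" (structure) and n e :: nat
  assumes A: "comm_group A" and \<pi>: "\<And>p. p \<in> \<pi> \<Longrightarrow> prime p"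
    and tors: "\<And>n::nat. n > 0 \<Longrightarrow> card {a \<in> carrier A. a [^]\<^bsub>A\<^esub> n = \<one>\<^bsub>A\<^esub>} = pi_part \<pi> n"
    and a: "a \<in> carrier A" "a [^]\<^bsub>A\<^esub> e = \<one>\<^bsub>A\<^esub>" "e > 0" and n: "n > 0"
  shows "\<exists>b\<in>carrier A. b [^]\<^bsub>A\<^esub> n = a"
proof -
  interpret comm_group A by fact
  define T where "T j = {a \<in> carrier A. a [^] j = \<one>}" for j :: nat
  have fin: "finite (T j)" and cT: "card (T j) = pi_part \<pi> j" if "j > 0" for j
    using tors[OF that] pi_part_pos[OF \<pi>] by (auto simp: T_def intro: card_ge_0_finite)
  define f where "f b = b [^] n" for b
  define I where "I = f ` T (e * n)"
  have IT: "I \<subseteq> T e"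
    by (auto simp: I_def T_def f_def nat_pow_pow mult.commute)
  define s where "s = inv_into (T (e * n)) f"
  have "T (e * n) \<subseteq> (\<lambda>(y, t). s y \<otimes> t) ` (I \<times> T n)"
  proof
    fix b assume b: "b \<in> T (e * n)"
    have sb: "s (f b) \<in> T (e * n)" "f (s (f b)) = f b"
      unfolding s_def using b by (auto intro: inv_into_into f_inv_into_f)
    then have *: "s (f b) \<in> carrier A" "b \<in> carrier A" using b by (auto simp: T_def)
    have "inv (s (f b)) \<otimes> b \<in> T n"
      using sb(2) * by (auto simp: T_def f_def nat_pow_distrib nat_pow_inv)
    moreover have "b = s (f b) \<otimes> (inv (s (f b)) \<otimes> b)"
      using * by (simp add: m_assoc[symmetric])
    ultimately show "b \<in> (\<lambda>(y, t). s y \<otimes> t) ` (I \<times> T n)"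
      using b by (intro image_eqI[of _ _ "(f b, inv (s (f b)) \<otimes> b)"]) (auto simp: I_def)
  qed
  moreover have finI: "finite I" using finite_subset[OF IT fin] a by simp
  ultimately have "card (T (e * n)) \<le> card I * card (T n)"
    by (metis card_cartesian_product fin finite_cartesian_product n surj_card_le)
  then have "card (T e) \<le> card I"
    using cT a(3) n pi_part_mult[OF \<pi> a(3) n] pi_part_pos[OF \<pi>, where n=n] by simp
  then have "I = T e"
    by (intro card_seteq fin a IT)
  moreover have "a \<in> T e" using a by (simp add: T_def)
  ultimately have "a \<in> I" by simp
  then show ?thesis unfolding I_def T_def f_def by auto
qed

lemma nat_pow_DirProd:
  "(a, g) [^]\<^bsub>A \<times>\<times> G\<^esub> (n::nat) = (a [^]\<^bsub>A\<^esub> n, g [^]\<^bsub>G\<^esub> n)"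
  by (induction n) auto

lemma int_pow_DirProd:
  assumes "group A" "group G" "a \<in> carrier A" "g \<in> carrier G"
  shows "(a, g) [^]\<^bsub>A \<times>\<times> G\<^esub> (n::int) = (a [^]\<^bsub>A\<^esub> n, g [^]\<^bsub>G\<^esub> n)"
proof -
  interpret A: group A by fact
  interpret G: group G by fact
  show ?thesis
    by (cases "n < 0") (simp_all only: int_pow_def2 nat_pow_DirProd if_True if_False
      inv_DirProd[OF assms(1,2) A.nat_pow_closed G.nat_pow_closed] assms(3,4))
qed

text \<open>
  The exponents \<open>i\<close> with \<open>g\<^sup>i \<in> S\<close> form a nonzero ideal of the integers; \<open>n\<close> is its generator.
\<close>

lemma finite_group_pow_in_subgroup:
  assumes "group G" "finite (carrier G)" "subgroup S G" "g \<in> carrier G"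
  obtains n :: nat where "n > 0" "g [^]\<^bsub>G\<^esub> n \<in> S"
    "\<And>i::int. g [^]\<^bsub>G\<^esub> i \<in> S \<Longrightarrow> int n dvd i"
proof -
  interpret G: group G by fact
  define Q where "Q n \<longleftrightarrow> n > 0 \<and> g [^]\<^bsub>G\<^esub> (n::nat) \<in> S" for n
  have "Q (order G)"
    unfolding Q_def using assms subgroup.one_closed[OF assms(3)] G.pow_order_eq_1
    by (simp add: G.order_gt_0_iff_finite)
  then have Q: "Q (Least Q)" by (rule LeastI)
  define n where "n = Least Q"
  have "int n dvd i" if i: "g [^]\<^bsub>G\<^esub> (i::int) \<in> S" for i
  proof -
    have "g [^]\<^bsub>G\<^esub> (int n * (i div int n)) \<in> S"
      using Q assms G.subgroup_int_pow_closed[OF assms(3)]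
      by (simp add: G.int_pow_pow[symmetric] n_def Q_def int_pow_int)
    then have "g [^]\<^bsub>G\<^esub> (i - int n * (i div int n)) \<in> S"
      using i assms by (simp add: G.int_pow_diff subgroup.m_closed subgroup.m_inv_closed)
    then have "g [^]\<^bsub>G\<^esub> (i mod int n) \<in> S" by (simp add: minus_mult_div_eq_mod)
    moreover have "i mod int n \<ge> 0" "i mod int n < int n" using Q by (auto simp: n_def Q_def)
    ultimately have "g [^]\<^bsub>G\<^esub> (nat (i mod int n)) \<in> S"
      by (metis int_pow_int nat_0_le)
    moreover have "\<not> Q (nat (i mod int n))"
      using not_less_Least[of "nat (i mod int n)" Q] \<open>i mod int n < int n\<close> \<open>i mod int n \<ge> 0\<close>
      by (auto simp: n_def)
    ultimately have "nat (i mod int n) = 0" by (auto simp: Q_def)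
    then show ?thesis using \<open>i mod int n \<ge> 0\<close> by (simp add: dvd_eq_mod_eq_0)
  qed
  then show thesis using that Q by (auto simp: n_def Q_def)
qed

section \<open>Splitting off the torsion\<close>

text \<open>
  Finite quotients are needed as groups on natural numbers, and only through the projection onto
  them; numbering the cosets of \<open>N\<close> provides both.
\<close>

lemma nat_model_of_quotient:
  fixes G (structure)
  assumes "N \<lhd> G" "finite (carrier G)"
  obtains Q :: "nat monoid" and r where
    "group Q" "finite (carrier Q)" "r \<in> hom G Q" "r ` carrier G = carrier Q"
    "\<And>x. x \<in> carrier G \<Longrightarrow> r x = \<one>\<^bsub>Q\<^esub> \<longleftrightarrow> x \<in> N"
proof -
  interpret normal N G by fact
  have "finite (rcosets\<^bsub>G\<^esub> N)"
    using assms(2) by (auto simp: RCOSETS_def)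
  then obtain enc :: "_ \<Rightarrow> nat" where enc: "inj_on enc (rcosets\<^bsub>G\<^esub> N)"
    using finite_imp_inj_to_nat_seg by metis
  define r where "r x = enc (N #> x)" for x
  have r: "weak_group_morphism r N G"
  proof (rule weak_group_morphismsI[OF assms(1)])
    fix a b assume ab: "a \<in> carrier G" "b \<in> carrier G"
    then have "r a = r b \<longleftrightarrow> N #> a = N #> b"
      unfolding r_def using enc by (auto simp: inj_on_def RCOSETS_def)
    also have "\<dots> \<longleftrightarrow> a \<otimes> inv b \<in> N"
      using ab by (metis rcos_module rcos_self repr_independence is_group subgroup_axioms)
    finally show "r a = r b \<longleftrightarrow> a \<otimes> inv b \<in> N" .
  qed
  show thesis
  proof (rule that[of "image_group r G" r])
    show "r x = \<one>\<^bsub>image_group r G\<^esub> \<longleftrightarrow> x \<in> N" if "x \<in> carrier G" for x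
      using weak_group_morphism_ker[OF r] that by (auto simp: kernel_def)
  qed (use assms(2) image_group_is_group[OF r] weak_group_morphism_is_hom[OF r]
        in \<open>auto simp: image_group_carrier\<close>)
qed

text \<open>
  As \<open>A\<close> is abelian, every commutator of \<open>A \<times> G\<close> lies in \<open>1 \<times> G'\<close>.
\<close>

lemma normal_if_contains_derived:
  assumes "comm_group A" "group G" "subgroup P (A \<times>\<times> G)"
    and "\<And>d. d \<in> derived G (carrier G) \<Longrightarrow> (\<one>\<^bsub>A\<^esub>, d) \<in> P"
  shows "P \<lhd> A \<times>\<times> G"
proof -
  interpret A: comm_group A by fact
  interpret G: group G by fact
  interpret AG: group "A \<times>\<times> G" by (rule DirProd_group) unfold_locales
  show ?thesis
    unfolding AG.normal_inv_iff
  proof (intro conjI ballI assms(3))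
    fix x y assume x: "x \<in> carrier (A \<times>\<times> G)" and y: "y \<in> P"
    obtain a g where [simp]: "x = (a, g)" "a \<in> carrier A" "g \<in> carrier G" using x by auto
    obtain b h where [simp]: "y = (b, h)" "b \<in> carrier A" "h \<in> carrier G"
      using subgroup.subset[OF assms(3)] y by auto
    have "g \<otimes>\<^bsub>G\<^esub> h \<otimes>\<^bsub>G\<^esub> inv\<^bsub>G\<^esub> g \<otimes>\<^bsub>G\<^esub> inv\<^bsub>G\<^esub> h \<in> derived G (carrier G)"
      unfolding derived_def by (intro generate.incl UN_I[of g] UN_I[of h]) auto
    then have "(\<one>\<^bsub>A\<^esub>, g \<otimes>\<^bsub>G\<^esub> h \<otimes>\<^bsub>G\<^esub> inv\<^bsub>G\<^esub> g \<otimes>\<^bsub>G\<^esub> inv\<^bsub>G\<^esub> h) \<otimes>\<^bsub>A \<times>\<times> G\<^esub> y \<in> P"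
      using subgroup.m_closed[OF assms(3)] assms(4) y by blast
    moreover have "(\<one>\<^bsub>A\<^esub>, g \<otimes>\<^bsub>G\<^esub> h \<otimes>\<^bsub>G\<^esub> inv\<^bsub>G\<^esub> g \<otimes>\<^bsub>G\<^esub> inv\<^bsub>G\<^esub> h) \<otimes>\<^bsub>A \<times>\<times> G\<^esub> y
        = x \<otimes>\<^bsub>A \<times>\<times> G\<^esub> y \<otimes>\<^bsub>A \<times>\<times> G\<^esub> inv\<^bsub>A \<times>\<times> G\<^esub> x"
      by (simp add: G.m_assoc A.m_comm[of a b] A.m_assoc)
    ultimately show "x \<otimes>\<^bsub>A \<times>\<times> G\<^esub> y \<otimes>\<^bsub>A \<times>\<times> G\<^esub> inv\<^bsub>A \<times>\<times> G\<^esub> x \<in> P" by simp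
  qed
qed

text \<open>
  Modulo \<open>N = {(\<kappa>(k)\<^sup>-\<^sup>1, k)}\<close> this is the complement to \<open>A\<close> announced above. The subgroup \<open>N (1 \<times> G')\<close>
  has all the properties except the last one, and among the subgroups that share them one with the
  largest projection to \<open>G\<close> is chosen. If it misses \<open>g\<close>, let \<open>n\<close> be the order of \<open>g\<close> modulo the
  projection and \<open>(c, g\<^sup>n) \<in> P\<close>. Then \<open>c\<close> is torsion, because a power of it lies in \<open>\<kappa>(K)\<close>; with \<open>b\<^sup>n = c\<close>,
  adjoining \<open>z = (b, g)\<close> to \<open>P\<close> adds nothing over \<open>1\<close>, since a power of \<open>z\<close> whose second component
  lies in the projection is a power of \<open>z\<^sup>n \<in> P\<close>. This contradicts maximality.
\<close>

lemma exists_torsion_splitting: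
  assumes "comm_group A" "group G" "finite (carrier G)"
    and root: "\<And>a (e::nat) (n::nat). \<lbrakk>a \<in> carrier A; a [^]\<^bsub>A\<^esub> e = \<one>\<^bsub>A\<^esub>; e > 0; n > 0\<rbrakk>
          \<Longrightarrow> \<exists>b\<in>carrier A. b [^]\<^bsub>A\<^esub> n = a"
    and K: "subgroup K G" "K \<subseteq> centre G" and \<kappa>: "\<kappa> \<in> hom (G\<lparr>carrier := K\<rparr>) A"
  obtains P where "subgroup P (A \<times>\<times> G)"
    "\<And>k. k \<in> K \<Longrightarrow> (inv\<^bsub>A\<^esub> \<kappa> k, k) \<in> P"
    "\<And>d. d \<in> derived G (carrier G) \<Longrightarrow> (\<one>\<^bsub>A\<^esub>, d) \<in> P"
    "\<And>a. (a, \<one>\<^bsub>G\<^esub>) \<in> P \<Longrightarrow> a \<in> \<kappa> ` (K \<inter> derived G (carrier G))"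
    "snd ` P = carrier G"
proof -
  interpret A: comm_group A by fact
  interpret G: group G by fact
  interpret AG: group "A \<times>\<times> G" by (rule DirProd_group) unfold_locales
  interpret K: subgroup K G by fact
  define D where "D = derived G (carrier G)"
  interpret D: normal D G unfolding D_def by (rule G.derived_self_is_normal)
  have Kc: "k \<otimes>\<^bsub>G\<^esub> g = g \<otimes>\<^bsub>G\<^esub> k" if "k \<in> K" "g \<in> carrier G" for k g
    using K(2) that by (auto simp: centre_def)
  interpret \<kappa>: group_hom "G\<lparr>carrier := K\<rparr>" A \<kappa>
    by (intro group_hom.intro group_hom_axioms.intro \<kappa> A.group_axioms
      K.subgroup_is_group[OF G.group_axioms])
  have \<kappa>c[simp]: "\<kappa> k \<in> carrier A" if "k \<in> K" for k using that \<kappa>.hom_closed by simp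
  have \<kappa>m: "\<kappa> (k \<otimes>\<^bsub>G\<^esub> l) = \<kappa> k \<otimes>\<^bsub>A\<^esub> \<kappa> l" if "k \<in> K" "l \<in> K" for k l
    using that \<kappa>.hom_mult by simp
  have \<kappa>1: "\<kappa> \<one>\<^bsub>G\<^esub> = \<one>\<^bsub>A\<^esub>" using \<kappa>.hom_one by simp
  have \<kappa>i: "\<kappa> (inv\<^bsub>G\<^esub> k) = inv\<^bsub>A\<^esub> \<kappa> k" if "k \<in> K" for k
    by (metis A.inv_equality K.m_inv_closed K.mem_carrier G.l_inv \<kappa>1 \<kappa>c \<kappa>m that)
  define good where "good P \<longleftrightarrow> subgroup P (A \<times>\<times> G) \<and> (\<forall>k\<in>K. (inv\<^bsub>A\<^esub> \<kappa> k, k) \<in> P) \<and>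
     (\<forall>d\<in>D. (\<one>\<^bsub>A\<^esub>, d) \<in> P) \<and> (\<forall>a. (a, \<one>\<^bsub>G\<^esub>) \<in> P \<longrightarrow> a \<in> \<kappa> ` (K \<inter> D))" for P
  \<comment> \<open>the product of \<open>{(\<kappa>(k)\<^sup>-\<^sup>1, k)}\<close> and \<open>1 \<times> G'\<close>\<close>
  define P0 where "P0 = {(inv\<^bsub>A\<^esub> \<kappa> k, k \<otimes>\<^bsub>G\<^esub> d) | k d. k \<in> K \<and> d \<in> D}"
  have "good P0"
    unfolding good_def
  proof (intro conjI ballI allI impI)
    show "subgroup P0 (A \<times>\<times> G)"
    proof (rule AG.subgroupI)
      show "P0 \<subseteq> carrier (A \<times>\<times> G)" by (auto simp: P0_def)
      have "(inv\<^bsub>A\<^esub> \<kappa> \<one>\<^bsub>G\<^esub>, \<one>\<^bsub>G\<^esub> \<otimes>\<^bsub>G\<^esub> \<one>\<^bsub>G\<^esub>) \<in> P0"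
        unfolding P0_def using K.one_closed D.one_closed by blast
      then show "P0 \<noteq> {}" by blast
    next
      fix x assume "x \<in> P0"
      then obtain k d where kd: "x = (inv\<^bsub>A\<^esub> \<kappa> k, k \<otimes>\<^bsub>G\<^esub> d)" "k \<in> K" "d \<in> D" by (auto simp: P0_def)
      have "inv\<^bsub>G\<^esub> (k \<otimes>\<^bsub>G\<^esub> d) = inv\<^bsub>G\<^esub> k \<otimes>\<^bsub>G\<^esub> inv\<^bsub>G\<^esub> d"
        using kd by (simp add: Kc G.inv_mult_group)
      then have "inv\<^bsub>A \<times>\<times> G\<^esub> x = (inv\<^bsub>A\<^esub> \<kappa> (inv\<^bsub>G\<^esub> k), inv\<^bsub>G\<^esub> k \<otimes>\<^bsub>G\<^esub> inv\<^bsub>G\<^esub> d)"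
        using kd by (simp add: \<kappa>i)
      then show "inv\<^bsub>A \<times>\<times> G\<^esub> x \<in> P0" using kd by (auto simp: P0_def)
    next
      fix x y assume "x \<in> P0" "y \<in> P0"
      then obtain k d l e where kd: "x = (inv\<^bsub>A\<^esub> \<kappa> k, k \<otimes>\<^bsub>G\<^esub> d)" "k \<in> K" "d \<in> D"
        "y = (inv\<^bsub>A\<^esub> \<kappa> l, l \<otimes>\<^bsub>G\<^esub> e)" "l \<in> K" "e \<in> D" by (auto simp: P0_def)
      have "k \<otimes>\<^bsub>G\<^esub> d \<otimes>\<^bsub>G\<^esub> (l \<otimes>\<^bsub>G\<^esub> e) = (k \<otimes>\<^bsub>G\<^esub> l) \<otimes>\<^bsub>G\<^esub> (d \<otimes>\<^bsub>G\<^esub> e)"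
        using kd Kc[of l d] by (metis D.mem_carrier G.m_assoc G.m_closed K.mem_carrier)
      then have "x \<otimes>\<^bsub>A \<times>\<times> G\<^esub> y = (inv\<^bsub>A\<^esub> \<kappa> (k \<otimes>\<^bsub>G\<^esub> l), (k \<otimes>\<^bsub>G\<^esub> l) \<otimes>\<^bsub>G\<^esub> (d \<otimes>\<^bsub>G\<^esub> e))"
        using kd by (simp add: \<kappa>m A.inv_mult)
      then show "x \<otimes>\<^bsub>A \<times>\<times> G\<^esub> y \<in> P0" using kd by (auto simp: P0_def)
    qed
  next
    fix k assume "k \<in> K" then show "(inv\<^bsub>A\<^esub> \<kappa> k, k) \<in> P0"
      unfolding P0_def by (intro CollectI exI[of _ k] exI[of _ "\<one>\<^bsub>G\<^esub>"]) auto
  next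
    fix d assume "d \<in> D" then show "(\<one>\<^bsub>A\<^esub>, d) \<in> P0"
      unfolding P0_def by (intro CollectI exI[of _ "\<one>\<^bsub>G\<^esub>"] exI[of _ d]) (auto simp: \<kappa>1)
  next
    fix a assume "(a, \<one>\<^bsub>G\<^esub>) \<in> P0"
    then obtain k d where kd: "a = inv\<^bsub>A\<^esub> \<kappa> k" "\<one>\<^bsub>G\<^esub> = k \<otimes>\<^bsub>G\<^esub> d" "k \<in> K" "d \<in> D" by (auto simp: P0_def)
    then have "inv\<^bsub>G\<^esub> k = d" by (metis D.mem_carrier G.inv_equality G.inv_inv K.mem_carrier G.inv_closed)
    then show "a \<in> \<kappa> ` (K \<inter> D)" using kd \<kappa>i by (intro image_eqI[of _ _ "inv\<^bsub>G\<^esub> k"]) auto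
  qed
  moreover have "card (snd ` P) \<le> card (carrier G)" if "good P" for P
    using that assms(3) subgroup.subset[of P "A \<times>\<times> G"] by (intro card_mono) (auto simp: good_def)
  ultimately obtain P where P: "good P" and max: "\<And>P'. good P' \<Longrightarrow> card (snd ` P') \<le> card (snd ` P)"
    using ex_has_greatest_nat[of good P0 "\<lambda>P. card (snd ` P)" "Suc (card (carrier G))"]
    by (metis le_imp_less_Suc)
  then interpret P: subgroup P "A \<times>\<times> G" by (auto simp: good_def)
  have Pn: "P \<lhd> A \<times>\<times> G"
    using P by (intro normal_if_contains_derived assms P.subgroup_axioms) (auto simp: good_def D_def)
  have sub: "snd ` P \<subseteq> carrier G" using P.subset by auto
  have snd_hom: "group_hom (A \<times>\<times> G) G snd"
    by unfold_locales (auto simp: hom_def mult_DirProd')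
  have Psub: "subgroup (snd ` P) G"
    using group_hom.subgroup_img_is_subgroup[OF snd_hom P.subgroup_axioms] .
  have "snd ` P = carrier G"
  proof (rule ccontr)
    assume "snd ` P \<noteq> carrier G"
    then obtain g where g: "g \<in> carrier G" "g \<notin> snd ` P" using sub by auto
    obtain n where n: "n > 0" "g [^]\<^bsub>G\<^esub> n \<in> snd ` P" "\<And>i::int. g [^]\<^bsub>G\<^esub> i \<in> snd ` P \<Longrightarrow> int n dvd i"
      using finite_group_pow_in_subgroup[OF assms(2,3) Psub g(1)] by blast
    obtain c where c: "(c, g [^]\<^bsub>G\<^esub> n) \<in> P" using n by auto
    then have cA: "c \<in> carrier A" using P.subset by auto
    \<comment> \<open>\<open>c\<close> is torsion: its power to the order of \<open>G\<close> lies in \<open>\<kappa>(K)\<close>, whose exponent divides that order\<close>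
    have "(c, g [^]\<^bsub>G\<^esub> n) [^]\<^bsub>A \<times>\<times> G\<^esub> order G \<in> P"
      using AG.subgroup_int_pow_closed[OF P.subgroup_axioms c] by (metis int_pow_int)
    then have "(c [^]\<^bsub>A\<^esub> order G, \<one>\<^bsub>G\<^esub>) \<in> P"
      using g by (simp add: nat_pow_DirProd G.pow_order_eq_1)
    then obtain k where k: "k \<in> K" "c [^]\<^bsub>A\<^esub> order G = \<kappa> k" using P by (auto simp: good_def)
    have "\<kappa> k [^]\<^bsub>A\<^esub> order G = \<kappa> (k [^]\<^bsub>G\<^esub> order G)"
      using \<kappa>.hom_nat_pow[of k "order G"] k by (simp add: G.nat_pow_consistent[symmetric])
    then have "c [^]\<^bsub>A\<^esub> (order G * order G) = \<one>\<^bsub>A\<^esub>"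
      using k cA by (simp add: A.nat_pow_pow[symmetric] G.pow_order_eq_1 \<kappa>1)
    then obtain b where b: "b \<in> carrier A" "b [^]\<^bsub>A\<^esub> n = c"
      using root[of c "order G * order G" n] cA n assms(3) G.order_gt_0_iff_finite by auto
    define z where "z = (b, g)"
    have z: "z \<in> carrier (A \<times>\<times> G)" using b g by (simp add: z_def)
    have zi: "z [^]\<^bsub>A \<times>\<times> G\<^esub> (i::int) = (b [^]\<^bsub>A\<^esub> i, g [^]\<^bsub>G\<^esub> i)" for i
      unfolding z_def using b g by (intro int_pow_DirProd) unfold_locales
    have zP: "z [^]\<^bsub>A \<times>\<times> G\<^esub> i \<in> P" if dv: "int n dvd i" for i
    proof -
      obtain j where j: "i = int n * j" using dv by blast
      have "z [^]\<^bsub>A \<times>\<times> G\<^esub> int n \<in> P" unfolding zi using b c by (simp add: int_pow_int)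
      then show ?thesis
        unfolding j AG.int_pow_pow[OF z, symmetric]
        using AG.subgroup_int_pow_closed[OF P.subgroup_axioms] by blast
    qed
    define P' where "P' = P <#>\<^bsub>A \<times>\<times> G\<^esub> generate (A \<times>\<times> G) {z}"
    have P'_eq: "P' = {p \<otimes>\<^bsub>A \<times>\<times> G\<^esub> z [^]\<^bsub>A \<times>\<times> G\<^esub> (i::int) | p i. p \<in> P}"
      unfolding P'_def AG.generate_pow[OF z] by (auto simp: set_mult_def) blast+
    have sP': "subgroup P' (A \<times>\<times> G)"
      unfolding P'_def using AG.mult_norm_subgroup[OF Pn AG.generate_is_subgroup] z by simp
    have PP': "P \<subseteq> P'"
    proof
      fix p assume p: "p \<in> P"
      then have "p = p \<otimes>\<^bsub>A \<times>\<times> G\<^esub> z [^]\<^bsub>A \<times>\<times> G\<^esub> (0::int)"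
        using AG.r_one[OF P.mem_carrier] by (simp only: int_pow_0)
      then show "p \<in> P'" unfolding P'_eq using p by blast
    qed
    have "z = \<one>\<^bsub>A \<times>\<times> G\<^esub> \<otimes>\<^bsub>A \<times>\<times> G\<^esub> z [^]\<^bsub>A \<times>\<times> G\<^esub> (1::int)"
      using AG.int_pow_1[OF z] AG.l_one[OF z] by (simp only:)
    then have "z \<in> P'" unfolding P'_eq using P.one_closed by blast
    then have "g \<in> snd ` P'" by (force simp: z_def)
    have "good P'"
      unfolding good_def
    proof (intro conjI sP' allI impI)
      fix a assume "(a, \<one>\<^bsub>G\<^esub>) \<in> P'"
      then obtain p i where p: "p \<in> P" "(a, \<one>\<^bsub>G\<^esub>) = p \<otimes>\<^bsub>A \<times>\<times> G\<^esub> z [^]\<^bsub>A \<times>\<times> G\<^esub> (i::int)"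
        unfolding P'_eq by blast
      have "snd p \<otimes>\<^bsub>G\<^esub> g [^]\<^bsub>G\<^esub> i = \<one>\<^bsub>G\<^esub>"
        using p by (metis mult_DirProd' snd_conv zi)
      moreover have sp: "snd p \<in> snd ` P" "snd p \<in> carrier G" using p P.subset by auto
      ultimately have "g [^]\<^bsub>G\<^esub> i = inv\<^bsub>G\<^esub> snd p"
        using g by (metis G.inv_equality G.int_pow_closed G.inv_inv)
      then have "g [^]\<^bsub>G\<^esub> i \<in> snd ` P" using sp subgroup.m_inv_closed[OF Psub] by simp
      then have "z [^]\<^bsub>A \<times>\<times> G\<^esub> i \<in> P" using n zP by blast
      then have "(a, \<one>\<^bsub>G\<^esub>) \<in> P" using p P.m_closed by metis
      then show "a \<in> \<kappa> ` (K \<inter> D)" using P by (auto simp: good_def)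
    qed (use P PP' in \<open>auto simp: good_def\<close>)
    then have "card (snd ` P') \<le> card (snd ` P)" by (rule max)
    moreover have "snd ` P \<subset> snd ` P'" using PP' g \<open>g \<in> snd ` P'\<close> by blast
    moreover have "snd ` P' \<subseteq> carrier G" using subgroup.subset[OF sP'] by auto
    then have "finite (snd ` P')" by (rule finite_subset[OF _ assms(3)])
    ultimately show False using psubset_card_mono[of "snd ` P'" "snd ` P"] by simp
  qed
  then show thesis using that[of P] P by (auto simp: good_def D_def)
qed

section \<open>Characters as subgroups of a direct product\<close>

text \<open>
  A subgroup of \<open>A \<times> B\<close> meeting \<open>A\<close> trivially is the graph of a homomorphism from its projection to
  \<open>A\<close>. The inverse in \<open>\<phi>\<close> is the sign convention of \<open>twisted_graph\<close>.
\<close>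

lemma char_pairs_twisted_graph:
  assumes "comm_group A" "group B" "subgroup S (A \<times>\<times> B)"
    and free: "\<And>a. (a, \<one>\<^bsub>B\<^esub>) \<in> S \<Longrightarrow> a = \<one>\<^bsub>A\<^esub>"
  obtains U \<phi> where "(U, \<phi>) \<in> char_pairs A B" "twisted_graph A U \<phi> = S"
proof -
  interpret A: comm_group A by fact
  interpret B: group B by fact
  interpret AB: group "A \<times>\<times> B" by (rule DirProd_group) unfold_locales
  interpret S: subgroup S "A \<times>\<times> B" by fact
  have uniq: "a = b" if "(a, u) \<in> S" "(b, u) \<in> S" for a b u
  proof -
    have c: "a \<in> carrier A" "b \<in> carrier A" "u \<in> carrier B" using that S.subset by auto
    have "(a, u) \<otimes>\<^bsub>A \<times>\<times> B\<^esub> inv\<^bsub>A \<times>\<times> B\<^esub> (b, u) \<in> S" using that by blast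
    then have "a \<otimes>\<^bsub>A\<^esub> inv\<^bsub>A\<^esub> b = \<one>\<^bsub>A\<^esub>" using c free by simp
    then show "a = b" using c by (metis A.inv_equality A.inv_inv A.inv_closed)
  qed
  define U where "U = snd ` S"
  define \<phi> where "\<phi> = (\<lambda>u\<in>U. inv\<^bsub>A\<^esub> (THE a. (a, u) \<in> S))"
  have \<phi>: "\<phi> u = inv\<^bsub>A\<^esub> a" if "(a, u) \<in> S" for a u
  proof -
    have "(THE a. (a, u) \<in> S) = a" using that uniq by blast
    then show ?thesis using that by (force simp: \<phi>_def U_def)
  qed
  have in_U: "\<exists>a. (a, u) \<in> S" if "u \<in> U" for u using that by (auto simp: U_def)
  have "group_hom (A \<times>\<times> B) B snd" by unfold_locales (auto simp: hom_def mult_DirProd')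
  then have "subgroup U B"
    unfolding U_def using S.subgroup_axioms group_hom.subgroup_img_is_subgroup by blast
  moreover have "\<phi> \<in> characters A B U"
  proof -
    have "\<phi> u \<in> carrier A" if "u \<in> U" for u
      using that \<phi> S.subset by (auto simp: U_def)
    moreover have "\<phi> (u \<otimes>\<^bsub>B\<^esub> v) = \<phi> u \<otimes>\<^bsub>A\<^esub> \<phi> v" if uv: "u \<in> U" "v \<in> U" for u v
    proof -
      obtain a b where ab: "(a, u) \<in> S" "(b, v) \<in> S" using uv in_U by meson
      then have "(a \<otimes>\<^bsub>A\<^esub> b, u \<otimes>\<^bsub>B\<^esub> v) \<in> S" using S.m_closed by fastforce
      moreover have "a \<in> carrier A" "b \<in> carrier A" using ab S.subset by auto
      ultimately show ?thesis using ab by (simp add: \<phi> A.inv_mult)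
    qed
    ultimately show ?thesis by (auto simp: characters_def hom_def \<phi>_def)
  qed
  moreover have "twisted_graph A U \<phi> = S"
  proof
    show "S \<subseteq> twisted_graph A U \<phi>"
      using \<phi> S.subset by (force simp: twisted_graph_def U_def)
    show "twisted_graph A U \<phi> \<subseteq> S"
      using \<phi> S.subset by (force simp: twisted_graph_def U_def)
  qed
  ultimately show thesis using that by (auto simp: char_pairs_def)
qed

lemma mem_twisted_graph: "(a, u) \<in> twisted_graph A U \<phi> \<longleftrightarrow> u \<in> U \<and> a = inv\<^bsub>A\<^esub> \<phi> u"
  by (auto simp: twisted_graph_def)

lemma subgroup_twisted_graph:
  assumes "comm_group A" "group B" "(U, \<phi>) \<in> char_pairs A B"
  shows "subgroup (twisted_graph A U \<phi>) (A \<times>\<times> B)" and "(a, \<one>\<^bsub>B\<^esub>) \<in> twisted_graph A U \<phi> \<Longrightarrow> a = \<one>\<^bsub>A\<^esub>"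
proof -
  interpret A: comm_group A by fact
  interpret B: group B by fact
  interpret AB: group "A \<times>\<times> B" by (rule DirProd_group) unfold_locales
  interpret U: subgroup U B using assms(3) by (auto simp: char_pairs_def)
  have "\<phi> \<in> hom (B\<lparr>carrier := U\<rparr>) A" using assms(3) by (auto simp: char_pairs_def characters_def)
  then interpret \<phi>: group_hom "B\<lparr>carrier := U\<rparr>" A \<phi>
    by (intro group_hom.intro group_hom_axioms.intro A.group_axioms U.subgroup_is_group[OF B.group_axioms])
  have c: "\<phi> u \<in> carrier A" if "u \<in> U" for u using \<phi>.hom_closed that by simp
  have m: "\<phi> (u \<otimes>\<^bsub>B\<^esub> v) = \<phi> u \<otimes>\<^bsub>A\<^esub> \<phi> v" if "u \<in> U" "v \<in> U" for u v using \<phi>.hom_mult that by simp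
  have one: "\<phi> \<one>\<^bsub>B\<^esub> = \<one>\<^bsub>A\<^esub>" using \<phi>.hom_one by simp
  have i: "\<phi> (inv\<^bsub>B\<^esub> u) = inv\<^bsub>A\<^esub> \<phi> u" if "u \<in> U" for u
    by (metis A.inv_equality U.m_inv_closed U.mem_carrier B.l_inv one c m that)
  show "subgroup (twisted_graph A U \<phi>) (A \<times>\<times> B)"
  proof (rule AB.subgroupI)
    show "twisted_graph A U \<phi> \<subseteq> carrier (A \<times>\<times> B)" by (auto simp: mem_twisted_graph c)
    have "(\<one>\<^bsub>A\<^esub>, \<one>\<^bsub>B\<^esub>) \<in> twisted_graph A U \<phi>" by (simp add: mem_twisted_graph one)
    then show "twisted_graph A U \<phi> \<noteq> {}" by blast
  qed (auto simp: mem_twisted_graph c i m A.inv_mult)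
  show "(a, \<one>\<^bsub>B\<^esub>) \<in> twisted_graph A U \<phi> \<Longrightarrow> a = \<one>\<^bsub>A\<^esub>" by (simp add: mem_twisted_graph one)
qed

lemma char_values_closed:
  "(U, \<phi>) \<in> char_pairs A B \<Longrightarrow> u \<in> U \<Longrightarrow> \<phi> u \<in> carrier A"
  by (auto simp: char_pairs_def characters_def hom_def)

text \<open>
  The invariants of \<open>(U, \<phi>)\<close> can be read off from its graph, without mentioning \<open>U\<close> and \<open>\<phi>\<close>.
\<close>

lemma char_parts_twisted_graph:
  assumes "comm_group A" "(U, \<phi>) \<in> char_pairs A (G \<times>\<times> H)" "twisted_graph A U \<phi> = S"
  shows "U = snd ` S"
    and "g \<in> k1 G H U \<longleftrightarrow> (\<exists>a. (a, g, \<one>\<^bsub>H\<^esub>) \<in> S)"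
    and "h \<in> k2 G H U \<longleftrightarrow> (\<exists>a. (a, \<one>\<^bsub>G\<^esub>, h) \<in> S)"
    and "(a, g, \<one>\<^bsub>H\<^esub>) \<in> S \<Longrightarrow> char1 G H U \<phi> g = inv\<^bsub>A\<^esub> a"
    and "(a, \<one>\<^bsub>G\<^esub>, h) \<in> S \<Longrightarrow> char2 A G H U \<phi> h = a"
proof -
  interpret A: comm_group A by fact
  have sub: "U \<subseteq> carrier G \<times> carrier H"
    using assms(2) subgroup.subset[of U "G \<times>\<times> H"] by (simp add: char_pairs_def)
  note c = char_values_closed[OF assms(2)]
  show "U = snd ` S" using assms(3) by (force simp: twisted_graph_def)
  show *: "g \<in> k1 G H U \<longleftrightarrow> (\<exists>a. (a, g, \<one>\<^bsub>H\<^esub>) \<in> S)" for g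
    using sub by (auto simp: assms(3)[symmetric] mem_twisted_graph k1_def)
  show **: "h \<in> k2 G H U \<longleftrightarrow> (\<exists>a. (a, \<one>\<^bsub>G\<^esub>, h) \<in> S)" for h
    using sub by (auto simp: assms(3)[symmetric] mem_twisted_graph k2_def)
  show "char1 G H U \<phi> g = inv\<^bsub>A\<^esub> a" if "(a, g, \<one>\<^bsub>H\<^esub>) \<in> S"
    using that *[of g] c by (auto simp: char1_def assms(3)[symmetric] mem_twisted_graph)
  show "char2 A G H U \<phi> h = a" if "(a, \<one>\<^bsub>G\<^esub>, h) \<in> S"
    using that **[of h] by (auto simp: char2_def assms(3)[symmetric] mem_twisted_graph)
qed

text \<open>
  A product of commutators of second components lifts to a product of commutators of \<open>P\<close>, whose
  first component is trivial because \<open>A\<close> is abelian.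
\<close>

lemma derived_lift:
  assumes "comm_group A" "group B" "subgroup P (A \<times>\<times> B)" "d \<in> derived B (snd ` P)"
  shows "(\<one>\<^bsub>A\<^esub>, d) \<in> derived (A \<times>\<times> B) P"
proof -
  interpret A: comm_group A by fact
  interpret B: group B by fact
  interpret AB: group "A \<times>\<times> B" by (rule DirProd_group) unfold_locales
  interpret snd: group_hom "A \<times>\<times> B" B snd by unfold_locales (auto simp: hom_def mult_DirProd')
  interpret fst: group_hom "A \<times>\<times> B" A fst by unfold_locales (auto simp: hom_def mult_DirProd')
  have P: "P \<subseteq> carrier (A \<times>\<times> B)" using assms(3) by (rule subgroup.subset)
  obtain a where a: "(a, d) \<in> derived (A \<times>\<times> B) P"
    using assms(4) snd.derived_img[OF P] by auto
  then have "a \<in> derived A (fst ` P)" using fst.derived_img[OF P] by force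
  moreover have "derived A (fst ` P) = {\<one>\<^bsub>A\<^esub>}" using P by (intro A.derived_eq_singleton) auto
  ultimately show ?thesis using a by simp
qed

lemma char_parts_char_pairs:
  assumes "comm_group A" "group G" "group H" "(U, \<phi>) \<in> char_pairs A (G \<times>\<times> H)"
  shows "(k1 G H U, char1 G H U \<phi>) \<in> char_pairs A G" "(k2 G H U, char2 A G H U \<phi>) \<in> char_pairs A H"
proof -
  interpret A: comm_group A by fact
  interpret G: group G by fact
  interpret H: group H by fact
  have U: "subgroup U (G \<times>\<times> H)" and \<phi>: "\<phi> \<in> hom ((G \<times>\<times> H)\<lparr>carrier := U\<rparr>) A"
    using assms(4) by (auto simp: char_pairs_def characters_def)
  have m: "(g \<otimes>\<^bsub>G\<^esub> g', h \<otimes>\<^bsub>H\<^esub> h') \<in> U" "\<phi> (g \<otimes>\<^bsub>G\<^esub> g', h \<otimes>\<^bsub>H\<^esub> h') = \<phi> (g, h) \<otimes>\<^bsub>A\<^esub> \<phi> (g', h')"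
    if "(g, h) \<in> U" "(g', h') \<in> U" for g h g' h'
    using subgroup.m_closed[OF U that] hom_mult[OF \<phi>, of "(g, h)" "(g', h')"] that by simp_all
  have i: "(inv\<^bsub>G\<^esub> g, inv\<^bsub>H\<^esub> h) \<in> U" if "(g, h) \<in> U" "g \<in> carrier G" "h \<in> carrier H" for g h
    using subgroup.m_inv_closed[OF U that(1)] that by (simp add: G.group_axioms H.group_axioms)
  have c: "\<phi> u \<in> carrier A" if "u \<in> U" for u using char_values_closed[OF assms(4) that] .
  have one: "(\<one>\<^bsub>G\<^esub>, \<one>\<^bsub>H\<^esub>) \<in> U" using subgroup.one_closed[OF U] by simp
  have k1: "subgroup (k1 G H U) G"
  proof (rule G.subgroupI)
    show "k1 G H U \<noteq> {}" using one by (auto simp: k1_def)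
    show "inv\<^bsub>G\<^esub> g \<in> k1 G H U" if "g \<in> k1 G H U" for g using i[of g "\<one>\<^bsub>H\<^esub>"] that by (auto simp: k1_def)
    show "g \<otimes>\<^bsub>G\<^esub> g' \<in> k1 G H U" if "g \<in> k1 G H U" "g' \<in> k1 G H U" for g g'
      using m(1)[of g "\<one>\<^bsub>H\<^esub>" g' "\<one>\<^bsub>H\<^esub>"] that by (auto simp: k1_def)
  qed (auto simp: k1_def)
  have k2: "subgroup (k2 G H U) H"
  proof (rule H.subgroupI)
    show "k2 G H U \<noteq> {}" using one by (auto simp: k2_def)
    show "inv\<^bsub>H\<^esub> h \<in> k2 G H U" if "h \<in> k2 G H U" for h using i[of "\<one>\<^bsub>G\<^esub>" h] that by (auto simp: k2_def)
    show "h \<otimes>\<^bsub>H\<^esub> h' \<in> k2 G H U" if "h \<in> k2 G H U" "h' \<in> k2 G H U" for h h'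
      using m(1)[of "\<one>\<^bsub>G\<^esub>" h "\<one>\<^bsub>G\<^esub>" h'] that by (auto simp: k2_def)
  qed (auto simp: k2_def)
  have "char1 G H U \<phi> \<in> characters A G (k1 G H U)"
    using m(2)[of _ "\<one>\<^bsub>H\<^esub>" _ "\<one>\<^bsub>H\<^esub>"] c subgroup.m_closed[OF k1]
    by (auto simp: characters_def hom_def char1_def k1_def)
  then show "(k1 G H U, char1 G H U \<phi>) \<in> char_pairs A G" using k1 by (simp add: char_pairs_def)
  have "char2 A G H U \<phi> \<in> characters A H (k2 G H U)"
    using m(2)[of "\<one>\<^bsub>G\<^esub>" _ "\<one>\<^bsub>G\<^esub>"] c subgroup.m_closed[OF k2]
    by (auto simp: characters_def hom_def char2_def k2_def A.inv_mult)
  then show "(k2 G H U, char2 A G H U \<phi>) \<in> char_pairs A H" using k2 by (simp add: char_pairs_def)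
qed

section \<open>The extension cut out by a torsion splitting\<close>

text \<open>
  Here \<open>Q\<close> is the complement constructed above, taken modulo \<open>N\<close>: \<open>P\<close> is its preimage in \<open>A \<times> G\<close>
  and \<open>r\<close> is the projection. The target of \<open>r\<close> is an arbitrary group, so that it can be one on the
  natural numbers.
\<close>

locale torsion_splitting = A: comm_group A + G: group G + Q: group Q
  for A :: "'a monoid" and G :: "'g monoid" and K :: "'g set" and \<kappa> :: "'g \<Rightarrow> 'a"
    and P :: "('a \<times> 'g) set" and Q :: "'q monoid" and r :: "'a \<times> 'g \<Rightarrow> 'q" +
  assumes fin: "finite (carrier G)"
    and K: "subgroup K G" and Kc: "K \<subseteq> centre G"
    and \<kappa>: "\<kappa> \<in> characters A G K" and \<kappa>_inj: "inj_on \<kappa> K"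
    and P: "subgroup P (A \<times>\<times> G)"
    and KP: "\<And>k. k \<in> K \<Longrightarrow> (inv\<^bsub>A\<^esub> \<kappa> k, k) \<in> P"
    and DP: "\<And>d. d \<in> derived G (carrier G) \<Longrightarrow> (\<one>\<^bsub>A\<^esub>, d) \<in> P"
    and PA: "\<And>a. (a, \<one>\<^bsub>G\<^esub>) \<in> P \<Longrightarrow> a \<in> \<kappa> ` (K \<inter> derived G (carrier G))"
    and sndP: "snd ` P = carrier G"
    and r_hom: "r \<in> hom ((A \<times>\<times> G)\<lparr>carrier := P\<rparr>) Q" and r_surj: "r ` P = carrier Q"
    and r_ker: "\<And>x. x \<in> P \<Longrightarrow> r x = \<one>\<^bsub>Q\<^esub> \<longleftrightarrow> (\<exists>k\<in>K. x = (inv\<^bsub>A\<^esub> \<kappa> k, k))"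
begin

definition Kt where "Kt = K \<inter> derived G (carrier G)"

text \<open>
  In \<open>E\<close>, \<open>k\<close> and \<open>\<kappa>(k)\<close> are identified; the embedding of \<open>K \<inter> G'\<close> is written with the second
  form because this makes centrality and injectivity immediate.
\<close>

definition incl where "incl k = r (\<kappa> k, \<one>\<^bsub>G\<^esub>)"

definition proj where "proj q = (THE C. \<exists>a g. (a, g) \<in> P \<and> r (a, g) = q \<and> C = K #>\<^bsub>G\<^esub> g)"

text \<open>
  The stabilizer of the base point of the insertion biset. Its character sends \<open>(g, r(a, g))\<close> to \<open>a\<^sup>-\<^sup>1\<close>,
  which is the quotient of \<open>g\<close> by \<open>r(a, g)\<close> in \<open>E\<close>.
\<close>

definition ins_graph where "ins_graph = {(a, g, r (a, g)) | a g. (a, g) \<in> P}"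

sublocale AG: group "A \<times>\<times> G" by (rule DirProd_group) unfold_locales
sublocale K: subgroup K G by (rule K)
sublocale P: subgroup P "A \<times>\<times> G" by (rule P)
sublocale D: normal "derived G (carrier G)" G by (rule G.derived_self_is_normal)
sublocale \<kappa>: group_hom "G\<lparr>carrier := K\<rparr>" A \<kappa>
  using \<kappa> by (intro group_hom.intro group_hom_axioms.intro A.group_axioms
      K.subgroup_is_group[OF G.group_axioms]) (auto simp: characters_def)
sublocale r: group_hom "(A \<times>\<times> G)\<lparr>carrier := P\<rparr>" Q r
  by (intro group_hom.intro group_hom_axioms.intro r_hom Q.group_axioms
      P.subgroup_is_group[OF AG.group_axioms])

lemma K_comm: "k \<in> K \<Longrightarrow> g \<in> carrier G \<Longrightarrow> k \<otimes>\<^bsub>G\<^esub> g = g \<otimes>\<^bsub>G\<^esub> k"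
  using Kc by (auto simp: centre_def)

lemma K_normal: "K \<lhd> G"
  unfolding G.normal_inv_iff
proof (intro conjI ballI K)
  fix x h assume "x \<in> carrier G" "h \<in> K"
  then have "x \<otimes>\<^bsub>G\<^esub> h \<otimes>\<^bsub>G\<^esub> inv\<^bsub>G\<^esub> x = h"
    by (metis G.inv_solve_right G.m_closed K.mem_carrier K_comm)
  then show "x \<otimes>\<^bsub>G\<^esub> h \<otimes>\<^bsub>G\<^esub> inv\<^bsub>G\<^esub> x \<in> K" using \<open>h \<in> K\<close> by simp
qed

lemma \<kappa>_closed [simp]: "k \<in> K \<Longrightarrow> \<kappa> k \<in> carrier A"
  using \<kappa>.hom_closed by simp
lemma \<kappa>_mult: "k \<in> K \<Longrightarrow> l \<in> K \<Longrightarrow> \<kappa> (k \<otimes>\<^bsub>G\<^esub> l) = \<kappa> k \<otimes>\<^bsub>A\<^esub> \<kappa> l"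
  using \<kappa>.hom_mult by simp
lemma \<kappa>_one [simp]: "\<kappa> \<one>\<^bsub>G\<^esub> = \<one>\<^bsub>A\<^esub>"
  using \<kappa>.hom_one by simp
lemma \<kappa>_inv: "k \<in> K \<Longrightarrow> \<kappa> (inv\<^bsub>G\<^esub> k) = inv\<^bsub>A\<^esub> \<kappa> k"
  by (metis A.inv_equality K.m_inv_closed K.mem_carrier G.l_inv \<kappa>_one \<kappa>_closed \<kappa>_mult)

lemma P_closed: "(a, g) \<in> P \<Longrightarrow> a \<in> carrier A" "(a, g) \<in> P \<Longrightarrow> g \<in> carrier G"
  using P.subset by auto

lemma P_mult: "(a, g) \<in> P \<Longrightarrow> (b, h) \<in> P \<Longrightarrow> (a \<otimes>\<^bsub>A\<^esub> b, g \<otimes>\<^bsub>G\<^esub> h) \<in> P"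
  using P.m_closed[of "(a, g)" "(b, h)"] by simp

lemma P_inv: "(a, g) \<in> P \<Longrightarrow> (inv\<^bsub>A\<^esub> a, inv\<^bsub>G\<^esub> g) \<in> P"
  using P.m_inv_closed[of "(a, g)"] P_closed by simp

lemma P_above: assumes "g \<in> carrier G" obtains a where "(a, g) \<in> P"
  using sndP assms that by (metis imageE prod.collapse)

lemma r_closed [simp]: "(a, g) \<in> P \<Longrightarrow> r (a, g) \<in> carrier Q"
  using r_surj by blast

lemma r_above: assumes "q \<in> carrier Q" obtains a g where "(a, g) \<in> P" "q = r (a, g)"
  using r_surj assms that by (metis imageE prod.collapse)

lemma r_mult: "(a, g) \<in> P \<Longrightarrow> (b, h) \<in> P \<Longrightarrow> r (a, g) \<otimes>\<^bsub>Q\<^esub> r (b, h) = r (a \<otimes>\<^bsub>A\<^esub> b, g \<otimes>\<^bsub>G\<^esub> h)"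
  using r.hom_mult[of "(a, g)" "(b, h)"] by simp

lemma r_inv: "(a, g) \<in> P \<Longrightarrow> r (inv\<^bsub>A\<^esub> a, inv\<^bsub>G\<^esub> g) = inv\<^bsub>Q\<^esub> r (a, g)"
  using r_mult[OF P_inv, of a g a g] P_closed[of a g] P_inv[of a g] r.hom_one
  by (simp add: Q.inv_equality)

lemma r_one [simp]: "r (\<one>\<^bsub>A\<^esub>, \<one>\<^bsub>G\<^esub>) = \<one>\<^bsub>Q\<^esub>"
  using r.hom_one by simp

lemma r_eq_one: "(a, g) \<in> P \<Longrightarrow> r (a, g) = \<one>\<^bsub>Q\<^esub> \<longleftrightarrow> g \<in> K \<and> a = inv\<^bsub>A\<^esub> \<kappa> g"
  using r_ker[of "(a, g)"] by auto

lemma r_eqD: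
  assumes "(a, g) \<in> P" "(b, h) \<in> P" "r (a, g) = r (b, h)"
  obtains k where "k \<in> K" "a = b \<otimes>\<^bsub>A\<^esub> inv\<^bsub>A\<^esub> \<kappa> k" "g = h \<otimes>\<^bsub>G\<^esub> k"
proof -
  have *: "(inv\<^bsub>A\<^esub> b \<otimes>\<^bsub>A\<^esub> a, inv\<^bsub>G\<^esub> h \<otimes>\<^bsub>G\<^esub> g) \<in> P" using assms P_mult P_inv by blast
  have "r (inv\<^bsub>A\<^esub> b \<otimes>\<^bsub>A\<^esub> a, inv\<^bsub>G\<^esub> h \<otimes>\<^bsub>G\<^esub> g) = \<one>\<^bsub>Q\<^esub>"
    using assms by (simp add: r_mult[symmetric] P_inv r_inv)
  then have k: "inv\<^bsub>G\<^esub> h \<otimes>\<^bsub>G\<^esub> g \<in> K" "inv\<^bsub>A\<^esub> b \<otimes>\<^bsub>A\<^esub> a = inv\<^bsub>A\<^esub> \<kappa> (inv\<^bsub>G\<^esub> h \<otimes>\<^bsub>G\<^esub> g)"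
    using r_eq_one[OF *] by auto
  show thesis
    by (rule that[OF k(1)])
      (use P_closed assms(1,2) in \<open>auto simp: k(2)[symmetric] A.m_assoc[symmetric] G.m_assoc[symmetric]\<close>)
qed

lemma r_translate:
  assumes "(a, g) \<in> P" "k \<in> K"
  shows "(a \<otimes>\<^bsub>A\<^esub> inv\<^bsub>A\<^esub> \<kappa> k, g \<otimes>\<^bsub>G\<^esub> k) \<in> P" "r (a \<otimes>\<^bsub>A\<^esub> inv\<^bsub>A\<^esub> \<kappa> k, g \<otimes>\<^bsub>G\<^esub> k) = r (a, g)"
proof -
  show "(a \<otimes>\<^bsub>A\<^esub> inv\<^bsub>A\<^esub> \<kappa> k, g \<otimes>\<^bsub>G\<^esub> k) \<in> P" using assms P_mult KP by blast
  have "r (inv\<^bsub>A\<^esub> \<kappa> k, k) = \<one>\<^bsub>Q\<^esub>" using assms r_eq_one[OF KP] by simp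
  then show "r (a \<otimes>\<^bsub>A\<^esub> inv\<^bsub>A\<^esub> \<kappa> k, g \<otimes>\<^bsub>G\<^esub> k) = r (a, g)"
    using assms KP by (simp add: r_mult[symmetric])
qed

lemma Kt_K: "k \<in> Kt \<Longrightarrow> k \<in> K" by (simp add: Kt_def)

lemma Kt_P: "k \<in> Kt \<Longrightarrow> (\<kappa> k, \<one>\<^bsub>G\<^esub>) \<in> P"
  using P_mult[OF KP DP, of "inv\<^bsub>G\<^esub> k" k] by (auto simp: Kt_def \<kappa>_inv)

lemma incl_eq: "k \<in> Kt \<Longrightarrow> incl k = r (\<one>\<^bsub>A\<^esub>, k)"
  using r_translate(2)[OF Kt_P, of k k] by (simp add: incl_def Kt_def)

text \<open>Multiplying by \<open>(\<kappa>(g), g\<^sup>-\<^sup>1)\<close> moves such an element into \<open>A \<inter> P\<close> without changing its image in \<open>Q\<close>.\<close>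
lemma P_over_K:
  assumes "(a, g) \<in> P" "g \<in> K"
  obtains k where "k \<in> Kt" "a \<otimes>\<^bsub>A\<^esub> \<kappa> g = \<kappa> k" "r (a, g) = incl k"
proof -
  have g': "inv\<^bsub>G\<^esub> g \<in> K" using assms by simp
  have eq: "a \<otimes>\<^bsub>A\<^esub> inv\<^bsub>A\<^esub> \<kappa> (inv\<^bsub>G\<^esub> g) = a \<otimes>\<^bsub>A\<^esub> \<kappa> g" "g \<otimes>\<^bsub>G\<^esub> inv\<^bsub>G\<^esub> g = \<one>\<^bsub>G\<^esub>"
    using assms P_closed by (simp_all add: \<kappa>_inv)
  note tr = r_translate[OF assms(1) g', unfolded eq]
  obtain k where "k \<in> Kt" "a \<otimes>\<^bsub>A\<^esub> \<kappa> g = \<kappa> k" using PA[OF tr(1)] by (auto simp: Kt_def)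
  then show thesis using tr(2) that by (auto simp: incl_def)
qed

lemma Kt_subgroup: "subgroup Kt G"
  unfolding Kt_def using G.subgroups_Inter_pair[OF K D.subgroup_axioms] .

text \<open>
  Elements of \<open>P\<close> with the same image in \<open>Q\<close> have second components in the same coset of \<open>K\<close>.
\<close>

lemma proj_r: assumes "(a, g) \<in> P" shows "proj (r (a, g)) = K #>\<^bsub>G\<^esub> g"
  unfolding proj_def
proof (rule the_equality)
  fix C assume "\<exists>b h. (b, h) \<in> P \<and> r (b, h) = r (a, g) \<and> C = K #>\<^bsub>G\<^esub> h"
  then obtain b h where b: "(b, h) \<in> P" "r (b, h) = r (a, g)" "C = K #>\<^bsub>G\<^esub> h" by blast
  obtain k where k: "k \<in> K" "h = g \<otimes>\<^bsub>G\<^esub> k" using r_eqD[OF b(1) assms b(2)] by blast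
  then have "h = k \<otimes>\<^bsub>G\<^esub> g" using K_comm P_closed(2)[OF assms] by simp
  then show "C = K #>\<^bsub>G\<^esub> g"
    using b k P_closed(2)[OF assms] by (simp add: G.coset_mult_assoc[symmetric] G.coset_join2 K K.subset)
qed (use assms in auto)

lemma incl_central: "incl ` Kt \<subseteq> centre Q"
  by (auto simp: centre_def incl_def Kt_P r_mult P_closed A.m_comm Kt_K elim!: r_above)

text \<open>
  By \<open>incl_eq\<close> the image of \<open>k\<close> is \<open>r(1, k)\<close>, and \<open>(1, k)\<close> is a product of commutators of \<open>P\<close> because \<open>P\<close>
  projects onto \<open>G\<close>.
\<close>

lemma incl_derived: "incl ` Kt \<subseteq> derived Q (carrier Q)"
proof
  fix x assume "x \<in> incl ` Kt"
  then obtain k where k: "k \<in> Kt" "x = r (\<one>\<^bsub>A\<^esub>, k)" using incl_eq by auto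
  then have "(\<one>\<^bsub>A\<^esub>, k) \<in> derived (A \<times>\<times> G) P"
    using derived_lift[OF A.comm_group_axioms G.group_axioms P] sndP by (auto simp: Kt_def)
  also have "derived (A \<times>\<times> G) P = derived ((A \<times>\<times> G)\<lparr>carrier := P\<rparr>) P"
    using AG.derived_consistent[of P P] P by simp
  finally show "x \<in> derived Q (carrier Q)"
    using r.derived_img[of P] k r_surj by force
qed

lemma short_exact_incl_proj: "short_exact (G\<lparr>carrier := Kt\<rparr>) Q (G Mod K) incl proj"
  unfolding short_exact_def
proof (intro conjI)
  interpret K: normal K G by (rule K_normal)
  show "group (G Mod K)" by (rule K.factorgroup_is_group)
  show "group (G\<lparr>carrier := Kt\<rparr>)"
    using subgroup.subgroup_is_group[OF Kt_subgroup G.group_axioms] .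
  show "group Q" by unfold_locales
  show "incl \<in> hom (G\<lparr>carrier := Kt\<rparr>) Q"
  proof (rule homI)
    fix x y assume "x \<in> carrier (G\<lparr>carrier := Kt\<rparr>)" "y \<in> carrier (G\<lparr>carrier := Kt\<rparr>)"
    then show "incl (x \<otimes>\<^bsub>G\<lparr>carrier := Kt\<rparr>\<^esub> y) = incl x \<otimes>\<^bsub>Q\<^esub> incl y"
      by (simp add: incl_def r_mult Kt_P \<kappa>_mult Kt_K)
  qed (simp add: incl_def Kt_P)
  show "proj \<in> hom Q (G Mod K)"
  proof (rule homI)
    fix x assume "x \<in> carrier Q"
    then show "proj x \<in> carrier (G Mod K)"
      by (auto elim!: r_above simp: proj_r carrier_FactGroup P_closed)
  next
    fix x y assume "x \<in> carrier Q" "y \<in> carrier Q"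
    then show "proj (x \<otimes>\<^bsub>Q\<^esub> y) = proj x \<otimes>\<^bsub>G Mod K\<^esub> proj y"
      by (auto elim!: r_above simp: proj_r r_mult P_mult FactGroup_def K.rcos_sum P_closed)
  qed
  show "inj_on incl (carrier (G\<lparr>carrier := Kt\<rparr>))"
  proof (rule inj_onI, simp)
    fix x y assume xy: "x \<in> Kt" "y \<in> Kt" "incl x = incl y"
    then obtain k where k: "k \<in> K" "\<kappa> x = \<kappa> y \<otimes>\<^bsub>A\<^esub> inv\<^bsub>A\<^esub> \<kappa> k" "\<one>\<^bsub>G\<^esub> = \<one>\<^bsub>G\<^esub> \<otimes>\<^bsub>G\<^esub> k"
      using r_eqD[OF Kt_P Kt_P] by (metis incl_def)
    then have "\<kappa> x = \<kappa> y" using xy by (auto simp: Kt_K)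
    then show "x = y" using xy \<kappa>_inj by (auto simp: inj_on_def Kt_def)
  qed
  show "proj ` carrier Q = carrier (G Mod K)"
  proof
    show "proj ` carrier Q \<subseteq> carrier (G Mod K)"
      by (auto elim!: r_above simp: proj_r carrier_FactGroup P_closed)
    show "carrier (G Mod K) \<subseteq> proj ` carrier Q"
    proof
      fix C assume "C \<in> carrier (G Mod K)"
      then obtain g where g: "g \<in> carrier G" "C = K #>\<^bsub>G\<^esub> g" by (auto simp: carrier_FactGroup)
      obtain a where "(a, g) \<in> P" using P_above g by blast
      then show "C \<in> proj ` carrier Q" using g proj_r by (intro image_eqI[of _ _ "r (a, g)"]) auto
    qed
  qed
  show "kernel Q (G Mod K) proj = incl ` carrier (G\<lparr>carrier := Kt\<rparr>)"
  proof (intro subset_antisym subsetI)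
    fix q assume "q \<in> kernel Q (G Mod K) proj"
    then obtain a g where ag: "(a, g) \<in> P" "q = r (a, g)" "K #>\<^bsub>G\<^esub> g = K"
      by (auto simp: kernel_def FactGroup_def proj_r elim!: r_above)
    then have "g \<in> K" using G.coset_join1[OF ag(3)] P_closed K by blast
    then show "q \<in> incl ` carrier (G\<lparr>carrier := Kt\<rparr>)" using P_over_K[OF ag(1)] ag(2) by auto
  next
    fix q assume "q \<in> incl ` carrier (G\<lparr>carrier := Kt\<rparr>)"
    then obtain k where "k \<in> Kt" "q = r (\<kappa> k, \<one>\<^bsub>G\<^esub>)" by (auto simp: incl_def)
    then show "q \<in> kernel Q (G Mod K) proj"
      using Kt_P by (auto simp: kernel_def proj_r FactGroup_def K.subset G.coset_mult_one)
  qed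
qed

lemma subgroup_ins_graph: "subgroup ins_graph (A \<times>\<times> G \<times>\<times> Q)"
proof -
  interpret GQ: group "G \<times>\<times> Q" by (rule DirProd_group) unfold_locales
  interpret AGQ: group "A \<times>\<times> G \<times>\<times> Q" by (rule DirProd_group) unfold_locales
  show ?thesis
  proof (rule AGQ.subgroupI)
    show "ins_graph \<subseteq> carrier (A \<times>\<times> G \<times>\<times> Q)" by (auto simp: ins_graph_def P_closed)
    show "ins_graph \<noteq> {}" using P.one_closed by (auto simp: ins_graph_def)
  next
    fix x assume "x \<in> ins_graph"
    then show "inv\<^bsub>A \<times>\<times> G \<times>\<times> Q\<^esub> x \<in> ins_graph"
      by (auto simp: ins_graph_def P_closed P_inv r_inv inv_DirProd GQ.group_axioms
        A.group_axioms G.group_axioms Q.group_axioms)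
  next
    fix x y assume "x \<in> ins_graph" "y \<in> ins_graph"
    then show "x \<otimes>\<^bsub>A \<times>\<times> G \<times>\<times> Q\<^esub> y \<in> ins_graph"
      by (auto simp: ins_graph_def P_mult r_mult)
  qed
qed

lemma insertion_biset_ins_graph:
  obtains M \<mu> where "(M, \<mu>) \<in> char_pairs A (G \<times>\<times> Q)" "twisted_graph A M \<mu> = ins_graph"
    "insertion_biset A G K \<kappa> Q incl proj (trans_biset A G Q M \<mu>)"
proof -
  interpret GQ: group "G \<times>\<times> Q" by (rule DirProd_group) unfold_locales
  have free: "a = \<one>\<^bsub>A\<^esub>" if "(a, \<one>\<^bsub>G \<times>\<times> Q\<^esub>) \<in> ins_graph" for a
    using that r_eq_one[of a "\<one>\<^bsub>G\<^esub>"] by (auto simp: ins_graph_def)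
  obtain M \<mu> where M: "(M, \<mu>) \<in> char_pairs A (G \<times>\<times> Q)" "twisted_graph A M \<mu> = ins_graph"
    using char_pairs_twisted_graph[OF A.comm_group_axioms GQ.group_axioms subgroup_ins_graph free] .
  note parts = char_parts_twisted_graph[OF A.comm_group_axioms M]
  have fst: "fst ` M = carrier G"
    using sndP by (force simp: parts(1) ins_graph_def image_iff)
  have snd: "snd ` M = carrier Q"
    using r_surj by (force simp: parts(1) ins_graph_def image_iff)
  have in1: "(a, g, \<one>\<^bsub>Q\<^esub>) \<in> ins_graph \<longleftrightarrow> g \<in> K \<and> a = inv\<^bsub>A\<^esub> \<kappa> g" for a g
    using r_eq_one[of a g] KP[of g] by (auto simp: ins_graph_def)
  have in2: "(a, \<one>\<^bsub>G\<^esub>, q) \<in> ins_graph \<longleftrightarrow> (\<exists>k\<in>Kt. a = \<kappa> k \<and> q = incl k)" for a q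
    using PA Kt_P by (auto simp: ins_graph_def incl_def Kt_def)
  have k1: "k1 G Q M = K" using parts(2) in1 by blast
  have c1: "char1 G Q M \<mu> = \<kappa>"
  proof
    fix g show "char1 G Q M \<mu> g = \<kappa> g"
    proof (cases "g \<in> K")
      case True
      then show ?thesis using parts(4)[of "inv\<^bsub>A\<^esub> \<kappa> g" g] in1 by simp
    next
      case False
      then show ?thesis using \<kappa> by (auto simp: char1_def k1 characters_def extensional_def)
    qed
  qed
  have k2: "k2 G Q M = incl ` Kt" using parts(3) in2 by (auto simp: set_eq_iff)
  have c2: "char2 A G Q M \<mu> (incl k) = \<kappa> k" if "k \<in> Kt" for k
    using parts(5)[of "\<kappa> k" "incl k"] in2 that by blast
  have "insertion_biset A G K \<kappa> Q incl proj (trans_biset A G Q M \<mu>)"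
    unfolding insertion_biset_def Let_def Kt_def[symmetric]
    using G.group_axioms fin K Kc \<kappa> \<kappa>_inj short_exact_incl_proj incl_central incl_derived M(1)
      fst k1 c1 snd k2 c2 by blast
  then show thesis using M that by blast
qed

end

text \<open>
  The subgroup \<open>P\<close> is finite, since each of its fibres over \<open>G\<close> is a translate of a subset of \<open>\<kappa>(K)\<close>, and
  \<open>N\<close> is normal in it because it is central in \<open>A \<times> G\<close>.
\<close>

lemma exists_torsion_splitting_nat:
  assumes "comm_group A" "group G" "finite (carrier G)"
    and root: "\<And>a (e::nat) (n::nat). \<lbrakk>a \<in> carrier A; a [^]\<^bsub>A\<^esub> e = \<one>\<^bsub>A\<^esub>; e > 0; n > 0\<rbrakk>
          \<Longrightarrow> \<exists>b\<in>carrier A. b [^]\<^bsub>A\<^esub> n = a"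
    and K: "subgroup K G" "K \<subseteq> centre G" and \<kappa>: "\<kappa> \<in> characters A G K" "inj_on \<kappa> K"
  obtains P and Q :: "nat monoid" and r where "torsion_splitting A G K \<kappa> P Q r" "finite (carrier Q)"
proof -
  interpret A: comm_group A by fact
  interpret G: group G by fact
  interpret AG: group "A \<times>\<times> G" by (rule DirProd_group) unfold_locales
  interpret K: subgroup K G by fact
  have \<kappa>h: "\<kappa> \<in> hom (G\<lparr>carrier := K\<rparr>) A" using \<kappa>(1) by (simp add: characters_def)
  interpret \<kappa>: group_hom "G\<lparr>carrier := K\<rparr>" A \<kappa>
    by (intro group_hom.intro group_hom_axioms.intro \<kappa>h A.group_axioms K.subgroup_is_group[OF G.group_axioms])
  have \<kappa>c: "\<kappa> k \<in> carrier A" if "k \<in> K" for k using that \<kappa>.hom_closed by simp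
  have \<kappa>m: "\<kappa> (k \<otimes>\<^bsub>G\<^esub> l) = \<kappa> k \<otimes>\<^bsub>A\<^esub> \<kappa> l" if "k \<in> K" "l \<in> K" for k l
    using that \<kappa>.hom_mult by simp
  have \<kappa>1: "\<kappa> \<one>\<^bsub>G\<^esub> = \<one>\<^bsub>A\<^esub>" using \<kappa>.hom_one by simp
  have \<kappa>i: "\<kappa> (inv\<^bsub>G\<^esub> k) = inv\<^bsub>A\<^esub> \<kappa> k" if "k \<in> K" for k
    by (metis A.inv_equality K.m_inv_closed K.mem_carrier G.l_inv \<kappa>1 \<kappa>c \<kappa>m that)
  obtain P where P: "subgroup P (A \<times>\<times> G)"
    "\<And>k. k \<in> K \<Longrightarrow> (inv\<^bsub>A\<^esub> \<kappa> k, k) \<in> P"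
    "\<And>d. d \<in> derived G (carrier G) \<Longrightarrow> (\<one>\<^bsub>A\<^esub>, d) \<in> P"
    "\<And>a. (a, \<one>\<^bsub>G\<^esub>) \<in> P \<Longrightarrow> a \<in> \<kappa> ` (K \<inter> derived G (carrier G))"
    "snd ` P = carrier G"
    by (rule exists_torsion_splitting[OF assms(1-3) root K \<kappa>h]) (assumption | blast)+
  interpret P: subgroup P "A \<times>\<times> G" by (rule P)
  interpret Pg: group "(A \<times>\<times> G)\<lparr>carrier := P\<rparr>" by (rule P.subgroup_is_group[OF AG.group_axioms])
  \<comment> \<open>a choice of a point of \<open>P\<close> over each \<open>g\<close>, from which the other ones differ by elements of \<open>\<kappa>(K)\<close>\<close>
  have "finite P"
  proof -
    define s where "s g = (SOME a. (a, g) \<in> P)" for g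
    have s: "(s g, g) \<in> P" if "g \<in> carrier G" for g
    proof -
      have "\<exists>a. (a, g) \<in> P" using P(5) that by force
      then show ?thesis unfolding s_def by (rule someI_ex)
    qed
    have "P \<subseteq> (\<lambda>(k, g). (\<kappa> k \<otimes>\<^bsub>A\<^esub> s g, g)) ` (K \<times> carrier G)"
    proof
      fix x assume "x \<in> P"
      then obtain a g where x: "x = (a, g)" "(a, g) \<in> P" "a \<in> carrier A" "g \<in> carrier G"
        using P.subset by auto
      have sc: "s g \<in> carrier A" using s[OF x(4)] P.subset by auto
      have "(a \<otimes>\<^bsub>A\<^esub> inv\<^bsub>A\<^esub> s g, \<one>\<^bsub>G\<^esub>) \<in> P"
        using P.m_closed[OF x(2) P.m_inv_closed[OF s[OF x(4)]]] x sc by (simp add: A.group_axioms G.group_axioms)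
      then obtain k where "k \<in> K" "a \<otimes>\<^bsub>A\<^esub> inv\<^bsub>A\<^esub> s g = \<kappa> k" using P(4) by blast
      moreover have "a = (a \<otimes>\<^bsub>A\<^esub> inv\<^bsub>A\<^esub> s g) \<otimes>\<^bsub>A\<^esub> s g" using x sc by (simp add: A.m_assoc)
      ultimately show "x \<in> (\<lambda>(k, g). (\<kappa> k \<otimes>\<^bsub>A\<^esub> s g, g)) ` (K \<times> carrier G)"
        using x by (intro image_eqI[of _ _ "(k, g)"]) auto
    qed
    moreover have "finite K" using K.subset assms(3) finite_subset by blast
    ultimately show ?thesis using assms(3) by (auto intro: finite_subset)
  qed
  define N where "N = {(inv\<^bsub>A\<^esub> \<kappa> k, k) | k. k \<in> K}"
  have N: "N \<lhd> (A \<times>\<times> G)\<lparr>carrier := P\<rparr>"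
    unfolding Pg.normal_inv_iff
  proof (intro conjI ballI)
    have "subgroup N (A \<times>\<times> G)"
    proof (rule AG.subgroupI)
      show "N \<subseteq> carrier (A \<times>\<times> G)" by (auto simp: N_def \<kappa>c)
      have "(inv\<^bsub>A\<^esub> \<kappa> \<one>\<^bsub>G\<^esub>, \<one>\<^bsub>G\<^esub>) \<in> N" using K.one_closed unfolding N_def by blast
      then show "N \<noteq> {}" by blast
      show "inv\<^bsub>A \<times>\<times> G\<^esub> x \<in> N" if "x \<in> N" for x
        using that by (auto simp: N_def \<kappa>c \<kappa>i A.group_axioms G.group_axioms)
      show "x \<otimes>\<^bsub>A \<times>\<times> G\<^esub> y \<in> N" if "x \<in> N" "y \<in> N" for x y
        using that by (auto simp: N_def \<kappa>c \<kappa>m A.inv_mult)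
    qed
    moreover have NP: "N \<subseteq> P" using P(2) by (auto simp: N_def)
    ultimately show "subgroup N ((A \<times>\<times> G)\<lparr>carrier := P\<rparr>)" using AG.subgroup_incl P(1) by blast
    fix x y assume x: "x \<in> carrier ((A \<times>\<times> G)\<lparr>carrier := P\<rparr>)" and y: "y \<in> N"
    obtain a b k where abk: "x = (a, b)" "a \<in> carrier A" "b \<in> carrier G" "k \<in> K" "y = (inv\<^bsub>A\<^esub> \<kappa> k, k)"
      using x y P.subset by (auto simp: N_def)
    then have "k \<otimes>\<^bsub>G\<^esub> b = b \<otimes>\<^bsub>G\<^esub> k" using K(2) by (auto simp: centre_def)
    then have "x \<otimes>\<^bsub>A \<times>\<times> G\<^esub> y = y \<otimes>\<^bsub>A \<times>\<times> G\<^esub> x"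
      using abk \<kappa>c by (simp add: A.m_comm)
    then have "x \<otimes>\<^bsub>(A \<times>\<times> G)\<lparr>carrier := P\<rparr>\<^esub> y = y \<otimes>\<^bsub>(A \<times>\<times> G)\<lparr>carrier := P\<rparr>\<^esub> x" by simp
    moreover have "y \<in> carrier ((A \<times>\<times> G)\<lparr>carrier := P\<rparr>)" using NP y by auto
    ultimately have "x \<otimes>\<^bsub>(A \<times>\<times> G)\<lparr>carrier := P\<rparr>\<^esub> y \<otimes>\<^bsub>(A \<times>\<times> G)\<lparr>carrier := P\<rparr>\<^esub>
        inv\<^bsub>(A \<times>\<times> G)\<lparr>carrier := P\<rparr>\<^esub> x = y"
      using x by (metis Pg.inv_solve_right Pg.m_closed)
    then show "x \<otimes>\<^bsub>(A \<times>\<times> G)\<lparr>carrier := P\<rparr>\<^esub> y \<otimes>\<^bsub>(A \<times>\<times> G)\<lparr>carrier := P\<rparr>\<^esub>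
        inv\<^bsub>(A \<times>\<times> G)\<lparr>carrier := P\<rparr>\<^esub> x \<in> N" using y by simp
  qed
  obtain Q :: "nat monoid" and r where Q: "group Q" "finite (carrier Q)" "r \<in> hom ((A \<times>\<times> G)\<lparr>carrier := P\<rparr>) Q"
    "r ` P = carrier Q" "\<And>x. x \<in> P \<Longrightarrow> r x = \<one>\<^bsub>Q\<^esub> \<longleftrightarrow> x \<in> N"
    using nat_model_of_quotient[OF N] \<open>finite P\<close> by auto
  have "torsion_splitting A G K \<kappa> P Q r"
  proof (intro torsion_splitting.intro torsion_splitting_axioms.intro)
    show "r x = \<one>\<^bsub>Q\<^esub> \<longleftrightarrow> (\<exists>k\<in>K. x = (inv\<^bsub>A\<^esub> \<kappa> k, k))" if "x \<in> P" for x
      using Q(5)[OF that] by (auto simp: N_def)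
  qed (use assms P Q in blast)+
  then show thesis using that Q(2) by blast
qed

section \<open>Transitive bisets and stabilizers\<close>

lemma group_actionI:
  assumes "group T"
    and closed: "\<And>t x. t \<in> carrier T \<Longrightarrow> x \<in> E \<Longrightarrow> f t x \<in> E"
    and ext: "\<And>t. t \<in> carrier T \<Longrightarrow> f t \<in> extensional E"
    and one: "\<And>x. x \<in> E \<Longrightarrow> f \<one>\<^bsub>T\<^esub> x = x"
    and mult: "\<And>s t x. \<lbrakk>s \<in> carrier T; t \<in> carrier T; x \<in> E\<rbrakk> \<Longrightarrow> f (s \<otimes>\<^bsub>T\<^esub> t) x = f s (f t x)"
  shows "group_action T E f"
proof -
  interpret T: group T by fact
  have bij: "f t \<in> Bij E" if t: "t \<in> carrier T" for t
  proof -
    have "f (inv\<^bsub>T\<^esub> t) (f t x) = x" "f t (f (inv\<^bsub>T\<^esub> t) x) = x" if "x \<in> E" for x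
      using t that by (simp_all add: mult[symmetric] one)
    then have "bij_betw (f t) E E"
      using t by (intro bij_betw_byWitness[where f' = "f (inv\<^bsub>T\<^esub> t)"]) (auto simp: closed)
    then show ?thesis using ext t by (simp add: Bij_def)
  qed
  have "f \<in> hom T (BijGroup E)"
  proof (rule homI)
    fix s t assume st: "s \<in> carrier T" "t \<in> carrier T"
    show "f (s \<otimes>\<^bsub>T\<^esub> t) = f s \<otimes>\<^bsub>BijGroup E\<^esub> f t"
    proof
      fix x show "f (s \<otimes>\<^bsub>T\<^esub> t) x = (f s \<otimes>\<^bsub>BijGroup E\<^esub> f t) x"
      proof (cases "x \<in> E")
        case True
        then show ?thesis using st by (simp add: BijGroup_def bij mult compose_def)
      next
        case False
        then show ?thesis
          using st ext[of "s \<otimes>\<^bsub>T\<^esub> t"] by (simp add: BijGroup_def bij compose_def extensional_def)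
      qed
    qed
  qed (simp add: BijGroup_def bij)
  then show ?thesis
    by (intro group_action.intro group_hom.intro group_hom_axioms.intro group_BijGroup assms(1))
qed

context group_action
begin

lemma grp: "group G"
  using group_hom by (simp add: group_hom_def)

lemma act_closed: "t \<in> carrier G \<Longrightarrow> x \<in> E \<Longrightarrow> \<phi> t x \<in> E"
  using element_image by blast

lemma act_one: "x \<in> E \<Longrightarrow> \<phi> \<one> x = x"
  using id_eq_one by (metis restrict_apply')

lemma act_outside: "t \<in> carrier G \<Longrightarrow> \<phi> t \<in> extensional E"
  using bij_prop0 by (simp add: Bij_def)

lemma act_inv: "t \<in> carrier G \<Longrightarrow> x \<in> E \<Longrightarrow> \<phi> (inv t) (\<phi> t x) = x"
  using orbit_sym_aux by blast

lemma act_eq_iff: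
  assumes "s \<in> carrier G" "t \<in> carrier G" "x \<in> E"
  shows "\<phi> s x = \<phi> t x \<longleftrightarrow> inv t \<otimes> s \<in> stabilizer G \<phi> x"
proof -
  interpret group G by (rule grp)
  have "\<phi> (inv t \<otimes> s) x = \<phi> (inv t) (\<phi> s x)" using assms by (simp add: composition_rule)
  moreover have "\<phi> t (\<phi> (inv t) (\<phi> s x)) = \<phi> s x"
    using assms act_inv[of "inv t" "\<phi> s x"] by (simp add: act_closed)
  ultimately show ?thesis using assms act_inv[of t x] by (auto simp: stabilizer_def)
qed

lemma orbit_eq_iff:
  assumes "x \<in> E" "y \<in> E"
  shows "orbit G \<phi> x = orbit G \<phi> y \<longleftrightarrow> y \<in> orbit G \<phi> x"
proof -
  have sub: "orbit G \<phi> z \<subseteq> E" if "z \<in> E" for z using that act_closed by (auto simp: orbit_def)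
  have mono: "orbit G \<phi> v \<subseteq> orbit G \<phi> u" if "u \<in> E" "v \<in> E" "v \<in> orbit G \<phi> u" for u v
    using orbit_trans[OF that(1,2) _ that(3)] sub[OF that(2)] by blast
  show ?thesis
    using mono[OF assms] mono[OF assms(2,1) orbit_sym[OF assms]] orbit_refl[OF assms(2)] by blast
qed

end

text \<open>
  Transitivity of \<open>X\<close> together with the stabilizer of one of its points. Unlike \<open>trans_biset\<close>, this
  applies directly to opposite bisets and tensor products.
\<close>

definition transitive_at ::
  "'a monoid \<Rightarrow> 'g monoid \<Rightarrow> 'h monoid \<Rightarrow> ('a, 'g, 'h, 'x) fbiset \<Rightarrow> 'x \<Rightarrow> ('a \<times> 'g \<times> 'h) set \<Rightarrow> bool" where
  "transitive_at A G H X x S \<longleftrightarrow>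
     group_action (A \<times>\<times> G \<times>\<times> H) (pts X) (act X) \<and> x \<in> pts X \<and>
     (\<forall>y\<in>pts X. \<exists>t\<in>carrier (A \<times>\<times> G \<times>\<times> H). y = act X t x) \<and>
     stabilizer (A \<times>\<times> G \<times>\<times> H) (act X) x = S"

text \<open>
  The isomorphism sends \<open>t x\<close> to \<open>t y\<close>. It is well defined and injective because \<open>s x = t x\<close> and
  \<open>s y = t y\<close> both mean \<open>t\<^sup>-\<^sup>1 s \<in> S\<close>.
\<close>

lemma fbiset_iso_if_same_stabilizer:
  assumes "transitive_at A G H X x S" "transitive_at A G H Y y S"
  shows "fbiset_iso A G H X Y"
proof -
  let ?T = "A \<times>\<times> G \<times>\<times> H"
  interpret X: group_action ?T "pts X" "act X" using assms by (auto simp: transitive_at_def)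
  interpret Y: group_action ?T "pts Y" "act Y" using assms by (auto simp: transitive_at_def)
  interpret T: group ?T by (rule X.grp)
  have x: "x \<in> pts X" and y: "y \<in> pts Y" using assms by (auto simp: transitive_at_def)
  have eq: "act X s x = act X t x \<longleftrightarrow> act Y s y = act Y t y" if "s \<in> carrier ?T" "t \<in> carrier ?T" for s t
    using X.act_eq_iff[OF that x] Y.act_eq_iff[OF that y] assms by (simp add: transitive_at_def)
  define g where "g z = (SOME t. t \<in> carrier ?T \<and> z = act X t x)" for z
  have g: "g z \<in> carrier ?T" "z = act X (g z) x" if "z \<in> pts X" for z
  proof -
    have "\<exists>t. t \<in> carrier ?T \<and> z = act X t x" using assms(1) that by (auto simp only: transitive_at_def)
    from someI_ex[OF this] show "g z \<in> carrier ?T" "z = act X (g z) x" by (simp_all add: g_def)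
  qed
  define f where "f z = act Y (g z) y" for z
  have f: "f (act X t x) = act Y t y" if "t \<in> carrier ?T" for t
    using eq[of "g (act X t x)" t] g[of "act X t x"] that X.act_closed[OF that x] by (simp add: f_def)
  have rep: "\<exists>t\<in>carrier ?T. z = act X t x" if "z \<in> pts X" for z using g that by blast
  have "inj_on f (pts X)"
    by (rule inj_onI) (metis rep f eq)
  moreover have "f ` pts X = pts Y"
  proof
    show "f ` pts X \<subseteq> pts Y" unfolding f_def using Y.act_closed[OF g(1) y] by blast
    show "pts Y \<subseteq> f ` pts X"
    proof
      fix w assume "w \<in> pts Y"
      then obtain t where "t \<in> carrier ?T" "w = act Y t y" using assms(2) by (auto simp only: transitive_at_def)
      then show "w \<in> f ` pts X" using f X.act_closed x by (intro image_eqI[of _ _ "act X t x"]) auto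
    qed
  qed
  moreover have "f (act X t z) = act Y t (f z)" if t: "t \<in> carrier ?T" and z: "z \<in> pts X" for t z
  proof -
    obtain s where s: "s \<in> carrier ?T" "z = act X s x" using rep z by blast
    have "f (act X t z) = f (act X (t \<otimes>\<^bsub>?T\<^esub> s) x)" using s t x by (simp only: X.composition_rule)
    also have "\<dots> = act Y t (f z)" using s t y by (simp only: f T.m_closed Y.composition_rule)
    finally show ?thesis .
  qed
  ultimately show ?thesis unfolding fbiset_iso_def bij_betw_def by blast
qed

lemma triple_group: "group A \<Longrightarrow> group G \<Longrightarrow> group H \<Longrightarrow> group (A \<times>\<times> G \<times>\<times> H)"
  by (intro DirProd_group)

lemma group_action_lcosets:
  assumes "group T" "S \<subseteq> carrier T"
  shows "group_action T (lcosets\<^bsub>T\<^esub> S) (\<lambda>t. \<lambda>c\<in>lcosets\<^bsub>T\<^esub> S. t <#\<^bsub>T\<^esub> c)"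
proof -
  interpret T: group T by fact
  have *: "s <#\<^bsub>T\<^esub> (t <#\<^bsub>T\<^esub> S) = (s \<otimes>\<^bsub>T\<^esub> t) <#\<^bsub>T\<^esub> S" if "s \<in> carrier T" "t \<in> carrier T" for s t
    using T.lcos_m_assoc assms(2) that by simp
  have cl: "t <#\<^bsub>T\<^esub> c \<in> lcosets\<^bsub>T\<^esub> S" if "t \<in> carrier T" "c \<in> lcosets\<^bsub>T\<^esub> S" for t c
    using that by (auto simp: LCOSETS_def *)
  show ?thesis
  proof (rule group_actionI[OF assms(1)])
    fix c assume "c \<in> lcosets\<^bsub>T\<^esub> S"
    then show "(\<lambda>c\<in>lcosets\<^bsub>T\<^esub> S. \<one>\<^bsub>T\<^esub> <#\<^bsub>T\<^esub> c) c = c" by (auto simp: LCOSETS_def *)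
  next
    fix s t c assume st: "s \<in> carrier T" "t \<in> carrier T" and c: "c \<in> lcosets\<^bsub>T\<^esub> S"
    then obtain u where "u \<in> carrier T" "c = u <#\<^bsub>T\<^esub> S" by (auto simp: LCOSETS_def)
    then have "(s \<otimes>\<^bsub>T\<^esub> t) <#\<^bsub>T\<^esub> c = s <#\<^bsub>T\<^esub> (t <#\<^bsub>T\<^esub> c)" using st by (simp add: * T.m_assoc)
    then show "(\<lambda>c\<in>lcosets\<^bsub>T\<^esub> S. (s \<otimes>\<^bsub>T\<^esub> t) <#\<^bsub>T\<^esub> c) c
       = (\<lambda>c\<in>lcosets\<^bsub>T\<^esub> S. s <#\<^bsub>T\<^esub> c) ((\<lambda>c\<in>lcosets\<^bsub>T\<^esub> S. t <#\<^bsub>T\<^esub> c) c)"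
      using c cl st by simp
  qed (auto simp: cl)
qed

lemma transitive_at_trans_biset:
  assumes "comm_group A" "group G" "group H" "(U, \<phi>) \<in> char_pairs A (G \<times>\<times> H)"
  shows "transitive_at A G H (trans_biset A G H U \<phi>) (twisted_graph A U \<phi>) (twisted_graph A U \<phi>)"
proof -
  let ?T = "A \<times>\<times> G \<times>\<times> H"
  let ?S = "twisted_graph A U \<phi>"
  interpret T: group ?T using assms by (intro triple_group) (simp_all add: comm_group_def)
  have S: "subgroup ?S ?T" by (rule subgroup_twisted_graph(1)[OF assms(1) DirProd_group[OF assms(2,3)] assms(4)])
  note SC = subgroup.subset[OF S]
  have "?S = \<one>\<^bsub>?T\<^esub> <#\<^bsub>?T\<^esub> ?S" using T.lcos_mult_one[OF SC] by simp
  then have SL: "?S \<in> lcosets\<^bsub>?T\<^esub> ?S" unfolding LCOSETS_def by blast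
  have pts: "pts (trans_biset A G H U \<phi>) = lcosets\<^bsub>?T\<^esub> ?S"
    and act: "act (trans_biset A G H U \<phi>) = (\<lambda>t. \<lambda>c\<in>lcosets\<^bsub>?T\<^esub> ?S. t <#\<^bsub>?T\<^esub> c)"
    by (simp_all only: trans_biset_def Let_def fbiset.simps)
  have "stabilizer ?T (act (trans_biset A G H U \<phi>)) ?S = ?S"
  proof (intro subset_antisym subsetI)
    fix t assume "t \<in> stabilizer ?T (act (trans_biset A G H U \<phi>)) ?S"
    then have "t \<in> carrier ?T" "t <#\<^bsub>?T\<^esub> ?S = ?S" using SL by (simp_all only: stabilizer_def act mem_Collect_eq restrict_apply if_True)
    then show "t \<in> ?S" using T.lcos_self S by blast
  next
    fix t assume t: "t \<in> ?S"
    then have tT: "t \<in> carrier ?T" using SC by blast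
    have "t <#\<^bsub>?T\<^esub> ?S = ?S"
      using T.coset_join3[OF tT S t] .
    then show "t \<in> stabilizer ?T (act (trans_biset A G H U \<phi>)) ?S"
      using SL tT by (simp only: stabilizer_def act mem_Collect_eq restrict_apply if_True simp_thms)
  qed
  moreover have "\<exists>t\<in>carrier ?T. y = act (trans_biset A G H U \<phi>) t ?S" if "y \<in> lcosets\<^bsub>?T\<^esub> ?S" for y
    using that SL unfolding act LCOSETS_def by (simp only: restrict_apply if_True) blast
  ultimately show ?thesis
    unfolding transitive_at_def pts using group_action_lcosets[OF T.group_axioms SC] SL
    by (simp only: act) blast
qed

lemma transitive_at_op_biset:
  assumes "comm_group A" "group G" "group H" "transitive_at A G H X x S"
  shows "transitive_at A H G (op_biset A X) x {(inv\<^bsub>A\<^esub> a, h, g) | a g h. (a, g, h) \<in> S}"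
proof -
  interpret A: comm_group A by fact
  interpret G: group G by fact
  interpret H: group H by fact
  let ?T = "A \<times>\<times> G \<times>\<times> H"
  let ?T' = "A \<times>\<times> H \<times>\<times> G"
  interpret X: group_action ?T "pts X" "act X" using assms by (auto simp only: transitive_at_def)
  have act: "act (op_biset A X) (a, h, g) = act X (inv\<^bsub>A\<^esub> a, g, h)" for a g h by (simp add: op_biset_def)
  have pts: "pts (op_biset A X) = pts X" by (simp add: op_biset_def)
  have SC: "S \<subseteq> carrier ?T" and S: "stabilizer ?T (act X) x = S" and x: "x \<in> pts X"
    using assms X.stabilizer_subset by (auto simp only: transitive_at_def)
  have "group_action ?T' (pts X) (act (op_biset A X))"
  proof (rule group_actionI)
    show "group ?T'" by (intro triple_group) unfold_locales
    show "act (op_biset A X) t \<in> extensional (pts X)" if "t \<in> carrier ?T'" for t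
      using that X.act_outside by (auto simp: act)
    show "act (op_biset A X) t y \<in> pts X" if "t \<in> carrier ?T'" "y \<in> pts X" for t y
      using that X.act_closed by (auto simp: act)
    show "act (op_biset A X) \<one>\<^bsub>?T'\<^esub> y = y" if "y \<in> pts X" for y
      using that X.act_one by (simp add: act)
    show "act (op_biset A X) (s \<otimes>\<^bsub>?T'\<^esub> t) y = act (op_biset A X) s (act (op_biset A X) t y)"
      if "s \<in> carrier ?T'" "t \<in> carrier ?T'" "y \<in> pts X" for s t y
      using that by (auto simp: act X.composition_rule[symmetric] A.inv_mult)
  qed
  moreover have "\<exists>t\<in>carrier ?T'. y = act (op_biset A X) t x" if y: "y \<in> pts X" for y
  proof -
    obtain a g h where "(a, g, h) \<in> carrier ?T" "y = act X (a, g, h) x"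
      using y assms(4) unfolding transitive_at_def by (metis prod_cases3)
    then show ?thesis
      by (intro bexI[of _ "(inv\<^bsub>A\<^esub> a, h, g)"]) (simp_all add: act)
  qed
  moreover have "stabilizer ?T' (act (op_biset A X)) x = {(inv\<^bsub>A\<^esub> a, h, g) | a g h. (a, g, h) \<in> S}"
  proof (intro subset_antisym subsetI)
    fix t assume "t \<in> stabilizer ?T' (act (op_biset A X)) x"
    then obtain a h g where "t = (a, h, g)" "a \<in> carrier A" "h \<in> carrier H" "g \<in> carrier G"
      "act X (inv\<^bsub>A\<^esub> a, g, h) x = x" by (auto simp: stabilizer_def act)
    then show "t \<in> {(inv\<^bsub>A\<^esub> a, h, g) | a g h. (a, g, h) \<in> S}"
      unfolding S[symmetric] stabilizer_def
      by (intro CollectI exI[of _ "inv\<^bsub>A\<^esub> a"] exI[of _ g] exI[of _ h]) auto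
  next
    fix t assume "t \<in> {(inv\<^bsub>A\<^esub> a, h, g) | a g h. (a, g, h) \<in> S}"
    then show "t \<in> stabilizer ?T' (act (op_biset A X)) x"
      unfolding S[symmetric] stabilizer_def by (auto simp: act)
  qed
  ultimately show ?thesis using x by (simp only: transitive_at_def pts simp_thms) blast
qed

text \<open>
  Every coset is an \<open>A\<close>-translate of one represented by some \<open>(1, g, h)\<close>, so there are at most
  \<open>|G| |H|\<close> orbits of \<open>A\<close>.
\<close>

lemma fibered_biset_trans_biset:
  assumes "comm_group A" "group G" "group H" "finite (carrier G)" "finite (carrier H)"
    and "(U, \<phi>) \<in> char_pairs A (G \<times>\<times> H)"
  shows "fibered_biset A G H (trans_biset A G H U \<phi>)"
proof -
  interpret A: comm_group A by fact
  interpret G: group G by fact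
  interpret H: group H by fact
  let ?T = "A \<times>\<times> G \<times>\<times> H"
  let ?X = "trans_biset A G H U \<phi>"
  let ?S = "twisted_graph A U \<phi>"
  have t: "transitive_at A G H ?X ?S ?S" by (rule transitive_at_trans_biset) fact+
  then interpret X: group_action ?T "pts ?X" "act ?X" by (auto simp only: transitive_at_def)
  have S: "stabilizer ?T (act ?X) ?S = ?S" and base: "?S \<in> pts ?X" using t by (auto simp only: transitive_at_def)
  have rep: "\<exists>a\<in>carrier A. \<exists>g\<in>carrier G. \<exists>h\<in>carrier H. y = act ?X (a, g, h) ?S" if "y \<in> pts ?X" for y
    using t that by (fastforce simp: transitive_at_def)
  have split: "act ?X (a, g, h) ?S = act ?X (a, \<one>\<^bsub>G\<^esub>, \<one>\<^bsub>H\<^esub>) (act ?X (\<one>\<^bsub>A\<^esub>, g, h) ?S)"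
    if "a \<in> carrier A" "g \<in> carrier G" "h \<in> carrier H" for a g h
    using that base by (simp add: X.composition_rule[symmetric])
  have "stabilizer A (\<lambda>a. act ?X (a, \<one>\<^bsub>G\<^esub>, \<one>\<^bsub>H\<^esub>)) y = {\<one>\<^bsub>A\<^esub>}" if y: "y \<in> pts ?X" for y
  proof -
    obtain b g h where b: "b \<in> carrier A" "g \<in> carrier G" "h \<in> carrier H" "y = act ?X (b, g, h) ?S"
      using rep y by blast
    have "a = \<one>\<^bsub>A\<^esub>" if a: "a \<in> carrier A" "act ?X (a, \<one>\<^bsub>G\<^esub>, \<one>\<^bsub>H\<^esub>) y = y" for a
    proof -
      have "act ?X (a \<otimes>\<^bsub>A\<^esub> b, g, h) ?S = act ?X (b, g, h) ?S"
        using a b base X.composition_rule[of ?S "(a, \<one>\<^bsub>G\<^esub>, \<one>\<^bsub>H\<^esub>)" "(b, g, h)"] by simp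
      then have "inv\<^bsub>?T\<^esub> (b, g, h) \<otimes>\<^bsub>?T\<^esub> (a \<otimes>\<^bsub>A\<^esub> b, g, h) \<in> ?S"
        using X.act_eq_iff[of "(a \<otimes>\<^bsub>A\<^esub> b, g, h)" "(b, g, h)" ?S] a b base S by simp
      then have "(inv\<^bsub>A\<^esub> b \<otimes>\<^bsub>A\<^esub> (a \<otimes>\<^bsub>A\<^esub> b), \<one>\<^bsub>G \<times>\<times> H\<^esub>) \<in> ?S"
        using a b by (simp add: DirProd_group A.group_axioms G.group_axioms H.group_axioms)
      then have "inv\<^bsub>A\<^esub> b \<otimes>\<^bsub>A\<^esub> (a \<otimes>\<^bsub>A\<^esub> b) = \<one>\<^bsub>A\<^esub>"
        by (rule subgroup_twisted_graph(2)[OF assms(1) DirProd_group[OF assms(2,3)] assms(6)])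
      then show "a = \<one>\<^bsub>A\<^esub>" using a b by (simp add: A.m_comm[of a b] A.m_assoc[symmetric])
    qed
    then show ?thesis using X.act_one[OF y] by (auto simp: stabilizer_def)
  qed
  moreover have "finite (orbits A (pts ?X) (\<lambda>a. act ?X (a, \<one>\<^bsub>G\<^esub>, \<one>\<^bsub>H\<^esub>)))"
  proof (rule finite_subset)
    let ?o = "\<lambda>(g, h). orbit A (\<lambda>a. act ?X (a, \<one>\<^bsub>G\<^esub>, \<one>\<^bsub>H\<^esub>)) (act ?X (\<one>\<^bsub>A\<^esub>, g, h) ?S)"
    show "orbits A (pts ?X) (\<lambda>a. act ?X (a, \<one>\<^bsub>G\<^esub>, \<one>\<^bsub>H\<^esub>)) \<subseteq> ?o ` (carrier G \<times> carrier H)"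
    proof
      fix c assume "c \<in> orbits A (pts ?X) (\<lambda>a. act ?X (a, \<one>\<^bsub>G\<^esub>, \<one>\<^bsub>H\<^esub>))"
      then obtain y where y: "y \<in> pts ?X" "c = orbit A (\<lambda>a. act ?X (a, \<one>\<^bsub>G\<^esub>, \<one>\<^bsub>H\<^esub>)) y"
        by (auto simp: orbits_def)
      obtain b g h where b: "b \<in> carrier A" "g \<in> carrier G" "h \<in> carrier H" "y = act ?X (b, g, h) ?S"
        using rep y by blast
      define z where "z = act ?X (\<one>\<^bsub>A\<^esub>, g, h) ?S"
      have z: "z \<in> pts ?X" using b base X.act_closed by (simp add: z_def)
      have "act ?X (a, \<one>\<^bsub>G\<^esub>, \<one>\<^bsub>H\<^esub>) y = act ?X (a \<otimes>\<^bsub>A\<^esub> b, \<one>\<^bsub>G\<^esub>, \<one>\<^bsub>H\<^esub>) z" if "a \<in> carrier A" for a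
        using that b base by (simp add: z_def X.composition_rule[symmetric])
      then have "c = (\<lambda>a. act ?X (a \<otimes>\<^bsub>A\<^esub> b, \<one>\<^bsub>G\<^esub>, \<one>\<^bsub>H\<^esub>) z) ` carrier A"
        unfolding y(2) orbit_def by (force simp: image_iff)
      also have "\<dots> = (\<lambda>a. act ?X (a, \<one>\<^bsub>G\<^esub>, \<one>\<^bsub>H\<^esub>) z) ` ((\<lambda>a. a \<otimes>\<^bsub>A\<^esub> b) ` carrier A)"
        by (simp add: image_image)
      also have "(\<lambda>a. a \<otimes>\<^bsub>A\<^esub> b) ` carrier A = carrier A" using A.surj_const_mult b A.m_comm
        by (metis (no_types, lifting) image_cong)
      finally have "c = ?o (g, h)" by (auto simp: orbit_def z_def)
      then show "c \<in> ?o ` (carrier G \<times> carrier H)" using b by blast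
    qed
  qed (use assms in simp)
  ultimately show ?thesis unfolding fibered_biset_def using X.group_action_axioms by blast
qed

section \<open>Stabilizers in tensor products\<close>

text \<open>
  On the graphs of \<open>(U, \<phi>)\<close> and \<open>(V, \<psi>)\<close>, this is composition of relations with the values of the
  characters multiplied along the way.
\<close>

definition graph_comp :: "'a monoid \<Rightarrow> ('a \<times> 'g \<times> 'h) set \<Rightarrow> ('a \<times> 'h \<times> 'i) set \<Rightarrow> ('a \<times> 'g \<times> 'i) set" where
  "graph_comp A S T = {(a \<otimes>\<^bsub>A\<^esub> b, g, i) | a b g h i. (a, g, h) \<in> S \<and> (b, h, i) \<in> T}"

lemma graph_compI:
  "(a, g, h) \<in> S \<Longrightarrow> (b, h, i) \<in> T \<Longrightarrow> x = a \<otimes>\<^bsub>A\<^esub> b \<Longrightarrow> (x, g, i) \<in> graph_comp A S T"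
  unfolding graph_comp_def by blast

locale tensor_factors = A: comm_group A + G: group G + H: group H + I: group I +
    X: group_action "A \<times>\<times> G \<times>\<times> H" "pts X" "act X" + Y: group_action "A \<times>\<times> H \<times>\<times> I" "pts Y" "act Y"
  for A :: "'a monoid" and G :: "'g monoid" and H :: "'h monoid" and I :: "'i monoid"
    and X :: "('a, 'g, 'h, 'x) fbiset" and Y :: "('a, 'h, 'i, 'y) fbiset"
begin

abbreviation mid where "mid \<equiv> mid_action A G I X Y"
abbreviation outer where "outer \<equiv> outer_action A H X Y"

text \<open>
  The class of \<open>(x, y)\<close> before the restriction to the classes on which \<open>A\<close> acts freely.
\<close>

definition cls where "cls x y = orbit (A \<times>\<times> H) mid (x, y)"

sublocale AGI: group "A \<times>\<times> G \<times>\<times> I" by (intro triple_group) unfold_locales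

lemma mid_apply:
  "x \<in> pts X \<Longrightarrow> y \<in> pts Y \<Longrightarrow>
    mid (a, h) (x, y) = (act X (inv\<^bsub>A\<^esub> a, \<one>\<^bsub>G\<^esub>, h) x, act Y (a, h, \<one>\<^bsub>I\<^esub>) y)"
  by (simp add: mid_action_def)

lemma actX_closed: "a \<in> carrier A \<Longrightarrow> g \<in> carrier G \<Longrightarrow> h \<in> carrier H \<Longrightarrow> x \<in> pts X \<Longrightarrow> act X (a, g, h) x \<in> pts X"
  by (rule X.act_closed) simp_all

lemma actY_closed: "a \<in> carrier A \<Longrightarrow> h \<in> carrier H \<Longrightarrow> i \<in> carrier I \<Longrightarrow> y \<in> pts Y \<Longrightarrow> act Y (a, h, i) y \<in> pts Y"
  by (rule Y.act_closed) simp_all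

lemma actX_actX:
  "\<lbrakk>a \<in> carrier A; g \<in> carrier G; h \<in> carrier H; b \<in> carrier A; g' \<in> carrier G; h' \<in> carrier H; x \<in> pts X\<rbrakk> \<Longrightarrow>
    act X (a, g, h) (act X (b, g', h') x) = act X (a \<otimes>\<^bsub>A\<^esub> b, g \<otimes>\<^bsub>G\<^esub> g', h \<otimes>\<^bsub>H\<^esub> h') x"
  using X.composition_rule[of x "(a, g, h)" "(b, g', h')"] by simp

lemma actY_actY:
  "\<lbrakk>a \<in> carrier A; h \<in> carrier H; i \<in> carrier I; b \<in> carrier A; h' \<in> carrier H; i' \<in> carrier I; y \<in> pts Y\<rbrakk> \<Longrightarrow>
    act Y (a, h, i) (act Y (b, h', i') y) = act Y (a \<otimes>\<^bsub>A\<^esub> b, h \<otimes>\<^bsub>H\<^esub> h', i \<otimes>\<^bsub>I\<^esub> i') y"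
  using Y.composition_rule[of y "(a, h, i)" "(b, h', i')"] by simp

sublocale M: group_action "A \<times>\<times> H" "pts X \<times> pts Y" mid
proof (rule group_actionI)
  show "group (A \<times>\<times> H)" by (intro DirProd_group) unfold_locales
  show "mid t \<in> extensional (pts X \<times> pts Y)" for t
    by (cases t) (simp add: mid_action_def)
  show "mid t z \<in> pts X \<times> pts Y" if "t \<in> carrier (A \<times>\<times> H)" "z \<in> pts X \<times> pts Y" for t z
    using that by (auto simp: mid_apply actX_closed actY_closed)
  show "mid \<one>\<^bsub>A \<times>\<times> H\<^esub> z = z" if "z \<in> pts X \<times> pts Y" for z
    using that X.act_one Y.act_one by (auto simp: mid_apply)
  show "mid (s \<otimes>\<^bsub>A \<times>\<times> H\<^esub> t) z = mid s (mid t z)"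
    if "s \<in> carrier (A \<times>\<times> H)" "t \<in> carrier (A \<times>\<times> H)" "z \<in> pts X \<times> pts Y" for s t z
    using that by (auto simp: mid_apply actX_closed actY_closed actX_actX actY_actY A.inv_mult)
qed

text \<open>
  The outer action commutes with the action of \<open>A \<times> H\<close>; the components from \<open>A\<close> do so because \<open>A\<close> is abelian.
\<close>

lemma outer_cls:
  assumes "x \<in> pts X" "y \<in> pts Y" "a \<in> carrier A" "g \<in> carrier G" "i \<in> carrier I"
  shows "outer (a, g, i) (cls x y) = cls (act X (a, g, \<one>\<^bsub>H\<^esub>) x) (act Y (\<one>\<^bsub>A\<^esub>, \<one>\<^bsub>H\<^esub>, i) y)"
proof -
  define o1 where "o1 = (\<lambda>(x, y). (act X (a, g, \<one>\<^bsub>H\<^esub>) x, act Y (\<one>\<^bsub>A\<^esub>, \<one>\<^bsub>H\<^esub>, i) y))"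
  have "o1 (mid (b, h) (x, y)) = mid (b, h) (o1 (x, y))" if "b \<in> carrier A" "h \<in> carrier H" for b h
    using that assms by (simp add: o1_def mid_apply actX_closed actY_closed actX_actX actY_actY A.m_comm)
  then have "o1 ` cls x y = orbit (A \<times>\<times> H) mid (o1 (x, y))"
    by (force simp: cls_def orbit_def image_iff)
  then show ?thesis by (simp add: outer_action_def o1_def cls_def)
qed

text \<open>
  The class is fixed if and only if some \<open>(b, h)\<close> takes \<open>(x, y)\<close> to its translate by \<open>(a, g, i)\<close>. This means
  that \<open>(b a, g, h\<^sup>-\<^sup>1)\<close> fixes \<open>x\<close> and \<open>(b\<^sup>-\<^sup>1, h\<^sup>-\<^sup>1, i)\<close> fixes \<open>y\<close>.
\<close>

lemma cls_stabilizer: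
  assumes "x \<in> pts X" "y \<in> pts Y" "a \<in> carrier A" "g \<in> carrier G" "i \<in> carrier I"
  shows "outer (a, g, i) (cls x y) = cls x y \<longleftrightarrow>
    (a, g, i) \<in> graph_comp A (stabilizer (A \<times>\<times> G \<times>\<times> H) (act X) x) (stabilizer (A \<times>\<times> H \<times>\<times> I) (act Y) y)"
    (is "_ \<longleftrightarrow> _ \<in> graph_comp A ?S ?T")
proof -
  let ?x = "act X (a, g, \<one>\<^bsub>H\<^esub>) x" and ?y = "act Y (\<one>\<^bsub>A\<^esub>, \<one>\<^bsub>H\<^esub>, i) y"
  have XY: "?x \<in> pts X" "?y \<in> pts Y" using assms by (simp_all add: actX_closed actY_closed)
  have "outer (a, g, i) (cls x y) = cls x y \<longleftrightarrow> cls x y = cls ?x ?y"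
    unfolding outer_cls[OF assms] by (rule eq_commute)
  also have "\<dots> \<longleftrightarrow> (?x, ?y) \<in> orbit (A \<times>\<times> H) mid (x, y)"
    unfolding cls_def by (intro M.orbit_eq_iff SigmaI XY assms(1,2))
  also have "\<dots> \<longleftrightarrow> (\<exists>b\<in>carrier A. \<exists>h\<in>carrier H. (?x, ?y) = mid (b, h) (x, y))"
    unfolding orbit_def by (simp only: carrier_DirProd mem_Collect_eq) (metis SigmaE SigmaI)
  also have "\<dots> \<longleftrightarrow> (\<exists>b\<in>carrier A. \<exists>h\<in>carrier H.
      ?x = act X (inv\<^bsub>A\<^esub> b, \<one>\<^bsub>G\<^esub>, h) x \<and> ?y = act Y (b, h, \<one>\<^bsub>I\<^esub>) y)"
    by (simp only: mid_apply[OF assms(1,2)] prod.inject)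
  also have "\<dots> \<longleftrightarrow> (\<exists>b\<in>carrier A. \<exists>h\<in>carrier H. (b \<otimes>\<^bsub>A\<^esub> a, g, inv\<^bsub>H\<^esub> h) \<in> ?S \<and> (inv\<^bsub>A\<^esub> b, inv\<^bsub>H\<^esub> h, i) \<in> ?T)"
  proof (intro bex_cong refl arg_cong2[of _ _ _ _ "(\<and>)"])
    fix b h assume "b \<in> carrier A" "h \<in> carrier H"
    then show "?x = act X (inv\<^bsub>A\<^esub> b, \<one>\<^bsub>G\<^esub>, h) x \<longleftrightarrow> (b \<otimes>\<^bsub>A\<^esub> a, g, inv\<^bsub>H\<^esub> h) \<in> ?S"
      and "?y = act Y (b, h, \<one>\<^bsub>I\<^esub>) y \<longleftrightarrow> (inv\<^bsub>A\<^esub> b, inv\<^bsub>H\<^esub> h, i) \<in> ?T"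
      using assms X.act_eq_iff[of "(a, g, \<one>\<^bsub>H\<^esub>)" "(inv\<^bsub>A\<^esub> b, \<one>\<^bsub>G\<^esub>, h)" x]
        Y.act_eq_iff[of "(\<one>\<^bsub>A\<^esub>, \<one>\<^bsub>H\<^esub>, i)" "(b, h, \<one>\<^bsub>I\<^esub>)" y]
      by (simp_all add: DirProd_group A.group_axioms G.group_axioms H.group_axioms I.group_axioms)
  qed
  also have "\<dots> \<longleftrightarrow> (a, g, i) \<in> graph_comp A ?S ?T"
  proof
    assume "\<exists>b\<in>carrier A. \<exists>h\<in>carrier H. (b \<otimes>\<^bsub>A\<^esub> a, g, inv\<^bsub>H\<^esub> h) \<in> ?S \<and> (inv\<^bsub>A\<^esub> b, inv\<^bsub>H\<^esub> h, i) \<in> ?T"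
    then obtain b h where b: "b \<in> carrier A" "(b \<otimes>\<^bsub>A\<^esub> a, g, inv\<^bsub>H\<^esub> h) \<in> ?S" "(inv\<^bsub>A\<^esub> b, inv\<^bsub>H\<^esub> h, i) \<in> ?T"
      by blast
    have "a = (b \<otimes>\<^bsub>A\<^esub> a) \<otimes>\<^bsub>A\<^esub> inv\<^bsub>A\<^esub> b" using b assms by (simp add: A.m_comm[of b a] A.m_assoc)
    then show "(a, g, i) \<in> graph_comp A ?S ?T" unfolding graph_comp_def using b by blast
  next
    assume "(a, g, i) \<in> graph_comp A ?S ?T"
    then obtain c d h where c: "a = c \<otimes>\<^bsub>A\<^esub> d" "(c, g, h) \<in> ?S" "(d, h, i) \<in> ?T"
      by (auto simp: graph_comp_def)
    then have cl: "c \<in> carrier A" "d \<in> carrier A" "h \<in> carrier H" by (auto simp: stabilizer_def)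
    then have "inv\<^bsub>A\<^esub> d \<otimes>\<^bsub>A\<^esub> a = c" by (simp add: c(1) A.m_comm[of c d] A.m_assoc[symmetric])
    then show "\<exists>b\<in>carrier A. \<exists>h\<in>carrier H. (b \<otimes>\<^bsub>A\<^esub> a, g, inv\<^bsub>H\<^esub> h) \<in> ?S \<and> (inv\<^bsub>A\<^esub> b, inv\<^bsub>H\<^esub> h, i) \<in> ?T"
      using c cl by (intro bexI[of _ "inv\<^bsub>A\<^esub> d"] bexI[of _ "inv\<^bsub>H\<^esub> h"]) auto
  qed
  finally show ?thesis .
qed

lemma mid_orbit_iff:
  "c \<in> orbits (A \<times>\<times> H) (pts X \<times> pts Y) mid \<longleftrightarrow> (\<exists>u\<in>pts X. \<exists>v\<in>pts Y. c = cls u v)"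
  by (auto simp: orbits_def cls_def)

lemma pts_tensor: "c \<in> pts (tensor A G H I X Y) \<longleftrightarrow> c \<in> orbits (A \<times>\<times> H) (pts X \<times> pts Y) mid \<and>
    (\<forall>a\<in>carrier A. outer (a, \<one>\<^bsub>G\<^esub>, \<one>\<^bsub>I\<^esub>) c = c \<longrightarrow> a = \<one>\<^bsub>A\<^esub>)"
proof -
  have "outer (\<one>\<^bsub>A\<^esub>, \<one>\<^bsub>G\<^esub>, \<one>\<^bsub>I\<^esub>) c = c" if "c \<in> orbits (A \<times>\<times> H) (pts X \<times> pts Y) mid"
    using that X.act_one Y.act_one by (auto simp: mid_orbit_iff outer_cls)
  then show ?thesis by (auto simp: tensor_def Let_def stabilizer_def)
qed

lemma act_tensor: "c \<in> pts (tensor A G H I X Y) \<Longrightarrow> act (tensor A G H I X Y) t c = outer t c"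
  by (simp add: tensor_def Let_def)

text \<open>
  The classes with trivial stabilizer in \<open>A\<close> are permuted because \<open>A\<close> is central in \<open>A \<times> G \<times> I\<close>.
\<close>

lemma tensor_group_action:
  "group_action (A \<times>\<times> G \<times>\<times> I) (pts (tensor A G H I X Y)) (act (tensor A G H I X Y))"
proof -
  let ?O = "orbits (A \<times>\<times> H) (pts X \<times> pts Y) mid"
  let ?Z = "tensor A G H I X Y"
  let ?T = "A \<times>\<times> G \<times>\<times> I"
  have outer_O: "outer t c \<in> ?O" if "t \<in> carrier ?T" "c \<in> ?O" for t c
    using that by (auto simp: mid_orbit_iff outer_cls intro!: bexI actX_closed actY_closed)
  have outer_one: "outer \<one>\<^bsub>?T\<^esub> c = c" if "c \<in> ?O" for c
    using that X.act_one Y.act_one by (auto simp: mid_orbit_iff outer_cls)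
  have outer_mult: "outer (s \<otimes>\<^bsub>?T\<^esub> t) c = outer s (outer t c)"
    if "s \<in> carrier ?T" "t \<in> carrier ?T" "c \<in> ?O" for s t c
    using that by (auto simp: mid_orbit_iff outer_cls actX_closed actY_closed actX_actX actY_actY)
  have closed: "outer t c \<in> pts ?Z" if t: "t \<in> carrier ?T" and c: "c \<in> pts ?Z" for t c
    unfolding pts_tensor
  proof (intro conjI ballI impI)
    have cO: "c \<in> ?O" using c by (simp add: pts_tensor)
    then show "outer t c \<in> ?O" using outer_O t by blast
    fix a assume a: "a \<in> carrier A" "outer (a, \<one>\<^bsub>G\<^esub>, \<one>\<^bsub>I\<^esub>) (outer t c) = outer t c"
    let ?a = "(a, \<one>\<^bsub>G\<^esub>, \<one>\<^bsub>I\<^esub>)"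
    have aT: "?a \<in> carrier ?T" using a by simp
    have comm: "?a \<otimes>\<^bsub>?T\<^esub> t = t \<otimes>\<^bsub>?T\<^esub> ?a"
      using a t by (cases t) (simp add: A.m_comm)
    have "outer t (outer ?a c) = outer t c"
      using a(2) outer_mult[OF t aT cO] outer_mult[OF aT t cO] comm by simp
    then have "outer (inv\<^bsub>?T\<^esub> t \<otimes>\<^bsub>?T\<^esub> t) (outer ?a c) = outer (inv\<^bsub>?T\<^esub> t \<otimes>\<^bsub>?T\<^esub> t) c"
      using outer_mult[OF AGI.inv_closed[OF t] t outer_O[OF aT cO]]
        outer_mult[OF AGI.inv_closed[OF t] t cO] by simp
    then have "outer ?a c = c"
      unfolding AGI.l_inv[OF t] by (simp only: outer_one cO outer_O[OF aT cO])
    then show "a = \<one>\<^bsub>A\<^esub>" using c a(1) unfolding pts_tensor by blast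
  qed
  show ?thesis
  proof (rule group_actionI)
    show "group ?T" by unfold_locales
    show "act ?Z t \<in> extensional (pts ?Z)" for t by (simp add: tensor_def Let_def)
    show "act ?Z t c \<in> pts ?Z" if "t \<in> carrier ?T" "c \<in> pts ?Z" for t c
      unfolding act_tensor[OF that(2)] using closed that by blast
    show "act ?Z \<one>\<^bsub>?T\<^esub> c = c" if "c \<in> pts ?Z" for c
      unfolding act_tensor[OF that] using outer_one that pts_tensor by blast
    show "act ?Z (s \<otimes>\<^bsub>?T\<^esub> t) c = act ?Z s (act ?Z t c)"
      if "s \<in> carrier ?T" "t \<in> carrier ?T" "c \<in> pts ?Z" for s t c
      unfolding act_tensor[OF that(3)] act_tensor[OF closed[OF that(2,3)]]
      using outer_mult that pts_tensor by blast
  qed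
qed

lemma stabilizer_tensor:
  assumes "x \<in> pts X" "y \<in> pts Y" "cls x y \<in> pts (tensor A G H I X Y)"
  shows "stabilizer (A \<times>\<times> G \<times>\<times> I) (act (tensor A G H I X Y)) (cls x y) =
    graph_comp A (stabilizer (A \<times>\<times> G \<times>\<times> H) (act X) x) (stabilizer (A \<times>\<times> H \<times>\<times> I) (act Y) y)"
    (is "?L = ?R")
proof (rule Set.set_eqI)
  fix t
  have "t \<in> carrier (A \<times>\<times> G \<times>\<times> I)" if "t \<in> ?R"
    using that X.stabilizer_subset[of x] Y.stabilizer_subset[of y] by (fastforce simp: graph_comp_def)
  then show "t \<in> ?L \<longleftrightarrow> t \<in> ?R"
    using cls_stabilizer[OF assms(1,2)] by (cases t) (auto simp: stabilizer_def act_tensor[OF assms(3)])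
qed

text \<open>
  Moving along the class of \<open>(u, v)\<close>, the components in \<open>A\<close> and \<open>H\<close> of an element taking \<open>y\<close> to \<open>v\<close> can
  be shifted to \<open>u\<close>. Since \<open>S\<close> projects onto \<open>H\<close>, the component in \<open>H\<close> of an element taking \<open>x\<close> to the new
  \<open>u\<close> can be cancelled by an element of \<open>S\<close>. So there is one orbit of classes, and \<open>A\<close> acts freely on all
  of them as soon as it does so on one.
\<close>

lemma transitive_at_tensor:
  assumes X: "transitive_at A G H X x S" and Y: "transitive_at A H I Y y T"
    and surj: "\<And>h. h \<in> carrier H \<Longrightarrow> \<exists>c g. (c, g, h) \<in> S"
    and free: "\<And>a. (a, \<one>\<^bsub>G\<^esub>, \<one>\<^bsub>I\<^esub>) \<in> graph_comp A S T \<Longrightarrow> a = \<one>\<^bsub>A\<^esub>"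
  shows "transitive_at A G I (tensor A G H I X Y) (cls x y) (graph_comp A S T)"
proof -
  let ?O = "orbits (A \<times>\<times> H) (pts X \<times> pts Y) mid"
  let ?Z = "tensor A G H I X Y"
  let ?b = "cls x y"
  have x: "x \<in> pts X" and y: "y \<in> pts Y" and S: "stabilizer (A \<times>\<times> G \<times>\<times> H) (act X) x = S"
    and T: "stabilizer (A \<times>\<times> H \<times>\<times> I) (act Y) y = T"
    using X Y by (auto simp only: transitive_at_def)
  have SC: "S \<subseteq> carrier (A \<times>\<times> G \<times>\<times> H)"
    using X.stabilizer_subset S by blast
  have base: "?b \<in> pts ?Z"
    using x y free cls_stabilizer[OF x y, unfolded S T] by (auto simp: pts_tensor mid_orbit_iff)
  have trans: "\<exists>t\<in>carrier (A \<times>\<times> G \<times>\<times> I). c = outer t ?b" if cO: "c \<in> ?O" for c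
  proof -
    obtain u v where u: "u \<in> pts X" "v \<in> pts Y" "c = cls u v" using cO mid_orbit_iff by blast
    obtain b h' i where v: "b \<in> carrier A" "h' \<in> carrier H" "i \<in> carrier I" "v = act Y (b, h', i) y"
      using Y u unfolding transitive_at_def by fastforce
    have w: "act X (b, \<one>\<^bsub>G\<^esub>, inv\<^bsub>H\<^esub> h') u \<in> pts X" using u v by (simp add: actX_closed)
    then obtain a g h where a: "a \<in> carrier A" "g \<in> carrier G" "h \<in> carrier H"
      "act X (b, \<one>\<^bsub>G\<^esub>, inv\<^bsub>H\<^esub> h') u = act X (a, g, h) x"
      using X unfolding transitive_at_def by fastforce
    obtain d g0 where d: "(d, g0, h) \<in> S" using surj a by blast
    then have dc: "d \<in> carrier A" "g0 \<in> carrier G" and dx: "act X (d, g0, h) x = x"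
      using SC S by (auto simp: stabilizer_def)
    have "mid (inv\<^bsub>A\<^esub> b, inv\<^bsub>H\<^esub> h') (u, v) =
        (act X (b, \<one>\<^bsub>G\<^esub>, inv\<^bsub>H\<^esub> h') u, act Y (\<one>\<^bsub>A\<^esub>, \<one>\<^bsub>H\<^esub>, i) y)"
      using u v y by (simp add: mid_apply actY_actY)
    also have "act X (b, \<one>\<^bsub>G\<^esub>, inv\<^bsub>H\<^esub> h') u = act X (a \<otimes>\<^bsub>A\<^esub> inv\<^bsub>A\<^esub> d, g \<otimes>\<^bsub>G\<^esub> inv\<^bsub>G\<^esub> g0, \<one>\<^bsub>H\<^esub>) (act X (d, g0, h) x)"
      using a dc x by (simp add: actX_actX A.m_assoc G.m_assoc)
    finally have *: "mid (inv\<^bsub>A\<^esub> b, inv\<^bsub>H\<^esub> h') (u, v) =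
        (act X (a \<otimes>\<^bsub>A\<^esub> inv\<^bsub>A\<^esub> d, g \<otimes>\<^bsub>G\<^esub> inv\<^bsub>G\<^esub> g0, \<one>\<^bsub>H\<^esub>) x, act Y (\<one>\<^bsub>A\<^esub>, \<one>\<^bsub>H\<^esub>, i) y)"
      by (simp only: dx)
    have "mid (inv\<^bsub>A\<^esub> b, inv\<^bsub>H\<^esub> h') (u, v) \<in> orbit (A \<times>\<times> H) mid (u, v)"
      unfolding orbit_def using v by auto
    moreover have "mid (inv\<^bsub>A\<^esub> b, inv\<^bsub>H\<^esub> h') (u, v) \<in> pts X \<times> pts Y"
      using * a dc v x y by (simp add: actX_closed actY_closed)
    ultimately have "c = orbit (A \<times>\<times> H) mid (mid (inv\<^bsub>A\<^esub> b, inv\<^bsub>H\<^esub> h') (u, v))"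
      using M.orbit_eq_iff[of "(u, v)"] u by (simp add: cls_def)
    then have "c = cls (act X (a \<otimes>\<^bsub>A\<^esub> inv\<^bsub>A\<^esub> d, g \<otimes>\<^bsub>G\<^esub> inv\<^bsub>G\<^esub> g0, \<one>\<^bsub>H\<^esub>) x) (act Y (\<one>\<^bsub>A\<^esub>, \<one>\<^bsub>H\<^esub>, i) y)"
      by (simp only: * cls_def)
    then have "c = outer (a \<otimes>\<^bsub>A\<^esub> inv\<^bsub>A\<^esub> d, g \<otimes>\<^bsub>G\<^esub> inv\<^bsub>G\<^esub> g0, i) ?b"
      using x y a dc v by (simp add: outer_cls)
    then show ?thesis using a dc v by (intro bexI[of _ "(a \<otimes>\<^bsub>A\<^esub> inv\<^bsub>A\<^esub> d, g \<otimes>\<^bsub>G\<^esub> inv\<^bsub>G\<^esub> g0, i)"]) auto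
  qed
  have "\<forall>c\<in>pts ?Z. \<exists>t\<in>carrier (A \<times>\<times> G \<times>\<times> I). c = act ?Z t ?b"
    using trans act_tensor[OF base] pts_tensor by metis
  then show ?thesis
    unfolding transitive_at_def using base tensor_group_action stabilizer_tensor[OF x y base, unfolded S T]
    by blast
qed

end

lemma tensor_transitive_at:
  assumes "comm_group A" "group G" "group H" "group I"
    and X: "transitive_at A G H X x S" and Y: "transitive_at A H I Y y T"
    and "\<And>h. h \<in> carrier H \<Longrightarrow> \<exists>c g. (c, g, h) \<in> S"
    and "\<And>a. (a, \<one>\<^bsub>G\<^esub>, \<one>\<^bsub>I\<^esub>) \<in> graph_comp A S T \<Longrightarrow> a = \<one>\<^bsub>A\<^esub>"
  obtains z where "transitive_at A G I (tensor A G H I X Y) z (graph_comp A S T)"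
proof -
  interpret tensor_factors A G H I X Y
    using assms by (intro tensor_factors.intro) (auto simp only: transitive_at_def)
  show thesis using transitive_at_tensor[OF X Y assms(7,8)] that by blast
qed

section \<open>Central characters on commutators are reduced\<close>

lemma (in group_hom) card_image_times_kernel:
  "card (h ` carrier G) * card (kernel G H h) = card (carrier G)"
proof -
  let ?N = "kernel G H h"
  have el: "the_elem (h ` (?N #> x)) = h x" if x: "x \<in> carrier G" for x
  proof -
    have "h ` (?N #> x) = {h x}"
    proof (intro subset_antisym subsetI)
      fix y assume "y \<in> h ` (?N #> x)"
      then obtain w where w: "w \<in> ?N #> x" "y = h w" by (elim imageE)
      obtain n where "n \<in> ?N" "w = n \<otimes> x" using w(1) unfolding r_coset_def by (elim UN_E singletonE)
      then show "y \<in> {h x}" using x w(2) by (simp add: kernel_def)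
    next
      fix y assume "y \<in> {h x}"
      then have "y = h x" by simp
      then show "y \<in> h ` (?N #> x)" by (rule image_eqI[OF _ G.rcos_self[OF x subgroup_kernel]])
    qed
    then show ?thesis by simp
  qed
  have "(\<lambda>X. the_elem (h ` X)) ` (rcosets ?N) = h ` carrier G"
    by (force simp: RCOSETS_def el image_iff)
  moreover have "inj_on (\<lambda>X. the_elem (h ` X)) (rcosets ?N)"
    using FactGroup_inj_on by (simp add: FactGroup_def)
  ultimately have "card (rcosets ?N) = card (h ` carrier G)"
    using card_image by metis
  then show ?thesis using G.lagrange[OF subgroup_kernel] by (simp add: order_def)
qed

text \<open>
  Let \<open>S\<^sub>G\<close> and \<open>S\<^sub>H\<close> be the kernels of the projections of \<open>S\<close> to \<open>G\<close> and \<open>H\<close>, so that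
  \<open>|G| |S\<^sub>G| = |S| \<le> |H| |S\<^sub>H|\<close>. An element of \<open>S\<^sub>H\<close> has the form \<open>(\<kappa>(x)\<^sup>-\<^sup>1, x, 1)\<close>; as \<open>x\<close> is a product of
  commutators, \<open>S\<close> contains some \<open>(1, x, w)\<close>, and the quotient \<open>(\<kappa>(x), 1, w)\<close> lies in \<open>S\<^sub>G\<close>. Since \<open>\<kappa>\<close> is
  injective, this gives \<open>|S\<^sub>H| \<le> |S\<^sub>G|\<close>.
\<close>

lemma order_le_if_factors:
  assumes "comm_group A" "group G" "group H" "finite (carrier G)" "finite (carrier H)"
    and S: "subgroup S (A \<times>\<times> G \<times>\<times> H)"
    and K: "subgroup K G" "K \<subseteq> derived G (carrier G)" and \<kappa>: "\<kappa> \<in> characters A G K" "inj_on \<kappa> K"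
    and over1: "\<And>a g. (a, g, \<one>\<^bsub>H\<^esub>) \<in> S \<Longrightarrow> g \<in> K \<and> a = inv\<^bsub>A\<^esub> \<kappa> g"
    and cover: "\<And>g. g \<in> carrier G \<Longrightarrow> \<exists>a h. (a, g, h) \<in> S"
  shows "order G \<le> order H"
proof -
  interpret A: comm_group A by fact
  interpret G: group G by fact
  interpret H: group H by fact
  interpret GH: group "G \<times>\<times> H" by (rule DirProd_group) unfold_locales
  interpret AGH: group "A \<times>\<times> G \<times>\<times> H" by (rule triple_group) unfold_locales
  interpret S: subgroup S "A \<times>\<times> G \<times>\<times> H" by fact
  let ?S = "(A \<times>\<times> G \<times>\<times> H)\<lparr>carrier := S\<rparr>"
  interpret Sg: group ?S by (rule S.subgroup_is_group[OF AGH.group_axioms])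
  have \<kappa>c: "\<kappa> k \<in> carrier A" if "k \<in> K" for k
    using \<kappa>(1) that by (auto simp: characters_def hom_def)
  have cl: "a \<in> carrier A" "g \<in> carrier G" "h \<in> carrier H" if "(a, g, h) \<in> S" for a g h
    using that S.subset by auto
  have mul: "(a \<otimes>\<^bsub>A\<^esub> b, g \<otimes>\<^bsub>G\<^esub> g', h \<otimes>\<^bsub>H\<^esub> h') \<in> S" if "(a, g, h) \<in> S" "(b, g', h') \<in> S" for a g h b g' h'
    using S.m_closed[OF that] by simp
  have inv: "(inv\<^bsub>A\<^esub> a, inv\<^bsub>G\<^esub> g, inv\<^bsub>H\<^esub> h) \<in> S" if "(a, g, h) \<in> S" for a g h
    using S.m_inv_closed[OF that] cl[OF that]
    by (simp add: GH.group_axioms A.group_axioms G.group_axioms H.group_axioms)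
  have one: "(\<one>\<^bsub>A\<^esub>, \<one>\<^bsub>G\<^esub>, \<one>\<^bsub>H\<^esub>) \<in> S" using S.one_closed by simp
  have free: "a = \<one>\<^bsub>A\<^esub>" if "(a, \<one>\<^bsub>G\<^esub>, \<one>\<^bsub>H\<^esub>) \<in> S" for a
    using over1[OF that] over1[OF one] by simp
  have finS: "finite S"
  proof (rule finite_imageD)
    have "snd ` S \<subseteq> carrier G \<times> carrier H" using S.subset by auto
    then show "finite (snd ` S)" by (rule finite_subset) (use assms in simp)
    show "inj_on snd S"
    proof (rule inj_onI)
      fix s t assume s: "s \<in> S" "t \<in> S" "snd s = snd t"
      obtain a b g h where ab: "s = (a, g, h)" "t = (b, g, h)" using s(3) by (metis prod.collapse)
      then have "(a \<otimes>\<^bsub>A\<^esub> inv\<^bsub>A\<^esub> b, \<one>\<^bsub>G\<^esub>, \<one>\<^bsub>H\<^esub>) \<in> S"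
        using mul[of a g h "inv\<^bsub>A\<^esub> b" "inv\<^bsub>G\<^esub> g" "inv\<^bsub>H\<^esub> h"] inv[of b g h] s cl[of b g h] by simp
      then have "a \<otimes>\<^bsub>A\<^esub> inv\<^bsub>A\<^esub> b = \<one>\<^bsub>A\<^esub>" by (rule free)
      then have "a = b" using ab s cl[of a g h] cl[of b g h] by (metis A.inv_closed A.inv_equality A.inv_inv)
      then show "s = t" using ab by simp
    qed
  qed
  define pG where "pG = (\<lambda>(a :: 'a, g :: 'b, h :: 'c). g)"
  define pH where "pH = (\<lambda>(a :: 'a, g :: 'b, h :: 'c). h)"
  interpret pG: group_hom ?S G pG
    by unfold_locales (auto simp: hom_def pG_def cl)
  interpret pH: group_hom ?S H pH
    by unfold_locales (auto simp: hom_def pH_def cl)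
  have cG: "order G * card (kernel ?S G pG) = card S"
  proof -
    have "pG ` S = carrier G"
    proof (intro subset_antisym subsetI)
      fix g assume "g \<in> carrier G"
      then obtain a h where "(a, g, h) \<in> S" using cover by blast
      then show "g \<in> pG ` S" by (intro image_eqI[of _ _ "(a, g, h)"]) (simp_all add: pG_def)
    qed (auto simp: pG_def cl)
    then show ?thesis using pG.card_image_times_kernel by (simp add: order_def)
  qed
  have cH: "card S \<le> order H * card (kernel ?S H pH)"
  proof -
    have "pH ` S \<subseteq> carrier H" using cl by (auto simp: pH_def)
    then have "card (pH ` S) \<le> order H" using assms(5) by (simp add: card_mono order_def)
    moreover have "card (pH ` S) * card (kernel ?S H pH) = card S"
      using pH.card_image_times_kernel by simp
    ultimately show ?thesis
      using mult_le_mono1[of "card (pH ` S)" "order H" "card (kernel ?S H pH)"] by linarith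
  qed
  have "card (kernel ?S H pH) \<le> card (fst ` kernel ?S G pG)"
  proof (rule card_inj_on_le[where f = "\<lambda>j. inv\<^bsub>A\<^esub> fst j"])
    have kH: "\<exists>x\<in>K. j = (inv\<^bsub>A\<^esub> \<kappa> x, x, \<one>\<^bsub>H\<^esub>)" if "j \<in> kernel ?S H pH" for j
      using that over1 by (cases j) (auto simp: kernel_def pH_def)
    show "inj_on (\<lambda>j. inv\<^bsub>A\<^esub> fst j) (kernel ?S H pH)"
    proof (rule inj_onI)
      fix i j assume "i \<in> kernel ?S H pH" "j \<in> kernel ?S H pH" and e: "inv\<^bsub>A\<^esub> fst i = inv\<^bsub>A\<^esub> fst j"
      then obtain x y where x: "x \<in> K" "i = (inv\<^bsub>A\<^esub> \<kappa> x, x, \<one>\<^bsub>H\<^esub>)" "y \<in> K" "j = (inv\<^bsub>A\<^esub> \<kappa> y, y, \<one>\<^bsub>H\<^esub>)"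
        using kH by meson
      then have "\<kappa> x = \<kappa> y" using e \<kappa>c by simp
      then show "i = j" using \<kappa>(2) x by (simp add: inj_on_def)
    qed
    show "(\<lambda>j. inv\<^bsub>A\<^esub> fst j) ` kernel ?S H pH \<subseteq> fst ` kernel ?S G pG"
    proof
      fix b assume "b \<in> (\<lambda>j. inv\<^bsub>A\<^esub> fst j) ` kernel ?S H pH"
      then obtain j where j: "j \<in> kernel ?S H pH" "b = inv\<^bsub>A\<^esub> fst j" by blast
      then obtain x where x: "x \<in> K" "j = (inv\<^bsub>A\<^esub> \<kappa> x, x, \<one>\<^bsub>H\<^esub>)" using kH by blast
      have xS: "(inv\<^bsub>A\<^esub> \<kappa> x, x, \<one>\<^bsub>H\<^esub>) \<in> S" using j x by (simp add: kernel_def)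
      interpret fst: group_hom "G \<times>\<times> H" G fst by unfold_locales (auto simp: hom_def mult_DirProd')
      have sub: "snd ` S \<subseteq> carrier (G \<times>\<times> H)" using S.subset by auto
      have "fst ` snd ` S = carrier G"
      proof (intro subset_antisym subsetI)
        fix g assume "g \<in> carrier G"
        then obtain a h where "(a, g, h) \<in> S" using cover by blast
        then show "g \<in> fst ` snd ` S" unfolding image_image using image_eqI[of g "\<lambda>x. fst (snd x)" "(a, g, h)" S] by simp
      qed (auto simp: cl)
      then have "x \<in> fst ` derived (G \<times>\<times> H) (snd ` S)"
        using fst.derived_img[OF sub] x K(2) by auto
      then obtain w where "(x, w) \<in> derived (G \<times>\<times> H) (snd ` S)" by auto
      then have "(\<one>\<^bsub>A\<^esub>, x, w) \<in> derived (A \<times>\<times> G \<times>\<times> H) S"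
        by (rule derived_lift[OF assms(1) GH.group_axioms S])
      then have w: "(\<one>\<^bsub>A\<^esub>, x, w) \<in> S" using AGH.derived_incl[OF subset_refl S] by blast
      have "(\<kappa> x, \<one>\<^bsub>G\<^esub>, w) \<in> S"
        using mul[OF inv[OF xS] w] \<kappa>c[OF x(1)] cl[OF w] by simp
      then show "b \<in> fst ` kernel ?S G pG"
        using j x \<kappa>c by (intro image_eqI[of _ _ "(\<kappa> x, \<one>\<^bsub>G\<^esub>, w)"]) (auto simp: kernel_def pG_def)
    qed
    show "finite (fst ` kernel ?S G pG)" using finS by (simp add: kernel_def)
  qed
  also have "\<dots> \<le> card (kernel ?S G pG)" using finS by (intro card_image_le) (simp add: kernel_def)
  finally have le: "card (kernel ?S H pH) \<le> card (kernel ?S G pG)" .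
  have "order G * card (kernel ?S G pG) \<le> order H * card (kernel ?S G pG)"
    using cG cH mult_le_mono2[OF le, of "order H"] by linarith
  moreover have "card (kernel ?S G pG) > 0"
    using finS one by (auto simp: card_gt_0_iff kernel_def pG_def)
  ultimately show ?thesis by simp
qed

lemma iso_class_self:
  assumes "comm_group A" "group G" "group H" "(U, \<phi>) \<in> char_pairs A (G \<times>\<times> H)"
  shows "(U, \<phi>) \<in> iso_class A G H (trans_biset A G H U \<phi>)"
proof -
  note t = transitive_at_trans_biset[OF assms]
  show ?thesis using fbiset_iso_if_same_stabilizer[OF t t] assms(4) by (simp add: iso_class_def)
qed

context
  fixes A :: "'a monoid" and G :: "'g monoid" and K :: "'g set" and \<kappa> :: "'g \<Rightarrow> 'a"
  assumes A: "comm_group A" and G: "group G" "finite (carrier G)"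
    and K: "subgroup K G" "K \<subseteq> centre G" and \<kappa>: "\<kappa> \<in> characters A G K"
begin

interpretation A: comm_group A by (rule A)
interpretation G: group G by (rule G)
interpretation K: subgroup K G by (rule K)

lemma central_comm: "k \<in> K \<Longrightarrow> g \<in> carrier G \<Longrightarrow> k \<otimes>\<^bsub>G\<^esub> g = g \<otimes>\<^bsub>G\<^esub> k"
  using K by (auto simp: centre_def)

lemma central_conj: "k \<in> K \<Longrightarrow> g \<in> carrier G \<Longrightarrow> g \<otimes>\<^bsub>G\<^esub> k \<otimes>\<^bsub>G\<^esub> inv\<^bsub>G\<^esub> g = k"
  by (metis central_comm G.inv_solve_right G.m_closed K.mem_carrier)

lemma central_character_stable: "(K, \<kappa>) \<in> stable_char_pairs A G"
  using K(1) \<kappa> by (auto simp: stable_char_pairs_def char_pairs_def G.normal_inv_iff central_conj)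

lemma diag_mod_iff: "(g, h) \<in> diag_mod G K \<longleftrightarrow> g \<in> carrier G \<and> h \<in> carrier G \<and> g \<otimes>\<^bsub>G\<^esub> inv\<^bsub>G\<^esub> h \<in> K"
proof -
  have "g <#\<^bsub>G\<^esub> K = h <#\<^bsub>G\<^esub> K \<longleftrightarrow> g \<otimes>\<^bsub>G\<^esub> inv\<^bsub>G\<^esub> h \<in> K" if gh: "g \<in> carrier G" "h \<in> carrier G"
  proof
    assume "g <#\<^bsub>G\<^esub> K = h <#\<^bsub>G\<^esub> K"
    then obtain k where "k \<in> K" "g = h \<otimes>\<^bsub>G\<^esub> k"
      using G.lcos_self[OF gh(1) K(1)] by (auto simp: l_coset_def)
    then show "g \<otimes>\<^bsub>G\<^esub> inv\<^bsub>G\<^esub> h \<in> K" using gh by (simp add: central_conj)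
  next
    assume k: "g \<otimes>\<^bsub>G\<^esub> inv\<^bsub>G\<^esub> h \<in> K"
    have "g = h \<otimes>\<^bsub>G\<^esub> (g \<otimes>\<^bsub>G\<^esub> inv\<^bsub>G\<^esub> h)"
      using central_comm[OF k gh(2)] gh by (simp add: G.m_assoc)
    then have "g \<in> h <#\<^bsub>G\<^esub> K" using k by (auto simp: l_coset_def)
    then show "g <#\<^bsub>G\<^esub> K = h <#\<^bsub>G\<^esub> K" using G.l_repr_independence[OF _ gh(2) K(1)] by blast
  qed
  then show ?thesis by (auto simp: diag_mod_def)
qed

lemma diag_char_pair: "(diag_mod G K, diag_char G K \<kappa>) \<in> char_pairs A (G \<times>\<times> G)"
proof -
  interpret GG: group "G \<times>\<times> G" by (rule DirProd_group) unfold_locales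
  have hom: "\<kappa> (k \<otimes>\<^bsub>G\<^esub> l) = \<kappa> k \<otimes>\<^bsub>A\<^esub> \<kappa> l" "\<kappa> k \<in> carrier A" if "k \<in> K" "l \<in> K" for k l
    using \<kappa> that by (auto simp: characters_def hom_def)
  have mult: "(g \<otimes>\<^bsub>G\<^esub> g') \<otimes>\<^bsub>G\<^esub> inv\<^bsub>G\<^esub> (h \<otimes>\<^bsub>G\<^esub> h') = (g \<otimes>\<^bsub>G\<^esub> inv\<^bsub>G\<^esub> h) \<otimes>\<^bsub>G\<^esub> (g' \<otimes>\<^bsub>G\<^esub> inv\<^bsub>G\<^esub> h')"
    if "g \<in> carrier G" "h \<in> carrier G" "g' \<in> carrier G" "h' \<in> carrier G" "g' \<otimes>\<^bsub>G\<^esub> inv\<^bsub>G\<^esub> h' \<in> K" for g h g' h'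
  proof -
    have "(g \<otimes>\<^bsub>G\<^esub> g') \<otimes>\<^bsub>G\<^esub> inv\<^bsub>G\<^esub> (h \<otimes>\<^bsub>G\<^esub> h') = g \<otimes>\<^bsub>G\<^esub> ((g' \<otimes>\<^bsub>G\<^esub> inv\<^bsub>G\<^esub> h') \<otimes>\<^bsub>G\<^esub> inv\<^bsub>G\<^esub> h)"
      using that by (simp add: G.inv_mult_group G.m_assoc)
    also have "\<dots> = (g \<otimes>\<^bsub>G\<^esub> inv\<^bsub>G\<^esub> h) \<otimes>\<^bsub>G\<^esub> (g' \<otimes>\<^bsub>G\<^esub> inv\<^bsub>G\<^esub> h')"
      using that central_comm[of "g' \<otimes>\<^bsub>G\<^esub> inv\<^bsub>G\<^esub> h'" "inv\<^bsub>G\<^esub> h"] by (simp add: G.m_assoc)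
    finally show ?thesis .
  qed
  have "subgroup (diag_mod G K) (G \<times>\<times> G)"
  proof (rule GG.subgroupI)
    show "diag_mod G K \<subseteq> carrier (G \<times>\<times> G)" by (auto simp: diag_mod_def)
    have "(\<one>\<^bsub>G\<^esub>, \<one>\<^bsub>G\<^esub>) \<in> diag_mod G K" by (simp add: diag_mod_def)
    then show "diag_mod G K \<noteq> {}" by blast
  next
    fix x assume "x \<in> diag_mod G K"
    then obtain g h where x: "x = (g, h)" "g \<in> carrier G" "h \<in> carrier G" "g \<otimes>\<^bsub>G\<^esub> inv\<^bsub>G\<^esub> h \<in> K"
      by (cases x) (auto simp: diag_mod_iff)
    have "inv\<^bsub>G\<^esub> g \<otimes>\<^bsub>G\<^esub> h = inv\<^bsub>G\<^esub> g \<otimes>\<^bsub>G\<^esub> inv\<^bsub>G\<^esub> (g \<otimes>\<^bsub>G\<^esub> inv\<^bsub>G\<^esub> h) \<otimes>\<^bsub>G\<^esub> inv\<^bsub>G\<^esub> (inv\<^bsub>G\<^esub> g)"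
      using x by (simp add: G.inv_mult_group G.m_assoc)
    then have "inv\<^bsub>G\<^esub> g \<otimes>\<^bsub>G\<^esub> h \<in> K" using central_conj[of "inv\<^bsub>G\<^esub> (g \<otimes>\<^bsub>G\<^esub> inv\<^bsub>G\<^esub> h)" "inv\<^bsub>G\<^esub> g"] x by simp
    then show "inv\<^bsub>G \<times>\<times> G\<^esub> x \<in> diag_mod G K" using x by (simp add: diag_mod_iff G.group_axioms)
  next
    fix x y assume "x \<in> diag_mod G K" "y \<in> diag_mod G K"
    then show "x \<otimes>\<^bsub>G \<times>\<times> G\<^esub> y \<in> diag_mod G K" by (cases x; cases y) (simp add: diag_mod_iff mult)
  qed
  moreover have "diag_char G K \<kappa> \<in> characters A (G \<times>\<times> G) (diag_mod G K)"
  proof -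
    have "diag_char G K \<kappa> x \<in> carrier A" if "x \<in> diag_mod G K" for x
      using that by (cases x) (auto simp: diag_char_def diag_mod_iff hom)
    moreover have "diag_char G K \<kappa> (x \<otimes>\<^bsub>G \<times>\<times> G\<^esub> y) = diag_char G K \<kappa> x \<otimes>\<^bsub>A\<^esub> diag_char G K \<kappa> y"
      if "x \<in> diag_mod G K" "y \<in> diag_mod G K" for x y
      using that by (cases x; cases y) (simp add: diag_char_def diag_mod_iff mult hom)
    ultimately show ?thesis by (auto simp: characters_def hom_def diag_char_def)
  qed
  ultimately show ?thesis by (simp add: char_pairs_def)
qed

text \<open>
  An isomorphism provides a point \<open>[x, y]\<close> of the orbit whose stabilizer is the graph of
  \<open>(\<Delta>\<^sub>K(G), \<phi>\<^sub>\<kappa>)\<close>, and this graph is the composition of the stabilizers of \<open>x\<close> and \<open>y\<close>. The first of these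
  satisfies the hypotheses of \<open>order_le_if_factors\<close>: it projects onto \<open>G\<close> because \<open>\<Delta>\<^sub>K(G)\<close> contains the
  diagonal, and its elements over \<open>1 \<in> H\<close> belong to the composition because \<open>1\<close> fixes \<open>y\<close>.
\<close>

lemma not_isomorphic_to_orbit_through_smaller_group:
  assumes der: "K \<subseteq> derived G (carrier G)" and inj: "inj_on \<kappa> K"
    and H: "group H" "finite (carrier H)" "order H < order G"
    and X: "group_action (A \<times>\<times> G \<times>\<times> H) (pts X) (act X)" and Y: "group_action (A \<times>\<times> H \<times>\<times> G) (pts Y) (act Y)"
    and orb: "orb \<in> orbits (A \<times>\<times> G \<times>\<times> G) (pts (tensor A G H G X Y)) (act (tensor A G H G X Y))"
    and iso: "fbiset_iso A G G \<lparr>pts = orb, act = (\<lambda>t. restrict (act (tensor A G H G X Y) t) orb)\<rparr>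
      (trans_biset A G G (diag_mod G K) (diag_char G K \<kappa>))"
  shows False
proof -
  let ?Z = "tensor A G H G X Y"
  let ?T = "A \<times>\<times> G \<times>\<times> G"
  let ?D = "trans_biset A G G (diag_mod G K) (diag_char G K \<kappa>)"
  let ?S = "twisted_graph A (diag_mod G K) (diag_char G K \<kappa>)"
  interpret tensor_factors A G H G X Y
    by (intro tensor_factors.intro A G H X Y)
  interpret Z: group_action ?T "pts ?Z" "act ?Z" by (rule tensor_group_action)
  have D: "transitive_at A G G ?D ?S ?S" by (rule transitive_at_trans_biset[OF A G(1) G(1) diag_char_pair])
  obtain f where f: "bij_betw f orb (pts ?D)"
    and eqv: "\<And>t z. t \<in> carrier ?T \<Longrightarrow> z \<in> orb \<Longrightarrow> f (act ?Z t z) = act ?D t (f z)"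
    using iso by (auto simp: fbiset_iso_def)
  obtain c where c: "c \<in> pts ?Z" "orb = orbit ?T (act ?Z) c" using orb by (auto simp: orbits_def)
  have closed: "act ?Z t z \<in> orb" if t: "t \<in> carrier ?T" and z: "z \<in> orb" for t z
  proof -
    obtain s where s: "s \<in> carrier ?T" "z = act ?Z s c" using z c(2) unfolding orbit_def by blast
    then have "act ?Z t z = act ?Z (t \<otimes>\<^bsub>?T\<^esub> s) c" using Z.composition_rule[OF c(1) t s(1)] by simp
    then show ?thesis unfolding c(2) orbit_def using AGI.m_closed[OF t s(1)] by blast
  qed
  have base: "?S \<in> pts ?D" using D by (auto simp only: transitive_at_def)
  then obtain z where z: "z \<in> orb" "f z = ?S" using f by (metis bij_betw_imp_surj_on imageE)
  have orbZ: "orb \<subseteq> pts ?Z" unfolding c(2) orbit_def using Z.act_closed c(1) by blast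
  have "stabilizer ?T (act ?Z) z = stabilizer ?T (act ?D) ?S"
  proof -
    have "act ?Z t z = z \<longleftrightarrow> act ?D t ?S = ?S" if t: "t \<in> carrier ?T" for t
      using eqv[OF t z(1)] closed[OF t z(1)] z f by (metis bij_betw_imp_inj_on inj_onD)
    then show ?thesis unfolding stabilizer_def by blast
  qed
  also have "\<dots> = ?S" using D by (auto simp only: transitive_at_def)
  finally have stab: "stabilizer ?T (act ?Z) z = ?S" .
  obtain x y where xy: "x \<in> pts X" "y \<in> pts Y" "z = cls x y"
    using z(1) orbZ pts_tensor mid_orbit_iff by blast
  define Sx where "Sx = stabilizer (A \<times>\<times> G \<times>\<times> H) (act X) x"
  define Sy where "Sy = stabilizer (A \<times>\<times> H \<times>\<times> G) (act Y) y"
  have comp: "graph_comp A Sx Sy = ?S"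
    using stabilizer_tensor[of x y] xy z(1) orbZ stab unfolding Sx_def Sy_def by blast
  have Sx: "subgroup Sx (A \<times>\<times> G \<times>\<times> H)" unfolding Sx_def by (rule X.stabilizer_subgroup[OF xy(1)])
  have Sy: "\<one>\<^bsub>A \<times>\<times> H \<times>\<times> G\<^esub> \<in> Sy" unfolding Sy_def by (rule Y.stabilizer_one_closed[OF xy(2)])
  have "order G \<le> order H"
  proof (rule order_le_if_factors[OF A G(1) H(1) G(2) H(2) Sx K(1) der \<kappa> inj])
    fix a g assume ag: "(a, g, \<one>\<^bsub>H\<^esub>) \<in> Sx"
    then have ac: "a \<in> carrier A" "g \<in> carrier G" using subgroup.subset[OF Sx] by auto
    have "(a \<otimes>\<^bsub>A\<^esub> \<one>\<^bsub>A\<^esub>, g, \<one>\<^bsub>G\<^esub>) \<in> graph_comp A Sx Sy"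
      unfolding graph_comp_def using ag Sy by (simp only: one_DirProd) blast
    then show "g \<in> K \<and> a = inv\<^bsub>A\<^esub> \<kappa> g"
      using ac by (simp add: comp mem_twisted_graph diag_mod_iff diag_char_def)
  next
    fix g assume g: "g \<in> carrier G"
    then have "(inv\<^bsub>A\<^esub> diag_char G K \<kappa> (g, g), g, g) \<in> graph_comp A Sx Sy"
      by (simp add: comp mem_twisted_graph diag_mod_iff)
    then show "\<exists>a h. (a, g, h) \<in> Sx" by (auto simp: graph_comp_def)
  qed
  then show False using H(3) by simp
qed

lemma keys_map_scale: "Poly_Mapping.keys (fib_scale c x) \<subseteq> Poly_Mapping.keys x"
  by (auto simp: in_keys_iff Poly_Mapping.map.rep_eq)

lemma class_rep_group_action:
  assumes "group G'" "group H'" "b \<in> {iso_class A G' H' (trans_biset A G' H' U \<phi>) |U \<phi>. (U, \<phi>) \<in> char_pairs A (G' \<times>\<times> H')}"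
  shows "group_action (A \<times>\<times> G' \<times>\<times> H') (pts (class_rep A G' H' b)) (act (class_rep A G' H' b))"
proof -
  obtain U \<phi> where U: "(U, \<phi>) \<in> char_pairs A (G' \<times>\<times> H')" "b = iso_class A G' H' (trans_biset A G' H' U \<phi>)"
    using assms(3) by blast
  have "(U, \<phi>) \<in> b"
    using iso_class_self[OF A assms(1,2) U(1)] U(2) by simp
  then have "(SOME u. u \<in> b) \<in> b" by (rule someI)
  moreover obtain U' \<phi>' where u: "(SOME u. u \<in> b) = (U', \<phi>')" by (metis prod.collapse)
  ultimately have "(U', \<phi>') \<in> char_pairs A (G' \<times>\<times> H')" unfolding U(2) iso_class_def by auto
  then have "transitive_at A G' H' (trans_biset A G' H' U' \<phi>') (twisted_graph A U' \<phi>') (twisted_graph A U' \<phi>')"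
    by (rule transitive_at_trans_biset[OF A assms(1,2)])
  then show ?thesis by (simp only: class_rep_def u prod.case transitive_at_def)
qed

text \<open>
  The elements whose support avoids the class of \<open>e\<^sub>(\<^sub>K\<^sub>,\<^sub>\<kappa>\<^sub>)\<close> form a submodule. It contains all
  generators of the ideal, because the support of a product consists of classes of orbits of tensor
  products.
\<close>

theorem central_commutator_character_reduced:
  fixes k :: "'k::comm_ring_1 itself"
  assumes der: "K \<subseteq> derived G (carrier G)" and inj: "inj_on \<kappa> K"
  shows "(K, \<kappa>) \<in> R_pairs k A G"
proof -
  define e where "e = iso_class A G G (trans_biset A G G (diag_mod G K) (diag_char G K \<kappa>))"
  have e_mem: "(diag_mod G K, diag_char G K \<kappa>) \<in> e"
    unfolding e_def by (rule iso_class_self[OF A G(1) G(1) diag_char_pair])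
  define V where "V = {x :: ('a, 'g, 'g) biset_class \<Rightarrow>\<^sub>0 'k. e \<notin> Poly_Mapping.keys x}"
  have V: "Modules.module.subspace fib_scale V"
  proof (rule Modules.module.subspaceI[OF module_fib_scale])
    show "0 \<in> V" by (simp add: V_def)
    show "x + y \<in> V" if "x \<in> V" "y \<in> V" for x y
      using that Poly_Mapping.keys_add[of x y] unfolding V_def by blast
    show "fib_scale c x \<in> V" if "x \<in> V" for c x
      using that keys_map_scale[of c x] unfolding V_def by blast
  qed
  have "fib_comp A G H G x y \<in> V"
    if H: "group H" "finite (carrier H)" "order H < order G"
      and x: "x \<in> fib_module A G H" and y: "y \<in> fib_module A H G" for H :: "nat monoid" and x y
  proof (rule ccontr)
    assume "fib_comp A G H G x y \<notin> V"
    then have "e \<in> Poly_Mapping.keys (fib_comp A G H G x y)" by (simp add: V_def)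
    then obtain b where b: "b \<in> Poly_Mapping.keys x" "e \<in> Poly_Mapping.keys (\<Sum>c\<in>Poly_Mapping.keys y.
        fib_scale (Poly_Mapping.lookup x b * Poly_Mapping.lookup y c)
          (fib_element A G G (tensor A G H G (class_rep A G H b) (class_rep A H G c)) :: _ \<Rightarrow>\<^sub>0 'k))"
      unfolding fib_comp_def using keys_sum by fast
    then obtain c where c: "c \<in> Poly_Mapping.keys y" "e \<in> Poly_Mapping.keys
        (fib_scale (Poly_Mapping.lookup x b * Poly_Mapping.lookup y c)
          (fib_element A G G (tensor A G H G (class_rep A G H b) (class_rep A H G c)) :: _ \<Rightarrow>\<^sub>0 'k))"
      using keys_sum by fast
    let ?X = "class_rep A G H b" and ?Y = "class_rep A H G c"
    let ?Z = "tensor A G H G ?X ?Y"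
    have "e \<in> Poly_Mapping.keys (fib_element A G G ?Z :: _ \<Rightarrow>\<^sub>0 'k)"
      by (rule subsetD[OF keys_map_scale c(2)])
    then have "e \<in> (\<Union>orb\<in>orbits (A \<times>\<times> G \<times>\<times> G) (pts ?Z) (act ?Z). Poly_Mapping.keys (Poly_Mapping.single
        (iso_class A G G \<lparr>pts = orb, act = (\<lambda>t. restrict (act ?Z t) orb)\<rparr>) (1 :: 'k)))"
      unfolding fib_element_def by (rule rev_subsetD[OF _ keys_sum])
    then obtain orb where orb: "orb \<in> orbits (A \<times>\<times> G \<times>\<times> G) (pts ?Z) (act ?Z)"
      "e = iso_class A G G \<lparr>pts = orb, act = (\<lambda>t. restrict (act ?Z t) orb)\<rparr>"
      by (elim UN_E) (simp only: keys_single one_neq_zero if_False singleton_iff)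
    have "fbiset_iso A G G \<lparr>pts = orb, act = (\<lambda>t. restrict (act ?Z t) orb)\<rparr>
      (trans_biset A G G (diag_mod G K) (diag_char G K \<kappa>))"
      using e_mem unfolding orb(2) iso_class_def by blast
    then show False
      using not_isomorphic_to_orbit_through_smaller_group[OF der inj H _ _ orb(1)]
        class_rep_group_action[OF G(1) H(1)] class_rep_group_action[OF H(1) G(1)] x y b(1) c(1)
      unfolding fib_module_def by blast
  qed
  then have "lower_ideal A G \<subseteq> V"
    unfolding lower_ideal_def by (intro Modules.module.span_minimal[OF module_fib_scale _ V]) blast
  moreover have "(e_elem A G K \<kappa> :: _ \<Rightarrow>\<^sub>0 'k) \<notin> V" by (simp add: V_def e_elem_def e_def)
  ultimately show ?thesis using central_character_stable by (auto simp: R_pairs_def)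
qed

end

section \<open>Transporting a biset between two splittings\<close>

lemma (in comm_group) mult_cancel_middle:
  assumes "a \<in> carrier G" "x \<in> carrier G" "y \<in> carrier G"
  shows "(a \<otimes> x) \<otimes> (inv a \<otimes> y) = x \<otimes> y"
proof -
  have "(a \<otimes> x) \<otimes> (inv a \<otimes> y) = x \<otimes> (a \<otimes> (inv a \<otimes> y))"
    using assms by (simp add: m_comm[of a x] m_assoc)
  also have "a \<otimes> (inv a \<otimes> y) = y" using assms by (simp add: m_assoc[symmetric])
  finally show ?thesis .
qed

text \<open>
  The subgroup \<open>S\<close> is the stabilizer for the biset to be decomposed. It enters through its
  elements over \<open>1 \<in> H\<close> and over \<open>1 \<in> G\<close>, which record \<open>\<kappa>\<close> and \<open>\<lambda>\<close>, and its surjectivity on both sides.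
\<close>

locale biset_splitting =
  GS: torsion_splitting A G K \<kappa> PG QG rG + HS: torsion_splitting A H L lam PH QH rH
  for A :: "'a monoid" and G :: "'g monoid" and K \<kappa> PG and QG :: "'p monoid" and rG
    and H :: "'h monoid" and L lam PH and QH :: "'q monoid" and rH +
  fixes S :: "('a \<times> 'g \<times> 'h) set"
  assumes S: "subgroup S (A \<times>\<times> G \<times>\<times> H)"
    and S1: "(a, g, \<one>\<^bsub>H\<^esub>) \<in> S \<longleftrightarrow> g \<in> K \<and> a = inv\<^bsub>A\<^esub> \<kappa> g"
    and S2: "(a, \<one>\<^bsub>G\<^esub>, h) \<in> S \<longleftrightarrow> h \<in> L \<and> a = lam h"
    and coverG: "g \<in> carrier G \<Longrightarrow> \<exists>a h. (a, g, h) \<in> S"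
    and coverH: "h \<in> carrier H \<Longrightarrow> \<exists>a g. (a, g, h) \<in> S"
begin

sublocale GH: group "G \<times>\<times> H" by (rule DirProd_group) unfold_locales
sublocale AGH: group "A \<times>\<times> G \<times>\<times> H" by (rule triple_group) unfold_locales
sublocale QQ: group "QG \<times>\<times> QH" by (rule DirProd_group) unfold_locales
sublocale AQQ: group "A \<times>\<times> QG \<times>\<times> QH" by (rule triple_group) unfold_locales
sublocale S: subgroup S "A \<times>\<times> G \<times>\<times> H" by (rule S)

text \<open>
  The composition of the opposite of the left insertion graph, \<open>S\<close>, and the right insertion graph.
\<close>

definition mid_graph where
  "mid_graph = {(inv\<^bsub>A\<^esub> a \<otimes>\<^bsub>A\<^esub> c \<otimes>\<^bsub>A\<^esub> b, rG (a, g), rH (b, h)) | a b c g h.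
     (a, g) \<in> PG \<and> (c, g, h) \<in> S \<and> (b, h) \<in> PH}"

lemma S_closed: "(a, g, h) \<in> S \<Longrightarrow> a \<in> carrier A" "(a, g, h) \<in> S \<Longrightarrow> g \<in> carrier G" "(a, g, h) \<in> S \<Longrightarrow> h \<in> carrier H"
  using S.subset by auto

lemma S_mult: "(a, g, h) \<in> S \<Longrightarrow> (b, g', h') \<in> S \<Longrightarrow> (a \<otimes>\<^bsub>A\<^esub> b, g \<otimes>\<^bsub>G\<^esub> g', h \<otimes>\<^bsub>H\<^esub> h') \<in> S"
  using S.m_closed[of "(a, g, h)" "(b, g', h')"] by simp

lemma S_inv: "(a, g, h) \<in> S \<Longrightarrow> (inv\<^bsub>A\<^esub> a, inv\<^bsub>G\<^esub> g, inv\<^bsub>H\<^esub> h) \<in> S"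
  using S.m_inv_closed[of "(a, g, h)"] S_closed[of a g h]
  by (simp add: GH.group_axioms GS.A.group_axioms GS.G.group_axioms HS.G.group_axioms)

lemma S_one: "(\<one>\<^bsub>A\<^esub>, \<one>\<^bsub>G\<^esub>, \<one>\<^bsub>H\<^esub>) \<in> S"
  using S.one_closed by simp

lemma mid_graphI:
  "(a, g) \<in> PG \<Longrightarrow> (c, g, h) \<in> S \<Longrightarrow> (b, h) \<in> PH \<Longrightarrow> x = inv\<^bsub>A\<^esub> a \<otimes>\<^bsub>A\<^esub> c \<otimes>\<^bsub>A\<^esub> b \<Longrightarrow>
    p = rG (a, g) \<Longrightarrow> q = rH (b, h) \<Longrightarrow> (x, p, q) \<in> mid_graph"
  unfolding mid_graph_def by blast

lemma mid_graphE:
  assumes "x \<in> mid_graph"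
  obtains a b c g h where "(a, g) \<in> PG" "(c, g, h) \<in> S" "(b, h) \<in> PH"
    "a \<in> carrier A" "b \<in> carrier A" "c \<in> carrier A" "g \<in> carrier G" "h \<in> carrier H"
    "x = (inv\<^bsub>A\<^esub> a \<otimes>\<^bsub>A\<^esub> c \<otimes>\<^bsub>A\<^esub> b, rG (a, g), rH (b, h))"
proof -
  obtain a b c g h where *: "(a, g) \<in> PG" "(c, g, h) \<in> S" "(b, h) \<in> PH"
    "x = (inv\<^bsub>A\<^esub> a \<otimes>\<^bsub>A\<^esub> c \<otimes>\<^bsub>A\<^esub> b, rG (a, g), rH (b, h))"
    using assms unfolding mid_graph_def by blast
  show thesis
    by (rule that[OF *(1-3) GS.P_closed(1)[OF *(1)] HS.P_closed(1)[OF *(3)] S_closed[OF *(2)] *(4)])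
qed

lemma subgroup_mid_graph: "subgroup mid_graph (A \<times>\<times> QG \<times>\<times> QH)"
proof (rule AQQ.subgroupI)
  show "mid_graph \<subseteq> carrier (A \<times>\<times> QG \<times>\<times> QH)"
    by (auto elim!: mid_graphE)
  have "(\<one>\<^bsub>A\<^esub>, \<one>\<^bsub>QG\<^esub>, \<one>\<^bsub>QH\<^esub>) \<in> mid_graph"
    using GS.P.one_closed HS.P.one_closed by (intro mid_graphI[OF _ S_one]) auto
  then show "mid_graph \<noteq> {}" by blast
next
  fix x assume "x \<in> mid_graph"
  then obtain a b c g h where x: "(a, g) \<in> PG" "(c, g, h) \<in> S" "(b, h) \<in> PH"
    "a \<in> carrier A" "b \<in> carrier A" "c \<in> carrier A" "g \<in> carrier G" "h \<in> carrier H"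
    "x = (inv\<^bsub>A\<^esub> a \<otimes>\<^bsub>A\<^esub> c \<otimes>\<^bsub>A\<^esub> b, rG (a, g), rH (b, h))" by (rule mid_graphE)
  have "(inv\<^bsub>A\<^esub> (inv\<^bsub>A\<^esub> a \<otimes>\<^bsub>A\<^esub> c \<otimes>\<^bsub>A\<^esub> b), inv\<^bsub>QG\<^esub> rG (a, g), inv\<^bsub>QH\<^esub> rH (b, h)) \<in> mid_graph"
    by (rule mid_graphI[OF GS.P_inv[OF x(1)] S_inv[OF x(2)] HS.P_inv[OF x(3)]])
      (use x in \<open>simp_all add: GS.A.inv_mult GS.r_inv HS.r_inv\<close>)
  then show "inv\<^bsub>A \<times>\<times> QG \<times>\<times> QH\<^esub> x \<in> mid_graph"
    using x by (simp add: QQ.group_axioms GS.A.group_axioms GS.Q.group_axioms HS.Q.group_axioms)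
next
  fix x y assume "x \<in> mid_graph" "y \<in> mid_graph"
  then obtain a b c g h a' b' c' g' h' where x: "(a, g) \<in> PG" "(c, g, h) \<in> S" "(b, h) \<in> PH"
    "a \<in> carrier A" "b \<in> carrier A" "c \<in> carrier A" "g \<in> carrier G" "h \<in> carrier H"
    "x = (inv\<^bsub>A\<^esub> a \<otimes>\<^bsub>A\<^esub> c \<otimes>\<^bsub>A\<^esub> b, rG (a, g), rH (b, h))"
    and y: "(a', g') \<in> PG" "(c', g', h') \<in> S" "(b', h') \<in> PH"
    "a' \<in> carrier A" "b' \<in> carrier A" "c' \<in> carrier A" "g' \<in> carrier G" "h' \<in> carrier H"
    "y = (inv\<^bsub>A\<^esub> a' \<otimes>\<^bsub>A\<^esub> c' \<otimes>\<^bsub>A\<^esub> b', rG (a', g'), rH (b', h'))" by (elim mid_graphE) blast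
  have "(inv\<^bsub>A\<^esub> a \<otimes>\<^bsub>A\<^esub> c \<otimes>\<^bsub>A\<^esub> b \<otimes>\<^bsub>A\<^esub> (inv\<^bsub>A\<^esub> a' \<otimes>\<^bsub>A\<^esub> c' \<otimes>\<^bsub>A\<^esub> b'),
      rG (a, g) \<otimes>\<^bsub>QG\<^esub> rG (a', g'), rH (b, h) \<otimes>\<^bsub>QH\<^esub> rH (b', h')) \<in> mid_graph"
    by (rule mid_graphI[OF GS.P_mult[OF x(1) y(1)] S_mult[OF x(2) y(2)] HS.P_mult[OF x(3) y(3)]])
      (use x y in \<open>simp_all add: GS.A.inv_mult GS.r_mult HS.r_mult GS.A.m_ac\<close>)
  then show "x \<otimes>\<^bsub>A \<times>\<times> QG \<times>\<times> QH\<^esub> y \<in> mid_graph" using x y by simp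
qed

text \<open>
  If \<open>r\<^sub>H(b, h) = 1\<close>, then \<open>b = \<lambda>(h)\<^sup>-\<^sup>1\<close> with \<open>h \<in> L\<close>; dividing \<open>(c, g, h)\<close> by \<open>(\<lambda>(h), 1, h) \<in> S\<close> then shows
  that \<open>g \<in> K\<close>, and \<open>P_over_K\<close> applies to \<open>(a, g)\<close>.
\<close>

lemma mid_graph_left: "(x, q, \<one>\<^bsub>QH\<^esub>) \<in> mid_graph \<longleftrightarrow> (\<exists>k\<in>GS.Kt. q = GS.incl k \<and> x = inv\<^bsub>A\<^esub> \<kappa> k)"
proof
  assume "(x, q, \<one>\<^bsub>QH\<^esub>) \<in> mid_graph"
  then obtain a b c g h where x: "(a, g) \<in> PG" "(c, g, h) \<in> S" "(b, h) \<in> PH"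
    "a \<in> carrier A" "b \<in> carrier A" "c \<in> carrier A" "g \<in> carrier G" "h \<in> carrier H"
    "(x, q, \<one>\<^bsub>QH\<^esub>) = (inv\<^bsub>A\<^esub> a \<otimes>\<^bsub>A\<^esub> c \<otimes>\<^bsub>A\<^esub> b, rG (a, g), rH (b, h))" by (rule mid_graphE)
  then have h: "h \<in> L" "b = inv\<^bsub>A\<^esub> lam h" using HS.r_eq_one[OF x(3)] by auto
  have "(lam h, \<one>\<^bsub>G\<^esub>, h) \<in> S" using h S2 by blast
  from S_mult[OF x(2) S_inv[OF this]] have "(c \<otimes>\<^bsub>A\<^esub> b, g, \<one>\<^bsub>H\<^esub>) \<in> S" using x h by simp
  then have g: "g \<in> K" "c \<otimes>\<^bsub>A\<^esub> b = inv\<^bsub>A\<^esub> \<kappa> g" using S1 by blast+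
  obtain k where k: "k \<in> GS.Kt" "a \<otimes>\<^bsub>A\<^esub> \<kappa> g = \<kappa> k" "rG (a, g) = GS.incl k"
    using GS.P_over_K[OF x(1) g(1)] .
  have "x = inv\<^bsub>A\<^esub> a \<otimes>\<^bsub>A\<^esub> (c \<otimes>\<^bsub>A\<^esub> b)" using x by (simp add: GS.A.m_assoc)
  then have "x = inv\<^bsub>A\<^esub> \<kappa> k" using x g by (simp add: k(2)[symmetric] GS.A.inv_mult)
  then show "\<exists>k\<in>GS.Kt. q = GS.incl k \<and> x = inv\<^bsub>A\<^esub> \<kappa> k" using k x by auto
next
  assume "\<exists>k\<in>GS.Kt. q = GS.incl k \<and> x = inv\<^bsub>A\<^esub> \<kappa> k"
  then obtain k where k: "k \<in> GS.Kt" "q = GS.incl k" "x = inv\<^bsub>A\<^esub> \<kappa> k" by blast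
  then show "(x, q, \<one>\<^bsub>QH\<^esub>) \<in> mid_graph"
    using HS.P.one_closed GS.Kt_K by (intro mid_graphI[OF GS.Kt_P S_one]) (auto simp: GS.incl_def)
qed

lemma mid_graph_right: "(x, \<one>\<^bsub>QG\<^esub>, q) \<in> mid_graph \<longleftrightarrow> (\<exists>l\<in>HS.Kt. q = HS.incl l \<and> x = lam l)"
proof
  assume "(x, \<one>\<^bsub>QG\<^esub>, q) \<in> mid_graph"
  then obtain a b c g h where x: "(a, g) \<in> PG" "(c, g, h) \<in> S" "(b, h) \<in> PH"
    "a \<in> carrier A" "b \<in> carrier A" "c \<in> carrier A" "g \<in> carrier G" "h \<in> carrier H"
    "(x, \<one>\<^bsub>QG\<^esub>, q) = (inv\<^bsub>A\<^esub> a \<otimes>\<^bsub>A\<^esub> c \<otimes>\<^bsub>A\<^esub> b, rG (a, g), rH (b, h))" by (rule mid_graphE)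
  then have g: "g \<in> K" "a = inv\<^bsub>A\<^esub> \<kappa> g" using GS.r_eq_one[OF x(1)] by auto
  have "(a, g, \<one>\<^bsub>H\<^esub>) \<in> S" using g S1 by blast
  from S_mult[OF S_inv[OF this] x(2)] have "(inv\<^bsub>A\<^esub> a \<otimes>\<^bsub>A\<^esub> c, \<one>\<^bsub>G\<^esub>, h) \<in> S" using x by simp
  then have h: "h \<in> L" "inv\<^bsub>A\<^esub> a \<otimes>\<^bsub>A\<^esub> c = lam h" using S2 by blast+
  obtain l where l: "l \<in> HS.Kt" "b \<otimes>\<^bsub>A\<^esub> lam h = lam l" "rH (b, h) = HS.incl l"
    using HS.P_over_K[OF x(3) h(1)] .
  have "x = lam l" using x h by (simp add: l(2)[symmetric] GS.A.m_comm)
  then show "\<exists>l\<in>HS.Kt. q = HS.incl l \<and> x = lam l" using l x by auto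
next
  assume "\<exists>l\<in>HS.Kt. q = HS.incl l \<and> x = lam l"
  then obtain l where l: "l \<in> HS.Kt" "q = HS.incl l" "x = lam l" by blast
  then show "(x, \<one>\<^bsub>QG\<^esub>, q) \<in> mid_graph"
    using GS.P.one_closed HS.Kt_K by (intro mid_graphI[OF _ S_one HS.Kt_P]) (auto simp: HS.incl_def)
qed

text \<open>
  The intersection with \<open>A\<close> consists of the \<open>\<kappa>(k)\<^sup>-\<^sup>1\<close> for which \<open>k\<close> becomes trivial in \<open>Q\<^sub>G\<close>.
\<close>

lemma mid_graph_free: "(x, \<one>\<^bsub>QG \<times>\<times> QH\<^esub>) \<in> mid_graph \<Longrightarrow> x = \<one>\<^bsub>A\<^esub>"
proof -
  assume "(x, \<one>\<^bsub>QG \<times>\<times> QH\<^esub>) \<in> mid_graph"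
  then obtain k where k: "k \<in> GS.Kt" "\<one>\<^bsub>QG\<^esub> = GS.incl k" "x = inv\<^bsub>A\<^esub> \<kappa> k" using mid_graph_left by auto
  then have "rG (\<kappa> k, \<one>\<^bsub>G\<^esub>) = \<one>\<^bsub>QG\<^esub>" by (simp add: GS.incl_def)
  then have "\<kappa> k = \<one>\<^bsub>A\<^esub>" using GS.r_eq_one[OF GS.Kt_P[OF k(1)]] by simp
  then show ?thesis using k by simp
qed

lemma mid_graph_covers:
  "p \<in> carrier QG \<Longrightarrow> \<exists>x q. (x, p, q) \<in> mid_graph"
  "q \<in> carrier QH \<Longrightarrow> \<exists>x p. (x, p, q) \<in> mid_graph"
proof -
  assume "p \<in> carrier QG"
  then obtain a g where a: "(a, g) \<in> PG" "p = rG (a, g)" by (rule GS.r_above)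
  obtain c h where c: "(c, g, h) \<in> S" using coverG GS.P_closed(2)[OF a(1)] by blast
  obtain b where "(b, h) \<in> PH" by (rule HS.P_above[OF S_closed(3)[OF c]])
  then show "\<exists>x q. (x, p, q) \<in> mid_graph" using mid_graphI[OF a(1) c] a(2) by blast
next
  assume "q \<in> carrier QH"
  then obtain b h where b: "(b, h) \<in> PH" "q = rH (b, h)" by (rule HS.r_above)
  obtain c g where c: "(c, g, h) \<in> S" using coverH HS.P_closed(2)[OF b(1)] by blast
  obtain a where "(a, g) \<in> PG" by (rule GS.P_above[OF S_closed(2)[OF c]])
  then show "\<exists>x p. (x, p, q) \<in> mid_graph" using mid_graphI[OF _ c b(1)] b(2) by blast
qed

text \<open>
  Two elements of \<open>P\<^sub>G\<close> with the same image in \<open>Q\<^sub>G\<close> differ by some \<open>(\<kappa>(k)\<^sup>-\<^sup>1, k)\<close>, and \<open>(\<kappa>(k)\<^sup>-\<^sup>1, k, 1)\<close> is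
  absorbed by \<open>S\<close>.
\<close>

lemma ins_comp_mid:
  "graph_comp A GS.ins_graph mid_graph = {(c \<otimes>\<^bsub>A\<^esub> b, g, rH (b, h)) | b c g h. (c, g, h) \<in> S \<and> (b, h) \<in> PH}"
    (is "?L = ?R")
proof (intro subset_antisym subsetI)
  fix x assume "x \<in> ?L"
  then obtain a1 g1 y q where 1: "(a1, g1) \<in> PG" "(y, rG (a1, g1), q) \<in> mid_graph" "x = (a1 \<otimes>\<^bsub>A\<^esub> y, g1, q)"
    by (auto simp: graph_comp_def GS.ins_graph_def)
  from 1(2) obtain a b c g h where 2: "(a, g) \<in> PG" "(c, g, h) \<in> S" "(b, h) \<in> PH"
    "a \<in> carrier A" "b \<in> carrier A" "c \<in> carrier A" "g \<in> carrier G" "h \<in> carrier H"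
    "(y, rG (a1, g1), q) = (inv\<^bsub>A\<^esub> a \<otimes>\<^bsub>A\<^esub> c \<otimes>\<^bsub>A\<^esub> b, rG (a, g), rH (b, h))" by (rule mid_graphE)
  then obtain k where k: "k \<in> K" "a1 = a \<otimes>\<^bsub>A\<^esub> inv\<^bsub>A\<^esub> \<kappa> k" "g1 = g \<otimes>\<^bsub>G\<^esub> k"
    using GS.r_eqD[OF 1(1) 2(1)] by auto
  have "(c \<otimes>\<^bsub>A\<^esub> inv\<^bsub>A\<^esub> \<kappa> k, g1, h) \<in> S"
    using S_mult[OF 2(2), of "inv\<^bsub>A\<^esub> \<kappa> k" k "\<one>\<^bsub>H\<^esub>"] S1 k 2 by simp
  moreover have "a1 \<otimes>\<^bsub>A\<^esub> y = (c \<otimes>\<^bsub>A\<^esub> inv\<^bsub>A\<^esub> \<kappa> k) \<otimes>\<^bsub>A\<^esub> b"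
    using k 2 GS.A.mult_cancel_middle[of a "inv\<^bsub>A\<^esub> \<kappa> k" "c \<otimes>\<^bsub>A\<^esub> b"]
    by (simp add: GS.A.m_assoc[symmetric] GS.A.m_comm[of c "inv\<^bsub>A\<^esub> \<kappa> k"])
  ultimately show "x \<in> ?R" using 1(3) 2(3,9) by blast
next
  fix x assume "x \<in> ?R"
  then obtain b c g h where x: "(c, g, h) \<in> S" "(b, h) \<in> PH" "x = (c \<otimes>\<^bsub>A\<^esub> b, g, rH (b, h))" by blast
  obtain a where a: "(a, g) \<in> PG" by (rule GS.P_above[OF S_closed(2)[OF x(1)]])
  have "(inv\<^bsub>A\<^esub> a \<otimes>\<^bsub>A\<^esub> c \<otimes>\<^bsub>A\<^esub> b, rG (a, g), rH (b, h)) \<in> mid_graph" using mid_graphI[OF a x(1,2)] by blast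
  moreover have "(a, g, rG (a, g)) \<in> GS.ins_graph" using a by (auto simp: GS.ins_graph_def)
  moreover have "c \<otimes>\<^bsub>A\<^esub> b = a \<otimes>\<^bsub>A\<^esub> (inv\<^bsub>A\<^esub> a \<otimes>\<^bsub>A\<^esub> c \<otimes>\<^bsub>A\<^esub> b)"
    using GS.P_closed[OF a] HS.P_closed[OF x(2)] S_closed[OF x(1)] by (simp add: GS.A.m_assoc[symmetric])
  ultimately show "x \<in> ?L" unfolding x(3) by (intro graph_compI)
qed

text \<open>
  The same absorption on the right, now by \<open>(\<lambda>(l), 1, l) \<in> S\<close>.
\<close>

lemma ins_comp_mid_comp_del:
  "graph_comp A (graph_comp A GS.ins_graph mid_graph) {(inv\<^bsub>A\<^esub> b, q, h) | b h q. (b, h, q) \<in> HS.ins_graph} = S"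
  unfolding ins_comp_mid
proof (intro subset_antisym subsetI)
  fix x assume "x \<in> graph_comp A {(c \<otimes>\<^bsub>A\<^esub> b, g, rH (b, h)) | b c g h. (c, g, h) \<in> S \<and> (b, h) \<in> PH}
    {(inv\<^bsub>A\<^esub> b, q, h) | b h q. (b, h, q) \<in> HS.ins_graph}"
  then obtain b c g h b1 h1 where x: "(c, g, h) \<in> S" "(b, h) \<in> PH" "(b1, h1) \<in> PH" "rH (b, h) = rH (b1, h1)"
    "x = (c \<otimes>\<^bsub>A\<^esub> b \<otimes>\<^bsub>A\<^esub> inv\<^bsub>A\<^esub> b1, g, h1)"
    by (auto simp: graph_comp_def HS.ins_graph_def)
  obtain l where l: "l \<in> L" "b1 = b \<otimes>\<^bsub>A\<^esub> inv\<^bsub>A\<^esub> lam l" "h1 = h \<otimes>\<^bsub>H\<^esub> l"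
    using HS.r_eqD[OF x(3,2) x(4)[symmetric]] .
  note cl = S_closed[OF x(1)] HS.P_closed[OF x(2)]
  have "(c \<otimes>\<^bsub>A\<^esub> lam l, g, h1) \<in> S"
    using S_mult[OF x(1), of "lam l" "\<one>\<^bsub>G\<^esub>" l] S2 l cl by simp
  moreover have "c \<otimes>\<^bsub>A\<^esub> b \<otimes>\<^bsub>A\<^esub> inv\<^bsub>A\<^esub> b1 = c \<otimes>\<^bsub>A\<^esub> lam l"
  proof -
    have "c \<otimes>\<^bsub>A\<^esub> b \<otimes>\<^bsub>A\<^esub> inv\<^bsub>A\<^esub> b1 = c \<otimes>\<^bsub>A\<^esub> (b \<otimes>\<^bsub>A\<^esub> inv\<^bsub>A\<^esub> b) \<otimes>\<^bsub>A\<^esub> lam l"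
      using l cl by (simp add: GS.A.inv_mult GS.A.m_assoc del: GS.A.r_inv GS.A.Units_r_inv)
    then show ?thesis using cl by simp
  qed
  ultimately show "x \<in> S" using x(5) by simp
next
  fix x assume xS: "x \<in> S"
  obtain c g h where x: "x = (c, g, h)" by (metis prod.collapse)
  with xS have cgh: "(c, g, h) \<in> S" by simp
  obtain b where b: "(b, h) \<in> PH" by (rule HS.P_above[OF S_closed(3)[OF cgh]])
  have "(inv\<^bsub>A\<^esub> b, rH (b, h), h) \<in> {(inv\<^bsub>A\<^esub> b, q, h) | b h q. (b, h, q) \<in> HS.ins_graph}"
    using b unfolding HS.ins_graph_def by blast
  moreover have "c = c \<otimes>\<^bsub>A\<^esub> b \<otimes>\<^bsub>A\<^esub> inv\<^bsub>A\<^esub> b"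
    using S_closed[OF cgh] HS.P_closed[OF b] by (simp add: GS.A.m_assoc)
  moreover have "(c \<otimes>\<^bsub>A\<^esub> b, g, rH (b, h)) \<in>
      {(c \<otimes>\<^bsub>A\<^esub> b, g, rH (b, h)) | b c g h. (c, g, h) \<in> S \<and> (b, h) \<in> PH}"
    using cgh b by blast
  ultimately show "x \<in> graph_comp A {(c \<otimes>\<^bsub>A\<^esub> b, g, rH (b, h)) | b c g h. (c, g, h) \<in> S \<and> (b, h) \<in> PH}
    {(inv\<^bsub>A\<^esub> b, q, h) | b h q. (b, h, q) \<in> HS.ins_graph}"
    unfolding x by (intro graph_compI)
qed

lemma ins_comp_mid_free: "(x, \<one>\<^bsub>G\<^esub>, \<one>\<^bsub>QH\<^esub>) \<in> graph_comp A GS.ins_graph mid_graph \<Longrightarrow> x = \<one>\<^bsub>A\<^esub>"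
proof -
  assume "(x, \<one>\<^bsub>G\<^esub>, \<one>\<^bsub>QH\<^esub>) \<in> graph_comp A GS.ins_graph mid_graph"
  then obtain b c h where x: "(c, \<one>\<^bsub>G\<^esub>, h) \<in> S" "(b, h) \<in> PH" "rH (b, h) = \<one>\<^bsub>QH\<^esub>" "x = c \<otimes>\<^bsub>A\<^esub> b"
    unfolding ins_comp_mid by auto
  then have "h \<in> L" "b = inv\<^bsub>A\<^esub> lam h" "c = lam h" using HS.r_eq_one[OF x(2)] S2 by auto
  then show ?thesis using x by simp
qed

lemma ins_comp_mid_covers: "q \<in> carrier QH \<Longrightarrow> \<exists>x g. (x, g, q) \<in> graph_comp A GS.ins_graph mid_graph"
proof -
  assume "q \<in> carrier QH"
  then obtain b h where b: "(b, h) \<in> PH" "q = rH (b, h)" by (rule HS.r_above)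
  obtain c g where c: "(c, g, h) \<in> S" using coverH HS.P_closed(2)[OF b(1)] by blast
  show ?thesis unfolding ins_comp_mid using b c by blast
qed

end

section \<open>The decomposition\<close>

text \<open>
  Conjugation by \<open>(b, g, h) \<in> S\<close> fixes the component in \<open>A\<close>, so \<open>\<kappa>(g k g\<^sup>-\<^sup>1) = \<kappa>(k)\<close>; injectivity of \<open>\<kappa>\<close>
  finishes.
\<close>

lemma faithful_kernels_central:
  assumes "comm_group A" "group G" "group H" and S: "subgroup S (A \<times>\<times> G \<times>\<times> H)"
  shows "\<lbrakk>\<And>a g. (a, g, \<one>\<^bsub>H\<^esub>) \<in> S \<longleftrightarrow> g \<in> K \<and> a = \<kappa> g; inj_on \<kappa> K;
      \<And>g. g \<in> carrier G \<Longrightarrow> \<exists>a h. (a, g, h) \<in> S\<rbrakk> \<Longrightarrow> K \<subseteq> centre G"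
    and "\<lbrakk>\<And>a h. (a, \<one>\<^bsub>G\<^esub>, h) \<in> S \<longleftrightarrow> h \<in> L \<and> a = lam h; inj_on lam L;
      \<And>h. h \<in> carrier H \<Longrightarrow> \<exists>a g. (a, g, h) \<in> S\<rbrakk> \<Longrightarrow> L \<subseteq> centre H"
proof -
  interpret A: comm_group A by fact
  interpret G: group G by fact
  interpret H: group H by fact
  interpret GH: group "G \<times>\<times> H" by (rule DirProd_group) unfold_locales
  interpret S: subgroup S "A \<times>\<times> G \<times>\<times> H" by fact
  have cl: "a \<in> carrier A" "g \<in> carrier G" "h \<in> carrier H" if "(a, g, h) \<in> S" for a g h
    using that S.subset by auto
  have conj: "(a, g \<otimes>\<^bsub>G\<^esub> g' \<otimes>\<^bsub>G\<^esub> inv\<^bsub>G\<^esub> g, h \<otimes>\<^bsub>H\<^esub> h' \<otimes>\<^bsub>H\<^esub> inv\<^bsub>H\<^esub> h) \<in> S"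
    if s: "(b, g, h) \<in> S" "(a, g', h') \<in> S" for a b g h g' h'
  proof -
    have "b \<otimes>\<^bsub>A\<^esub> a \<otimes>\<^bsub>A\<^esub> inv\<^bsub>A\<^esub> b = a"
      using cl[OF s(1)] cl[OF s(2)] by (simp add: A.m_comm[of b a] A.m_assoc)
    then show ?thesis
      using S.m_closed[OF S.m_closed[OF s] S.m_inv_closed[OF s(1)]] cl[OF s(1)] cl[OF s(2)]
      by (simp add: GH.group_axioms A.group_axioms G.group_axioms H.group_axioms)
  qed
  show "K \<subseteq> centre G"
    if S1: "\<And>a g. (a, g, \<one>\<^bsub>H\<^esub>) \<in> S \<longleftrightarrow> g \<in> K \<and> a = \<kappa> g" and inj: "inj_on \<kappa> K"
      and cover: "\<And>g. g \<in> carrier G \<Longrightarrow> \<exists>a h. (a, g, h) \<in> S"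
  proof
    fix k assume k: "k \<in> K"
    then have kS: "(\<kappa> k, k, \<one>\<^bsub>H\<^esub>) \<in> S" using S1 by blast
    have "k \<otimes>\<^bsub>G\<^esub> g = g \<otimes>\<^bsub>G\<^esub> k" if g: "g \<in> carrier G" for g
    proof -
      obtain b h where b: "(b, g, h) \<in> S" using cover g by blast
      have "(\<kappa> k, g \<otimes>\<^bsub>G\<^esub> k \<otimes>\<^bsub>G\<^esub> inv\<^bsub>G\<^esub> g, \<one>\<^bsub>H\<^esub>) \<in> S" using conj[OF b kS] cl[OF b] by simp
      then have "g \<otimes>\<^bsub>G\<^esub> k \<otimes>\<^bsub>G\<^esub> inv\<^bsub>G\<^esub> g = k" using S1 k inj by (auto simp: inj_on_def)
      then show ?thesis using g cl(2)[OF kS] by (metis G.inv_solve_right G.m_closed)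
    qed
    then show "k \<in> centre G" using cl(2)[OF kS] by (simp add: centre_def)
  qed
  show "L \<subseteq> centre H"
    if S2: "\<And>a h. (a, \<one>\<^bsub>G\<^esub>, h) \<in> S \<longleftrightarrow> h \<in> L \<and> a = lam h" and inj: "inj_on lam L"
      and cover: "\<And>h. h \<in> carrier H \<Longrightarrow> \<exists>a g. (a, g, h) \<in> S"
  proof
    fix l assume l: "l \<in> L"
    then have lS: "(lam l, \<one>\<^bsub>G\<^esub>, l) \<in> S" using S2 by blast
    have "l \<otimes>\<^bsub>H\<^esub> h = h \<otimes>\<^bsub>H\<^esub> l" if h: "h \<in> carrier H" for h
    proof -
      obtain b g where b: "(b, g, h) \<in> S" using cover h by blast
      have "(lam l, \<one>\<^bsub>G\<^esub>, h \<otimes>\<^bsub>H\<^esub> l \<otimes>\<^bsub>H\<^esub> inv\<^bsub>H\<^esub> h) \<in> S" using conj[OF b lS] cl[OF b] by simp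
      then have "h \<otimes>\<^bsub>H\<^esub> l \<otimes>\<^bsub>H\<^esub> inv\<^bsub>H\<^esub> h = l" using S2 l inj by (auto simp: inj_on_def)
      then show ?thesis using h cl(3)[OF lS] by (metis H.inv_solve_right H.m_closed)
    qed
    then show "l \<in> centre H" using cl(3)[OF lS] by (simp add: centre_def)
  qed
qed

theorem proposition10p12:
  fixes A :: "'a monoid" and G :: "'g monoid" and H :: "'h monoid"
    and \<pi> :: "nat set"
    and U :: "('g \<times> 'h) set" and \<phi> :: "'g \<times> 'h \<Rightarrow> 'a"
    and K :: "'g set" and L :: "'h set" and \<kappa> :: "'g \<Rightarrow> 'a" and lam :: "'h \<Rightarrow> 'a"
    and k :: "'k::comm_ring_1 itself"
  assumes "comm_group A"
    and "\<And>p. p \<in> \<pi> \<Longrightarrow> prime p"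
    and "\<And>n::nat. n > 0 \<Longrightarrow>
           cyclic_group (A\<lparr>carrier := {a \<in> carrier A. a [^]\<^bsub>A\<^esub> n = \<one>\<^bsub>A\<^esub>}\<rparr>) \<and>
           card {a \<in> carrier A. a [^]\<^bsub>A\<^esub> n = \<one>\<^bsub>A\<^esub>} = pi_part \<pi> n"
    and "group G" "finite (carrier G)"
    and "group H" "finite (carrier H)"
    and "(U, \<phi>) \<in> char_pairs A (G \<times>\<times> H)"
    and "fst ` U = carrier G" "snd ` U = carrier H"
    and "K = k1 G H U" "L = k2 G H U"
    and "\<kappa> = char1 G H U \<phi>" "lam = char2 A G H U \<phi>"
    and "inj_on \<kappa> K" "inj_on lam L"
  shows "\<exists>(Gt :: nat monoid) (iG :: 'g \<Rightarrow> nat) (pG :: nat \<Rightarrow> 'g set)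
          (Ht :: nat monoid) (iH :: 'h \<Rightarrow> nat) (pH :: nat \<Rightarrow> 'h set)
          (Ins :: ('a, 'g, nat, ('a \<times> 'g \<times> nat) set) fbiset)
          (Y :: ('a, nat, nat, ('a \<times> nat \<times> nat) set) fbiset)
          (Del :: ('a, nat, 'h, ('a \<times> 'h \<times> nat) set) fbiset)
          (Ut :: (nat \<times> nat) set) (\<phi>t :: nat \<times> nat \<Rightarrow> 'a).
     insertion_biset A G K \<kappa> Gt iG pG Ins \<and>
     deletion_biset A H L lam Ht iH pH Del \<and>
     fibered_biset A Gt Ht Y \<and>
     fbiset_iso A G H (trans_biset A G H U \<phi>)
       (tensor A G Ht H (tensor A G Gt Ht Ins Y) Del) \<and>
     central_extension (G\<lparr>carrier := K \<inter> derived G (carrier G)\<rparr>) Gt (G Mod K) iG pG \<and>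
     central_extension (H\<lparr>carrier := L \<inter> derived H (carrier H)\<rparr>) Ht (H Mod L) iH pH \<and>
     fbiset_iso A Gt Ht Y (trans_biset A Gt Ht Ut \<phi>t) \<and>
     reduced_pair k A Gt Ht Ut \<phi>t \<and>
     k1 Gt Ht Ut = iG ` (K \<inter> derived G (carrier G)) \<and>
     k2 Gt Ht Ut = iH ` (L \<inter> derived H (carrier H)) \<and>
     (\<forall>x\<in>K \<inter> derived G (carrier G). char1 Gt Ht Ut \<phi>t (iG x) = \<kappa> x) \<and>
     (\<forall>x\<in>L \<inter> derived H (carrier H). char2 A Gt Ht Ut \<phi>t (iH x) = lam x)"
proof -
  interpret A: comm_group A by fact
  interpret G: group G by fact
  interpret H: group H by fact
  have GH: "group (G \<times>\<times> H)" by (rule DirProd_group) unfold_locales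
  have root: "\<exists>b\<in>carrier A. b [^]\<^bsub>A\<^esub> n = a"
    if "a \<in> carrier A" "a [^]\<^bsub>A\<^esub> e = \<one>\<^bsub>A\<^esub>" "e > 0" "n > 0" for a and e n :: nat
    by (rule torsion_root[OF assms(1,2) _ that]) (use assms(3) in blast)+
  have U: "U \<subseteq> carrier G \<times> carrier H"
    using assms(8) subgroup.subset[of U "G \<times>\<times> H"] by (simp add: char_pairs_def)
  define S where "S = twisted_graph A U \<phi>"
  have S: "subgroup S (A \<times>\<times> G \<times>\<times> H)"
    unfolding S_def by (rule subgroup_twisted_graph(1)[OF assms(1) GH assms(8)])
  have memS: "(a, g, h) \<in> S \<longleftrightarrow> (g, h) \<in> U \<and> a = inv\<^bsub>A\<^esub> \<phi> (g, h)" for a g h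
    by (simp add: S_def mem_twisted_graph)
  have S1: "(a, g, \<one>\<^bsub>H\<^esub>) \<in> S \<longleftrightarrow> g \<in> K \<and> a = inv\<^bsub>A\<^esub> \<kappa> g" for a g
    using U by (auto simp: memS assms(11,13) char1_def k1_def)
  have S2: "(a, \<one>\<^bsub>G\<^esub>, h) \<in> S \<longleftrightarrow> h \<in> L \<and> a = lam h" for a h
    using U by (auto simp: memS assms(12,14) char2_def k2_def)
  have coverG: "\<exists>a h. (a, g, h) \<in> S" if "g \<in> carrier G" for g
    using that unfolding memS assms(9)[symmetric] by force
  have coverH: "\<exists>a g. (a, g, h) \<in> S" if "h \<in> carrier H" for h
    using that unfolding memS assms(10)[symmetric] by force
  have K: "subgroup K G" "\<kappa> \<in> characters A G K" and L: "subgroup L H" "lam \<in> characters A H L"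
    using char_parts_char_pairs[OF assms(1,4,6,8)] by (simp_all add: assms(11-14) char_pairs_def)
  have "inj_on (\<lambda>k. inv\<^bsub>A\<^esub> \<kappa> k) K"
  proof (rule inj_onI)
    fix x y assume xy: "x \<in> K" "y \<in> K" "inv\<^bsub>A\<^esub> \<kappa> x = inv\<^bsub>A\<^esub> \<kappa> y"
    then have "\<kappa> x = \<kappa> y" using K(2) by (auto simp: characters_def hom_def dest!: A.inv_inj[THEN inj_onD])
    then show "x = y" using xy assms(15) by (auto simp: inj_on_def)
  qed
  then have Kc: "K \<subseteq> centre G" by (rule faithful_kernels_central(1)[OF assms(1,4,6) S S1 _ coverG])
  have Lc: "L \<subseteq> centre H" by (rule faithful_kernels_central(2)[OF assms(1,4,6) S S2 assms(16) coverH])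
  obtain PG and QG :: "nat monoid" and rG where
    GS: "torsion_splitting A G K \<kappa> PG QG rG" and finG: "finite (carrier QG)"
    by (rule exists_torsion_splitting_nat[OF assms(1,4,5) root K(1) Kc K(2) assms(15)]) (assumption | blast)+
  obtain PH and QH :: "nat monoid" and rH where
    HS: "torsion_splitting A H L lam PH QH rH" and finH: "finite (carrier QH)"
    by (rule exists_torsion_splitting_nat[OF assms(1,6,7) root L(1) Lc L(2) assms(16)]) (assumption | blast)+
  interpret biset_splitting A G K \<kappa> PG QG rG H L lam PH QH rH S
    by (intro biset_splitting.intro biset_splitting_axioms.intro GS HS S S1 S2 coverG coverH)
  obtain M \<mu> where M: "(M, \<mu>) \<in> char_pairs A (G \<times>\<times> QG)" "twisted_graph A M \<mu> = GS.ins_graph"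
    "insertion_biset A G K \<kappa> QG GS.incl GS.proj (trans_biset A G QG M \<mu>)"
    by (rule GS.insertion_biset_ins_graph)
  obtain N \<nu> where N: "(N, \<nu>) \<in> char_pairs A (H \<times>\<times> QH)" "twisted_graph A N \<nu> = HS.ins_graph"
    "insertion_biset A H L lam QH HS.incl HS.proj (trans_biset A H QH N \<nu>)"
    by (rule HS.insertion_biset_ins_graph)
  obtain Ut \<phi>t where Ut: "(Ut, \<phi>t) \<in> char_pairs A (QG \<times>\<times> QH)" "twisted_graph A Ut \<phi>t = mid_graph"
    by (rule char_pairs_twisted_graph[OF assms(1) QQ.group_axioms subgroup_mid_graph mid_graph_free])
  let ?Ins = "trans_biset A G QG M \<mu>"
  let ?Y = "trans_biset A QG QH Ut \<phi>t"
  let ?Del = "op_biset A (trans_biset A H QH N \<nu>)"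
  note QGg = GS.Q.group_axioms and QHg = HS.Q.group_axioms
  have tIns: "transitive_at A G QG ?Ins GS.ins_graph GS.ins_graph"
    using transitive_at_trans_biset[OF assms(1,4) QGg M(1)] by (simp only: M(2))
  have tY: "transitive_at A QG QH ?Y mid_graph mid_graph"
    using transitive_at_trans_biset[OF assms(1) QGg QHg Ut(1)] by (simp only: Ut(2))
  have tDel: "transitive_at A QH H ?Del HS.ins_graph {(inv\<^bsub>A\<^esub> b, q, h) | b h q. (b, h, q) \<in> HS.ins_graph}"
    using transitive_at_op_biset[OF assms(1,6) QHg transitive_at_trans_biset[OF assms(1,6) QHg N(1)]]
    by (simp only: N(2))
  have tX: "transitive_at A G H (trans_biset A G H U \<phi>) S S"
    unfolding S_def by (rule transitive_at_trans_biset[OF assms(1,4,6,8)])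
  obtain z where "transitive_at A G QH (tensor A G QG QH ?Ins ?Y) z (graph_comp A GS.ins_graph mid_graph)"
  proof (rule tensor_transitive_at[OF assms(1,4) QGg QHg tIns tY])
    show "\<exists>c g. (c, g, q) \<in> GS.ins_graph" if "q \<in> carrier QG" for q
      using that by (auto simp: GS.ins_graph_def elim!: GS.r_above)
  qed (use ins_comp_mid_free in blast)+
  then obtain w where "transitive_at A G H (tensor A G QH H (tensor A G QG QH ?Ins ?Y) ?Del) w
      (graph_comp A (graph_comp A GS.ins_graph mid_graph) {(inv\<^bsub>A\<^esub> b, q, h) | b h q. (b, h, q) \<in> HS.ins_graph})"
  proof (rule tensor_transitive_at[OF assms(1,4) QHg assms(6) _ tDel])
    show "a = \<one>\<^bsub>A\<^esub>" if "(a, \<one>\<^bsub>G\<^esub>, \<one>\<^bsub>H\<^esub>) \<in> graph_comp A (graph_comp A GS.ins_graph mid_graph)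
        {(inv\<^bsub>A\<^esub> b, q, h) | b h q. (b, h, q) \<in> HS.ins_graph}" for a
      using that unfolding ins_comp_mid_comp_del S1 by simp
  qed (use ins_comp_mid_covers in blast)+
  then have tT: "transitive_at A G H (tensor A G QH H (tensor A G QG QH ?Ins ?Y) ?Del) w S"
    by (simp only: ins_comp_mid_comp_del)
  have iso: "fbiset_iso A G H (trans_biset A G H U \<phi>) (tensor A G QH H (tensor A G QG QH ?Ins ?Y) ?Del)"
    by (rule fbiset_iso_if_same_stabilizer[OF tX tT])
  note parts = char_parts_twisted_graph[OF assms(1) Ut]
  have k1: "k1 QG QH Ut = GS.incl ` GS.Kt"
    unfolding set_eq_iff parts(2) mid_graph_left by blast
  have k2: "k2 QG QH Ut = HS.incl ` HS.Kt"
    unfolding set_eq_iff parts(3) mid_graph_right by blast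
  have c1: "char1 QG QH Ut \<phi>t (GS.incl k) = \<kappa> k" if "k \<in> GS.Kt" for k
    using parts(4)[of "inv\<^bsub>A\<^esub> \<kappa> k" "GS.incl k"] mid_graph_left that GS.Kt_K by auto
  have c2: "char2 A QG QH Ut \<phi>t (HS.incl l) = lam l" if "l \<in> HS.Kt" for l
    using parts(5)[of "lam l" "HS.incl l"] mid_graph_right that by blast
  have inj1: "inj_on (char1 QG QH Ut \<phi>t) (k1 QG QH Ut)"
    unfolding k1 using c1 assms(15) GS.Kt_K by (auto simp: inj_on_def)
  have inj2: "inj_on (char2 A QG QH Ut \<phi>t) (k2 QG QH Ut)"
    unfolding k2 using c2 assms(16) HS.Kt_K by (auto simp: inj_on_def)
  note ch = char_parts_char_pairs[OF assms(1) QGg QHg Ut(1)]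
  have "reduced_pair k A QG QH Ut \<phi>t"
    unfolding reduced_pair_def
  proof (intro conjI Ut(1))
    have sub: "mid_graph \<subseteq> carrier (A \<times>\<times> QG \<times>\<times> QH)" by (rule subgroup.subset[OF subgroup_mid_graph])
    show "fst ` Ut = carrier QG"
    proof (intro subset_antisym subsetI)
      fix p assume "p \<in> carrier QG"
      then obtain x q where "(x, p, q) \<in> mid_graph" using mid_graph_covers(1) by blast
      then have "fst (snd (x, p, q)) \<in> fst ` snd ` mid_graph" by (intro imageI)
      then show "p \<in> fst ` Ut" by (simp only: parts(1) fst_conv snd_conv)
    qed (use sub in \<open>auto simp: parts(1)\<close>)
    show "snd ` Ut = carrier QH"
    proof (intro subset_antisym subsetI)
      fix q assume "q \<in> carrier QH"
      then obtain x p where "(x, p, q) \<in> mid_graph" using mid_graph_covers(2) by blast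
      then have "snd (snd (x, p, q)) \<in> snd ` snd ` mid_graph" by (intro imageI)
      then show "q \<in> snd ` Ut" by (simp only: parts(1) snd_conv)
    qed (use sub in \<open>auto simp: parts(1)\<close>)
    show "(k1 QG QH Ut, char1 QG QH Ut \<phi>t) \<in> R_pairs k A QG"
    proof (rule central_commutator_character_reduced[OF assms(1) QGg finG _ _ _ _ inj1])
      show "k1 QG QH Ut \<subseteq> centre QG" unfolding k1 by (rule GS.incl_central)
      show "k1 QG QH Ut \<subseteq> derived QG (carrier QG)" unfolding k1 by (rule GS.incl_derived)
    qed (use ch(1) in \<open>simp_all add: char_pairs_def\<close>)
    show "(k2 QG QH Ut, char2 A QG QH Ut \<phi>t) \<in> R_pairs k A QH"
    proof (rule central_commutator_character_reduced[OF assms(1) QHg finH _ _ _ _ inj2])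
      show "k2 QG QH Ut \<subseteq> centre QH" unfolding k2 by (rule HS.incl_central)
      show "k2 QG QH Ut \<subseteq> derived QH (carrier QH)" unfolding k2 by (rule HS.incl_derived)
    qed (use ch(2) in \<open>simp_all add: char_pairs_def\<close>)
  qed
  moreover have "fibered_biset A QG QH ?Y"
    by (rule fibered_biset_trans_biset[OF assms(1) QGg QHg finG finH Ut(1)])
  moreover have "deletion_biset A H L lam QH HS.incl HS.proj ?Del"
    unfolding deletion_biset_def using N(3) by blast
  moreover have "central_extension (G\<lparr>carrier := GS.Kt\<rparr>) QG (G Mod K) GS.incl GS.proj"
    unfolding central_extension_def using GS.short_exact_incl_proj GS.incl_central by simp
  moreover have "central_extension (H\<lparr>carrier := HS.Kt\<rparr>) QH (H Mod L) HS.incl HS.proj"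
    unfolding central_extension_def using HS.short_exact_incl_proj HS.incl_central by simp
  moreover have "fbiset_iso A QG QH ?Y (trans_biset A QG QH Ut \<phi>t)"
    by (rule fbiset_iso_if_same_stabilizer[OF tY tY])
  ultimately show ?thesis
    unfolding GS.Kt_def[symmetric] HS.Kt_def[symmetric] using M(3) iso k1 k2 c1 c2 by blast
qed

end
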